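(* Consider a completely randomized $2^K$ factorial design (setup in the context), and let $\hat{\mathbb M}$ be the output of the forward factorial screening procedure run with maximal level $D\le K$, significance levels $\alpha_1,\dots,\alpha_D$ and a fixed heredity type (weak or strong). Assume (C1) the nearly uniform design condition, (C2) the order-of-parameters condition for this $D$, (C3) the regularity conditions on the potential outcomes, and (C4) the heredity condition of the same type as the one used in the procedure, all as stated in the context. Then $$\lim_{N\to\infty}\mathbb P\big(\hat{\mathbb M}\setminus\{\emptyset\}=\mathbb M^\star_{1:D}\big)=1 .$$
   Context: Setup. Let $K\ge 2$, $[K]=\{1,\dots,K\}$, $\mathcal T=\{0,1\}^K$ with $Q=2^K$ elements $z=(z_1,\dots,z_K)$ ordered lexicographically. For $\mathcal K\subseteq[K]$ let $g_{\mathcal K}\in\mathbb R^Q$ with $g_{\mathcal K}(z)=\prod_{k\in\mathcal K}(2z_k-1)$, $g_\emptyset=\mathbf 1_Q$. There are $N$ units with potential outcomes $Y_i(z)$, $z\in\mathcal T$; $\bar Y(z)=N^{-1}\sum_i Y_i(z)$, $\bar Y=(\bar Y(z))_{z}$, $S(z,z')=(N-1)^{-1}\sum_i (Y_i(z)-\bar Y(z))(Y_i(z')-\bar Y(z'))$. Factorial effects: $\tau_{\mathcal K}=Q^{-1}g_{\mathcal K}^\top\bar Y$. A parent of $\mathcal K$ is any $\mathcal K'\subset\mathcal K$ with $|\mathcal K'|=|\mathcal K|-1$. Design: fixed integers $N(z)\ge2$ with $\sum_z N(z)=N$; the assignment $(Z_1,\dots,Z_N)$ is uniform over all assignments putting exactly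 $N(z)$ units at level $z$; observed $Y_i=Y_i(Z_i)$. $\hat Y(z)=N(z)^{-1}\sum_{i:Z_i=z}Y_i$, $\hat S(z,z)=(N(z)-1)^{-1}\sum_{i:Z_i=z}(Y_i-\hat Y(z))^2$, $\hat Y=(\hat Y(z))_z$, $\hat V_{\hat Y}=\mathrm{diag}(N(z)^{-1}\hat S(z,z))_z$. For $d\in[K]$, $\mathbb M^\star_d=\{\mathcal K\subseteq[K]:|\mathcal K|=d,\ \tau_{\mathcal K}\neq0\}$ and $\mathbb M^\star_{1:D}=\bigcup_{d=1}^D\mathbb M^\star_d$. Forward screening procedure: set $\hat{\mathbb M}=\{\emptyset\}$. For $d=1,\dots,D$: let $C_d$ be the set of $\mathcal K$ with $|\mathcal K|=d$ such that at least one parent of $\mathcal K$ lies in $\hat{\mathbb M}$ (weak heredity) or all parents of $\mathcal K$ lie in $\hat{\mathbb M}$ (strong heredity); for each $\mathcal K\in C_d$ compute $\hat\tau_{\mathcal K}=Q^{-1}g_{\mathcal K}^\top\hat Y$ and $\hat\sigma_{\mathcal K}^2=Q^{-2}g_{\mathcal K}^\top\hat V_{\hat Y}g_{\mathcal K}$, and retain $\mathcal K$ iff the two-sided marginal t-test rejects at level $\min\{\alpha_d/|C_d|,1\}$, i.e. $|\hat\tau_{\mathcal K}/\hat\sigma_{\mathcal K}|\ge\Phi^{-1}(1-\min\{\alpha_d/|C_d|,1\}/2)$ ($\Phi$ the standard normal cdf); add the retained indices to $\hat{\mathbb M}$. Output $\hat{\mathbb M}$. Asymptotics: all quantities may vary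 with $N$; limits are as $N\to\infty$; constants below do not depend on $N$. (C1) There are a positive integer $N_0$ and constants $0<\underline c\le\overline c$ with $N(z)=c(z)N_0\ge2$, $\underline c\le c(z)\le\overline c$ for all $z$. (C2) (i) $|\tau_{\mathcal K}|=\Theta(N^{\delta})$ for all $\mathcal K\in\mathbb M^\star_{1:D}$, some $-1/2<\delta\le0$; (ii) $\alpha_d=\Theta(N^{-\delta'})$ for all $d\in[D]$, some $\delta'>0$; (iii) $\sum_{d=1}^D|\mathbb M^\star_d|=\Theta(N^{\delta''})$ for some $0\le\delta''<1/3$. (C3) (i) the correlation matrix of $\hat Y$ has condition number at most $\sigma^2$ for a constant $\sigma>0$; (ii) $\max_z N^{-1}\sum_i(Y_i(z)-\bar Y(z))^4\le\Delta^4$ for a constant $\Delta$; (iii) $\max_{i,z}|Y_i(z)-\bar Y(z)|/\{\min_z S(z,z)\}^{1/2}\le M$ for a constant $M$. (C4) Weak heredity: $\tau_{\mathcal K}\ne0$ only if some parent $\mathcal K'$ of $\mathcal K$ has $\tau_{\mathcal K'}\ne0$; strong heredity: $\tau_{\mathcal K}\ne0$ only if every parent $\mathcal K'$ has $\tau_{\mathcal K'}\ne0$. *)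

theory Defs
  imports "HOL-Probability.Probability"
begin

definition Phi :: "real \<Rightarrow> real" where
  "Phi x = measure (density lborel std_normal_density) {..x}"

definition Phi_inv :: "real \<Rightarrow> real" where
  "Phi_inv p = (THE x. Phi x = p)"

text \<open>A treatment level z in {0,1}^K is encoded as the set of k in [K] with z_k = 1;
  a factorial index set is a subset of [K] = {1..K}.\<close>

definition levels :: "nat \<Rightarrow> nat set set" where
  "levels K = Pow {1..K}"

definition gvec :: "nat set \<Rightarrow> nat set \<Rightarrow> real" where
  "gvec \<K> z = (\<Prod>k\<in>\<K>. (2 * (if k \<in> z then 1 else 0) - 1))"

definition parents :: "nat set \<Rightarrow> nat set set" where
  "parents \<K> = {\<K>'. \<K>' \<subset> \<K> \<and> card \<K>' = card \<K> - 1}"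

definition Ybar :: "nat \<Rightarrow> (nat \<Rightarrow> nat set \<Rightarrow> real) \<Rightarrow> nat set \<Rightarrow> real" where
  "Ybar N Y z = (\<Sum>i<N. Y i z) / real N"

definition Spop :: "nat \<Rightarrow> (nat \<Rightarrow> nat set \<Rightarrow> real) \<Rightarrow> nat set \<Rightarrow> nat set \<Rightarrow> real" where
  "Spop N Y z z' = (\<Sum>i<N. (Y i z - Ybar N Y z) * (Y i z' - Ybar N Y z')) / (real N - 1)"

definition tau :: "nat \<Rightarrow> nat \<Rightarrow> (nat \<Rightarrow> nat set \<Rightarrow> real) \<Rightarrow> nat set \<Rightarrow> real" where
  "tau K N Y \<K> = (\<Sum>z\<in>levels K. gvec \<K> z * Ybar N Y z) / 2 ^ K"

definition Mstar :: "nat \<Rightarrow> nat \<Rightarrow> (nat \<Rightarrow> nat set \<Rightarrow> real) \<Rightarrow> nat \<Rightarrow> nat set set" where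
  "Mstar K N Y d = {\<K>. \<K> \<subseteq> {1..K} \<and> card \<K> = d \<and> tau K N Y \<K> \<noteq> 0}"

definition Mstar_upto :: "nat \<Rightarrow> nat \<Rightarrow> (nat \<Rightarrow> nat set \<Rightarrow> real) \<Rightarrow> nat \<Rightarrow> nat set set" where
  "Mstar_upto K N Y D = (\<Union>d\<in>{1..D}. Mstar K N Y d)"

text \<open>Assignments: Z i is the level of unit i (i < N); Z i = {} for i >= N (normalisation).\<close>

definition assignments :: "nat \<Rightarrow> nat \<Rightarrow> (nat set \<Rightarrow> nat) \<Rightarrow> (nat \<Rightarrow> nat set) set" where
  "assignments K N Nz = {Z. (\<forall>i<N. Z i \<in> levels K) \<and> (\<forall>i. N \<le> i \<longrightarrow> Z i = {}) \<and>
      (\<forall>z\<in>levels K. card {i. i < N \<and> Z i = z} = Nz z)}"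

definition CRE :: "nat \<Rightarrow> nat \<Rightarrow> (nat set \<Rightarrow> nat) \<Rightarrow> (nat \<Rightarrow> nat set) pmf" where
  "CRE K N Nz = pmf_of_set (assignments K N Nz)"

definition Yhat :: "nat \<Rightarrow> (nat set \<Rightarrow> nat) \<Rightarrow> (nat \<Rightarrow> nat set \<Rightarrow> real) \<Rightarrow> (nat \<Rightarrow> nat set) \<Rightarrow> nat set \<Rightarrow> real" where
  "Yhat N Nz Y Z z = (\<Sum>i\<in>{i. i < N \<and> Z i = z}. Y i (Z i)) / real (Nz z)"

definition Shat :: "nat \<Rightarrow> (nat set \<Rightarrow> nat) \<Rightarrow> (nat \<Rightarrow> nat set \<Rightarrow> real) \<Rightarrow> (nat \<Rightarrow> nat set) \<Rightarrow> nat set \<Rightarrow> real" where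
  "Shat N Nz Y Z z = (\<Sum>i\<in>{i. i < N \<and> Z i = z}. (Y i (Z i) - Yhat N Nz Y Z z)^2) / (real (Nz z) - 1)"

definition tau_hat :: "nat \<Rightarrow> nat \<Rightarrow> (nat set \<Rightarrow> nat) \<Rightarrow> (nat \<Rightarrow> nat set \<Rightarrow> real) \<Rightarrow> (nat \<Rightarrow> nat set) \<Rightarrow> nat set \<Rightarrow> real" where
  "tau_hat K N Nz Y Z \<K> = (\<Sum>z\<in>levels K. gvec \<K> z * Yhat N Nz Y Z z) / 2 ^ K"

definition sigma_hat_sq :: "nat \<Rightarrow> nat \<Rightarrow> (nat set \<Rightarrow> nat) \<Rightarrow> (nat \<Rightarrow> nat set \<Rightarrow> real) \<Rightarrow> (nat \<Rightarrow> nat set) \<Rightarrow> nat set \<Rightarrow> real" where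
  "sigma_hat_sq K N Nz Y Z \<K> =
     (\<Sum>z\<in>levels K. gvec \<K> z * (Shat N Nz Y Z z / real (Nz z)) * gvec \<K> z) / (2 ^ K)^2"

datatype heredity = Weak | Strong

definition candidates :: "heredity \<Rightarrow> nat \<Rightarrow> nat \<Rightarrow> nat set set \<Rightarrow> nat set set" where
  "candidates h K d M = {\<K>. \<K> \<subseteq> {1..K} \<and> card \<K> = d \<and>
      (case h of Weak \<Rightarrow> (\<exists>\<K>'\<in>parents \<K>. \<K>' \<in> M) | Strong \<Rightarrow> (\<forall>\<K>'\<in>parents \<K>. \<K>' \<in> M))}"

definition retained :: "heredity \<Rightarrow> nat \<Rightarrow> nat \<Rightarrow> (nat set \<Rightarrow> nat) \<Rightarrow> (nat \<Rightarrow> nat set \<Rightarrow> real) \<Rightarrow>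
    (nat \<Rightarrow> real) \<Rightarrow> (nat \<Rightarrow> nat set) \<Rightarrow> nat \<Rightarrow> nat set set \<Rightarrow> nat set set" where
  "retained h K N Nz Y \<alpha> Z d M =
     (let C = candidates h K d M in
      {\<K>\<in>C. \<bar>tau_hat K N Nz Y Z \<K> / sqrt (sigma_hat_sq K N Nz Y Z \<K>)\<bar>
               \<ge> Phi_inv (1 - min (\<alpha> d / real (card C)) 1 / 2)})"

fun screen :: "heredity \<Rightarrow> nat \<Rightarrow> nat \<Rightarrow> (nat set \<Rightarrow> nat) \<Rightarrow> (nat \<Rightarrow> nat set \<Rightarrow> real) \<Rightarrow>
    (nat \<Rightarrow> real) \<Rightarrow> (nat \<Rightarrow> nat set) \<Rightarrow> nat \<Rightarrow> nat set set" where
  "screen h K N Nz Y \<alpha> Z 0 = {{}}"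
| "screen h K N Nz Y \<alpha> Z (Suc d) =
     (let M = screen h K N Nz Y \<alpha> Z d in M \<union> retained h K N Nz Y \<alpha> Z (Suc d) M)"

definition cov_Yhat :: "nat \<Rightarrow> nat \<Rightarrow> (nat set \<Rightarrow> nat) \<Rightarrow> (nat \<Rightarrow> nat set \<Rightarrow> real) \<Rightarrow> nat set \<Rightarrow> nat set \<Rightarrow> real" where
  "cov_Yhat K N Nz Y z z' =
     (let P = CRE K N Nz;
          m = (\<lambda>w. measure_pmf.expectation P (\<lambda>Z. Yhat N Nz Y Z w))
      in measure_pmf.expectation P (\<lambda>Z. (Yhat N Nz Y Z z - m z) * (Yhat N Nz Y Z z' - m z')))"

definition corr_Yhat :: "nat \<Rightarrow> nat \<Rightarrow> (nat set \<Rightarrow> nat) \<Rightarrow> (nat \<Rightarrow> nat set \<Rightarrow> real) \<Rightarrow> nat set \<Rightarrow> nat set \<Rightarrow> real" where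
  "corr_Yhat K N Nz Y z z' =
     cov_Yhat K N Nz Y z z' / sqrt (cov_Yhat K N Nz Y z z * cov_Yhat K N Nz Y z' z')"

definition eigenvalues_on :: "'i set \<Rightarrow> ('i \<Rightarrow> 'i \<Rightarrow> real) \<Rightarrow> real set" where
  "eigenvalues_on I A = {l. \<exists>x. (\<exists>j\<in>I. x j \<noteq> 0) \<and> (\<forall>j\<in>I. (\<Sum>k\<in>I. A j k * x k) = l * x j)}"

text \<open>Condition number of a symmetric positive definite matrix: lambda_max / lambda_min.\<close>
definition condition_number :: "'i set \<Rightarrow> ('i \<Rightarrow> 'i \<Rightarrow> real) \<Rightarrow> real" where
  "condition_number I A = Max (eigenvalues_on I A) / Min (eigenvalues_on I A)"

end

theory Submission
  imports Defs "HOL-Real_Asymp.Real_Asymp"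
begin

text \<open>
  No central limit theorem is needed: a Chernoff bound with the exact Gaussian constant suffices,
  because \<open>1 - Phi t \<ge> C exp (- (1 + \<eta>) t\<^sup>2 / 2)\<close> turns a tail \<open>exp (- (1 - \<epsilon>) t\<^sup>2 / 2)\<close> at the
  critical value into a power of the nominal level, with exponent as close to 1 as desired. There are
  at most \<open>2 ^ K \<le> N\<close> candidates per stage, so a union bound over \<open>D \<le> log\<^sub>2 N\<close> stages is enough.

  The Chernoff bound comes from exchanging the levels of two units, which preserves the uniform law on
  assignments. For a doubly centred statistic \<open>X = \<Sum>i. a i (Z i)\<close>, averaging over exchanges of unit
  \<open>i\<close> with a uniformly chosen unit removes the zeroth order term of \<open>E (a i (Z i) exp (s X))\<close>; its first order
  term is the moment generating function times \<open>s\<close> times a constant, plus a quadratic form which a second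
  exchange shows to be negligible. Summed over \<open>i\<close>, the constants give
  \<open>V = (1 / N) \<Sum>i. \<Sum>j. (a i (Z j))\<^sup>2\<close>. Integrating in \<open>s\<close> bounds the moment generating function by
  \<open>exp (V / 2 + o(1))\<close>, and \<open>V\<close> is at most the mean of the (conservative) variance estimator.

  Since all contrasts have entries \<open>\<plusminus>1\<close>, the variance estimator is the same for every effect, so its
  concentration is needed only once. Chebyshev suffices: the generator of the exchange dynamics maps the
  squared group sums to multiples of themselves plus linear statistics.
\<close>

section \<open>Exchanging two units\<close>

lemma exp_minus_one_bounds:
  fixes x :: real
  assumes "\<bar>x\<bar> \<le> 1"
  shows "\<bar>exp x - 1 - x\<bar> \<le> x\<^sup>2" "\<bar>exp x - 1\<bar> \<le> 2 * \<bar>x\<bar>"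
proof -
  show 1: "\<bar>exp x - 1 - x\<bar> \<le> x\<^sup>2"
  proof (cases "x \<ge> 0")
    case True
    have "exp x \<le> 1 + x + x\<^sup>2" using True assms by (intro exp_bound) auto
    moreover have "1 + x \<le> exp x" by (rule exp_ge_add_one_self)
    moreover have "0 \<le> x\<^sup>2" by simp
    ultimately show ?thesis by linarith
  next
    case False
    have "exp x \<ge> 1 + x" by (rule exp_ge_add_one_self)
    moreover have "exp x \<le> 1 + x + x\<^sup>2"
    proof -
      have "exp x = inverse (exp (- x))" by (simp add: exp_minus)
      also have "\<dots> \<le> inverse (1 - x)"
        using exp_ge_add_one_self[of "-x"] False by (intro le_imp_inverse_le) auto
      also have "\<dots> \<le> 1 + x + x\<^sup>2"
      proof -
        \<comment> \<open>The product equals \<open>1 - x^3\<close>, which is at least 1 because x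
          is negative here.\<close>
        have "1 \<le> (1 + x + x\<^sup>2) * (1 - x)"
          using False by (simp add: algebra_simps power2_eq_square mult_nonpos_nonneg mult_nonneg_nonpos2)
        then show ?thesis using False by (simp add: divide_simps)
      qed
      finally show ?thesis .
    qed
    ultimately show ?thesis by linarith
  qed
  have "x\<^sup>2 \<le> \<bar>x\<bar>" using assms
    by (metis abs_ge_zero mult.right_neutral mult_left_mono power2_abs power2_eq_square)
  with 1 show "\<bar>exp x - 1\<bar> \<le> 2 * \<bar>x\<bar>" by linarith
qed

definition exch :: "nat \<Rightarrow> nat \<Rightarrow> (nat \<Rightarrow> 'z) \<Rightarrow> nat \<Rightarrow> 'z" where
  "exch i j Z = Z(i := Z j, j := Z i)"

lemma exch_exch [simp]: "exch i j (exch i j Z) = Z"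
  by (auto simp: exch_def fun_eq_iff)

lemma exch_same [simp]: "exch i i Z = Z"
  by (auto simp: exch_def fun_eq_iff)

lemma exch_left [simp]: "exch i j Z i = Z j"
  by (auto simp: exch_def)

definition linstat :: "nat \<Rightarrow> (nat \<Rightarrow> 'z \<Rightarrow> real) \<Rightarrow> (nat \<Rightarrow> 'z) \<Rightarrow> real" where
  "linstat N a Z = (\<Sum>i<N. a i (Z i))"

text \<open>Only the summands of the two exchanged units change. The formula also covers
  \<open>i = j\<close>, where both sides vanish, so later double sums may run over all ordered pairs
  without excluding the diagonal.\<close>

lemma linstat_exch:
  assumes "i < N" "j < N"
  shows "linstat N a (exch i j Z) - linstat N a Z = a i (Z j) + a j (Z i) - a i (Z i) - a j (Z j)"
proof (cases "i = j")
  case False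
  let ?R = "{..<N} - {i, j}"
  have *: "(\<Sum>k<N. f k) = f i + f j + (\<Sum>k\<in>?R. f k)" for f :: "nat \<Rightarrow> real"
    using assms False by (subst sum.subset_diff[of "{i, j}" "{..<N}"]) auto
  have "(\<Sum>k\<in>?R. a k (exch i j Z k)) = (\<Sum>k\<in>?R. a k (Z k))"
    by (intro sum.cong) (auto simp: exch_def)
  then show ?thesis
    unfolding linstat_def * using False by (auto simp: exch_def)
qed simp

text \<open>With \<open>x = n z\<close> and \<open>w = N\<close> this is the coefficient of the sum
  of squared outcomes at one level when the mean of the variance estimator is computed in
  \<open>group_variance_second_moment\<close>.\<close>

lemma variance_estimator_mean_identity:
  fixes x w :: real
  assumes "x \<noteq> 0" "x - 1 \<noteq> 0" "w \<noteq> 0" "w - 1 \<noteq> 0"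
  shows "x * (1 / (x * (x - 1))) / w - (x * (1 / (x * (x - 1)) / x * (w - 2 * x) / (2 * (w - 1))) / w
      + 1 / (x * (x - 1)) / x * x / (2 * (w - 1))) = 1 / (x * (w - 1))"
proof -
  \<comment> \<open>Naming the differences keeps them atomic while denominators are cleared; the
    numerator \<open>2 * x * v - (w - 2 * x) - w\<close> then collapses to
    \<open>2 * u * w\<close>.\<close>
  define u v where "u = x - 1" and "v = w - 1"
  have "x = u + 1" "w = v + 1" "u \<noteq> 0" "v \<noteq> 0" "u + 1 \<noteq> 0" "v + 1 \<noteq> 0" using assms by (auto simp: u_def v_def)
  have "x * (1 / (x * u)) / w - (x * (1 / (x * u) / x * (w - 2 * x) / (2 * v)) / w + 1 / (x * u) / x * x / (2 * v))
    = (2 * x * v - (w - 2 * x) - w) / (2 * x * u * v * w)"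
    using assms unfolding u_def[symmetric] v_def[symmetric] by (simp add: divide_simps)
  also have "2 * x * v - (w - 2 * x) - w = 2 * u * w" by (simp add: u_def v_def algebra_simps)
  also have "2 * u * w / (2 * x * u * v * w) = 1 / (x * v)"
    using assms unfolding u_def[symmetric] v_def[symmetric] by simp
  finally show ?thesis unfolding u_def v_def .
qed

text \<open>The uniform law enters only through sums over \<open>Om\<close>, so bounds on
  expectations carry a factor \<open>card Om\<close>. Closure under exchanges makes these sums
  invariant under \<open>exch i j\<close>, and the fixed group sizes make the empirical law of the
  levels deterministic.\<close>

locale exchangeable_design =
  fixes N :: nat and L :: "'z set" and n :: "'z \<Rightarrow> nat" and Om :: "(nat \<Rightarrow> 'z) set"
  assumes fin_L: "finite L" and fin_Om: "finite Om" and Om_ne: "Om \<noteq> {}" and N_ge2: "2 \<le> N"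
    and in_L: "\<And>Z i. Z \<in> Om \<Longrightarrow> i < N \<Longrightarrow> Z i \<in> L"
    and counts: "\<And>Z z. Z \<in> Om \<Longrightarrow> z \<in> L \<Longrightarrow> card {i. i < N \<and> Z i = z} = n z"
    and exch_Om: "\<And>Z i j. Z \<in> Om \<Longrightarrow> i < N \<Longrightarrow> j < N \<Longrightarrow> exch i j Z \<in> Om"
begin

section \<open>Averages over assignments and the first-order expansion of the tilted mean\<close>

lemma card_Om_pos: "0 < card Om"
  using fin_Om Om_ne by (simp add: card_gt_0_iff)

lemma sum_exch:
  assumes "i < N" "j < N"
  shows "(\<Sum>Z\<in>Om. f (exch i j Z)) = (\<Sum>Z\<in>Om. f Z)"
  by (rule sum.reindex_bij_witness[where i = "exch i j" and j = "exch i j"])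
     (use assms exch_Om in auto)

text \<open>Units are grouped by level. Since the group sizes are fixed, the right side does not
  depend on \<open>Z\<close>: the level of a uniformly chosen unit has the same law under every
  assignment.\<close>

lemma sum_over_units:
  fixes f :: "'z \<Rightarrow> real"
  assumes "Z \<in> Om"
  shows "(\<Sum>j<N. f (Z j)) = (\<Sum>z\<in>L. real (n z) * f z)"
proof -
  have "(\<Sum>z\<in>L. real (n z) * f z) = (\<Sum>z\<in>L. \<Sum>j\<in>{j\<in>{..<N}. Z j = z}. f (Z j))"
  proof (rule sum.cong)
    fix z assume "z \<in> L"
    have "(\<Sum>j\<in>{j\<in>{..<N}. Z j = z}. f (Z j)) = (\<Sum>j\<in>{j\<in>{..<N}. Z j = z}. f z)"
      by (rule sum.cong) auto
    then show "real (n z) * f z = (\<Sum>j\<in>{j\<in>{..<N}. Z j = z}. f (Z j))"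
      using counts[OF assms \<open>z \<in> L\<close>] by simp
  qed simp
  also have "\<dots> = (\<Sum>j<N. f (Z j))"
    by (rule sum.group) (use fin_L in_L assms in auto)
  finally show ?thesis by simp
qed

lemma sum_n: "(\<Sum>z\<in>L. real (n z)) = real N"
proof -
  obtain Z where "Z \<in> Om" using Om_ne by auto
  from sum_over_units[OF this, of "\<lambda>_. 1"] show ?thesis by simp
qed

text \<open>Exchanging unit \<open>i\<close> with a uniformly chosen unit turns the tilted mean of a centred
  statistic into a discrete derivative of the tilt.\<close>

lemma tilted_first_order:
  fixes a :: "nat \<Rightarrow> 'z \<Rightarrow> real" and \<eta> s :: real
  defines "X \<equiv> linstat N a"
  assumes row: "\<And>i. i < N \<Longrightarrow> (\<Sum>z\<in>L. real (n z) * a i z) = 0"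
    and col: "\<And>z. z \<in> L \<Longrightarrow> (\<Sum>i<N. a i z) = 0"
    and bd: "\<And>i z. i < N \<Longrightarrow> z \<in> L \<Longrightarrow> \<bar>a i z\<bar> \<le> \<eta>"
    and eta: "4 * \<eta> \<le> 1" and s: "0 \<le> s" "s \<le> 1"
  shows "(\<Sum>Z\<in>Om. X Z * exp (s * X Z)) \<le>
     (s * ((\<Sum>i<N. \<Sum>z\<in>L. real (n z) * (a i z)\<^sup>2) / N) + 24 * N * \<eta>^3 + 3 * \<eta>\<^sup>2) * (\<Sum>Z\<in>Om. exp (s * X Z))"
proof -
  let ?V = "(\<Sum>i<N. \<Sum>z\<in>L. real (n z) * (a i z)\<^sup>2)"
  define m where "m = (\<Sum>Z\<in>Om. exp (s * X Z))"
  have m0: "0 \<le> m" unfolding m_def by (intro sum_nonneg) auto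
  have Npos: "0 < N" using N_ge2 by simp
  have eta0: "0 \<le> \<eta>"
  proof -
    obtain Z where Z: "Z \<in> Om" using Om_ne by auto
    then have "\<bar>a 0 (Z 0)\<bar> \<le> \<eta>" using bd in_L Npos by auto
    then show ?thesis by linarith
  qed
  define d where "d i j Z = X (exch i j Z) - X Z" for i j Z
  have d: "d i j Z = a i (Z j) + a j (Z i) - a i (Z i) - a j (Z j)" if "i < N" "j < N" for i j Z
    unfolding d_def X_def using that by (rule linstat_exch)
  have bdZ: "\<bar>a i (Z j)\<bar> \<le> \<eta>" if "Z \<in> Om" "i < N" "j < N" for Z i j
    using that bd in_L by auto
  have dbd: "\<bar>d i j Z\<bar> \<le> 4 * \<eta>" if "Z \<in> Om" "i < N" "j < N" for Z i j
    using bdZ[of Z i j] bdZ[of Z j i] bdZ[of Z i i] bdZ[of Z j j] that by (simp add: d)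
  have sdbd: "\<bar>s * d i j Z\<bar> \<le> 4 * \<eta>" if "Z \<in> Om" "i < N" "j < N" for Z i j
  proof -
    have "\<bar>s * d i j Z\<bar> \<le> 1 * \<bar>d i j Z\<bar>" unfolding abs_mult using s by (intro mult_right_mono) auto
    then show ?thesis using dbd[OF that] by linarith
  qed
  have rowZ: "(\<Sum>j<N. a i (Z j)) = 0" if "Z \<in> Om" "i < N" for Z i
    using sum_over_units[OF that(1), of "a i"] row[OF that(2)] by simp
  have exX: "exp (s * X (exch i j Z)) = exp (s * d i j Z) * exp (s * X Z)" for i j Z
    by (simp add: d_def flip: exp_add) (simp add: algebra_simps)

  \<comment> \<open>\<open>R\<close> is the part of the first-order term that remains random after
    centring. A second exchange shows that its tilted sum, divided by \<open>N\<close>, is only of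
    order \<open>\<eta>\<^sup>2 + N * \<eta>^3\<close> relative to \<open>m\<close>.\<close>
  define R where "R Z = (\<Sum>i<N. \<Sum>j<N. a i (Z j) * a j (Z i))" for Z
  have Rbd: "(\<Sum>Z\<in>Om. R Z * exp (s * X Z)) \<le> (3 * N * \<eta>\<^sup>2 + 8 * N\<^sup>2 * \<eta>^3) * m"
  proof -
    have pq: "\<bar>x * y\<bar> \<le> \<eta>\<^sup>2" if "\<bar>x\<bar> \<le> \<eta>" "\<bar>y\<bar> \<le> \<eta>" for x y :: real
      unfolding abs_mult power2_eq_square using that eta0 by (intro mult_mono) auto
    have ij: "(\<Sum>Z\<in>Om. a i (Z j) * a j (Z i) * exp (s * X Z)) \<le>
        (8 * \<eta>^3 + 2 * \<eta>\<^sup>2 / N + (if i = j then \<eta>\<^sup>2 else 0)) * m" if i: "i < N" and j: "j < N" for i j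
    proof (cases "i = j")
      case True
      have "(\<Sum>Z\<in>Om. a i (Z j) * a j (Z i) * exp (s * X Z)) \<le> (\<Sum>Z\<in>Om. \<eta>\<^sup>2 * exp (s * X Z))"
        by (intro sum_mono mult_right_mono) (use pq[OF bdZ bdZ] i j in \<open>auto intro: order_trans[OF abs_ge_self]\<close>)
      also have "\<dots> = \<eta>\<^sup>2 * m" by (simp add: m_def sum_distrib_left)
      also have "\<dots> \<le> (8 * \<eta>^3 + 2 * \<eta>\<^sup>2 / N + (if i = j then \<eta>\<^sup>2 else 0)) * m"
        using True eta0 m0 by (intro mult_right_mono) auto
      finally show ?thesis .
    next
      case False
      \<comment> \<open>Exchanging \<open>j\<close> with \<open>k\<close> moves the level of unit
        \<open>i\<close> only if \<open>k = i\<close> (as \<open>i\<close> and \<open>j\<close>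
        differ); \<open>w\<close> corrects the uniform formula for that single
        \<open>k\<close>.\<close>
      define w where "w k Z = (if k = i then a i (Z i) * a j (Z j) - a i (Z i) * a j (Z i) else 0)" for k Z
      have "real N * (\<Sum>Z\<in>Om. a i (Z j) * a j (Z i) * exp (s * X Z))
          = (\<Sum>k<N. \<Sum>Z\<in>Om. a i (Z j) * a j (Z i) * exp (s * X Z))" by simp
      also have "\<dots> = (\<Sum>k<N. \<Sum>Z\<in>Om. a i (exch j k Z j) * a j (exch j k Z i) * exp (s * X (exch j k Z)))"
        by (intro sum.cong refl sum_exch[symmetric, where f = "\<lambda>Z. a i (Z j) * a j (Z i) * exp (s * X Z)"]) (use j in auto)
      also have "\<dots> = (\<Sum>k<N. \<Sum>Z\<in>Om. a i (Z k) * a j (Z i) * exp (s * X (exch j k Z)) + w k Z * exp (s * X (exch j k Z)))"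
        by (intro sum.cong refl) (use False in \<open>auto simp: exch_def w_def algebra_simps\<close>)
      also have "\<dots> = (\<Sum>k<N. \<Sum>Z\<in>Om. a i (Z k) * a j (Z i) * exp (s * X Z) * exp (s * d j k Z))
            + (\<Sum>k<N. \<Sum>Z\<in>Om. w k Z * exp (s * X (exch j k Z)))"
        unfolding sum.distrib exX by (simp add: mult_ac)
      \<comment> \<open>Subtracting 1 from the exponential is free, since the sum of
        \<open>a i (Z k)\<close> over \<open>k\<close> vanishes by row centring. The factor that
        remains is at most \<open>8 * \<eta>\<close>.\<close>
      also have "(\<Sum>k<N. \<Sum>Z\<in>Om. a i (Z k) * a j (Z i) * exp (s * X Z) * exp (s * d j k Z))
           = (\<Sum>k<N. \<Sum>Z\<in>Om. a i (Z k) * a j (Z i) * exp (s * X Z) * (exp (s * d j k Z) - 1))"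
      proof -
        have "(\<Sum>k<N. \<Sum>Z\<in>Om. a i (Z k) * a j (Z i) * exp (s * X Z)) =
           (\<Sum>Z\<in>Om. (\<Sum>k<N. a i (Z k)) * a j (Z i) * exp (s * X Z))"
          by (subst sum.swap) (simp add: sum_distrib_right)
        also have "\<dots> = 0" by (intro sum.neutral) (use rowZ i in auto)
        finally show ?thesis by (simp add: algebra_simps sum_subtractf)
      qed
      also have "\<dots> \<le> (\<Sum>k<N. \<Sum>Z\<in>Om. \<eta>\<^sup>2 * exp (s * X Z) * (8 * \<eta>))"
      proof (intro sum_mono)
        fix k Z assume kZ: "k \<in> {..<N}" "Z \<in> Om"
        have "\<bar>exp (s * d j k Z) - 1\<bar> \<le> 8 * \<eta>"
          using exp_minus_one_bounds(2)[of "s * d j k Z"] sdbd[of Z j k] kZ j eta by auto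
        then have "\<bar>a i (Z k) * a j (Z i) * exp (s * X Z) * (exp (s * d j k Z) - 1)\<bar>
             \<le> \<eta>\<^sup>2 * exp (s * X Z) * (8 * \<eta>)"
          unfolding abs_mult[of _ "exp (s * d j k Z) - 1"] abs_mult[of _ "exp (s * X Z)"]
          by (intro mult_mono pq) (use bdZ kZ i j eta0 in auto)
        then show "a i (Z k) * a j (Z i) * exp (s * X Z) * (exp (s * d j k Z) - 1)
             \<le> \<eta>\<^sup>2 * exp (s * X Z) * (8 * \<eta>)" by linarith
      qed
      also have "(\<Sum>k<N. \<Sum>Z\<in>Om. \<eta>\<^sup>2 * exp (s * X Z) * (8 * \<eta>)) = real N * (8 * \<eta>^3) * m"
        by (simp add: m_def sum_distrib_left sum_distrib_right power2_eq_square power3_eq_cube mult_ac)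
      also have "(\<Sum>k<N. \<Sum>Z\<in>Om. w k Z * exp (s * X (exch j k Z)))
          \<le> (\<Sum>k<N. (if k = i then 2 * \<eta>\<^sup>2 else 0) * m)"
      proof (rule sum_mono)
        fix k assume k: "k \<in> {..<N}"
        have "(\<Sum>Z\<in>Om. w k Z * exp (s * X (exch j k Z))) \<le> (\<Sum>Z\<in>Om. (if k = i then 2 * \<eta>\<^sup>2 else 0) * exp (s * X (exch j k Z)))"
        proof (intro sum_mono mult_right_mono)
          fix Z assume Z: "Z \<in> Om"
          have "\<bar>a i (Z i) * a j (Z j)\<bar> \<le> \<eta>\<^sup>2" "\<bar>a i (Z i) * a j (Z i)\<bar> \<le> \<eta>\<^sup>2"
            using pq[OF bdZ bdZ] i j Z by auto
          then show "w k Z \<le> (if k = i then 2 * \<eta>\<^sup>2 else 0)"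
            unfolding w_def by (auto simp: abs_le_iff)
        qed auto
        also have "\<dots> = (if k = i then 2 * \<eta>\<^sup>2 else 0) * m"
          using sum_exch[where i = j and j = k and f = "\<lambda>Z. exp (s * X Z)"] k j
          by (simp add: m_def flip: sum_distrib_left)
        finally show "(\<Sum>Z\<in>Om. w k Z * exp (s * X (exch j k Z))) \<le> (if k = i then 2 * \<eta>\<^sup>2 else 0) * m" .
      qed
      also have "\<dots> = 2 * \<eta>\<^sup>2 * m" using i by (simp add: if_distrib[of "\<lambda>x. x * m"] cong: if_cong)
      finally have "real N * (\<Sum>Z\<in>Om. a i (Z j) * a j (Z i) * exp (s * X Z)) \<le> real N * (8 * \<eta>^3) * m + 2 * \<eta>\<^sup>2 * m"
        by simp
      then show ?thesis using False Npos by (simp add: field_simps)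
    qed
    have "(\<Sum>Z\<in>Om. R Z * exp (s * X Z)) = (\<Sum>i<N. \<Sum>j<N. \<Sum>Z\<in>Om. a i (Z j) * a j (Z i) * exp (s * X Z))"
      unfolding R_def sum_distrib_right by (subst sum.swap, subst (2) sum.swap) simp
    also have "\<dots> \<le> (\<Sum>i<N. \<Sum>j<N. (8 * \<eta>^3 + 2 * \<eta>\<^sup>2 / N + (if i = j then \<eta>\<^sup>2 else 0)) * m)"
      by (intro sum_mono ij) auto
    also have "\<dots> = (3 * N * \<eta>\<^sup>2 + 8 * N\<^sup>2 * \<eta>^3) * m"
      using Npos by (simp add: sum.distrib flip: sum_distrib_right) (simp add: power2_eq_square algebra_simps)
    finally show ?thesis .
  qed

  \<comment> \<open>Of the four products, the square gives the deterministic constant and the mixed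
    one gives \<open>R\<close>; the other two vanish by row and by column centring.\<close>
  have quad: "(\<Sum>i<N. \<Sum>j<N. a i (Z j) * d i j Z) = ?V + R Z" if Z: "Z \<in> Om" for Z
  proof -
    have "(\<Sum>i<N. \<Sum>j<N. a i (Z j) * d i j Z) =
       (\<Sum>i<N. \<Sum>j<N. (a i (Z j))\<^sup>2 + a i (Z j) * a j (Z i) - a i (Z j) * a i (Z i) - a i (Z j) * a j (Z j))"
      by (intro sum.cong refl) (simp add: d power2_eq_square algebra_simps)
    also have "\<dots> = (\<Sum>i<N. \<Sum>j<N. (a i (Z j))\<^sup>2) + R Z - (\<Sum>i<N. (\<Sum>j<N. a i (Z j)) * a i (Z i))
        - (\<Sum>j<N. (\<Sum>i<N. a i (Z j)) * a j (Z j))"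
      unfolding sum.distrib sum_subtractf R_def sum_distrib_right
      by (subst (6) sum.swap) simp
    also have "(\<Sum>i<N. (\<Sum>j<N. a i (Z j)) * a i (Z i)) = 0"
      by (intro sum.neutral) (use rowZ Z in auto)
    also have "(\<Sum>j<N. (\<Sum>i<N. a i (Z j)) * a j (Z j)) = 0"
      by (intro sum.neutral) (use col in_L Z in auto)
    also have "(\<Sum>i<N. \<Sum>j<N. (a i (Z j))\<^sup>2) = ?V"
      by (intro sum.cong refl) (rule sum_over_units[OF Z])
    finally show ?thesis by simp
  qed

  \<comment> \<open>The factor \<open>N\<close> counts the exchange partners \<open>j\<close>. The
    zeroth-order term vanishes by row centring, the first-order term is kept, and the second-order
    remainder is at most \<open>\<eta> * (4 * \<eta>)\<^sup>2\<close>.\<close>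
  have one: "real N * (\<Sum>Z\<in>Om. a i (Z i) * exp (s * X Z)) \<le>
      (\<Sum>Z\<in>Om. (\<Sum>j<N. a i (Z j) * d i j Z) * (s * exp (s * X Z))) + N * (16 * \<eta>^3) * m" if i: "i < N" for i
  proof -
    have "real N * (\<Sum>Z\<in>Om. a i (Z i) * exp (s * X Z)) = (\<Sum>j<N. \<Sum>Z\<in>Om. a i (Z i) * exp (s * X Z))" by simp
    also have "\<dots> = (\<Sum>j<N. \<Sum>Z\<in>Om. a i (exch i j Z i) * exp (s * X (exch i j Z)))"
      by (intro sum.cong refl sum_exch[symmetric, where f = "\<lambda>Z. a i (Z i) * exp (s * X Z)"]) (use i in auto)
    also have "\<dots> = (\<Sum>j<N. \<Sum>Z\<in>Om. a i (Z j) * exp (s * d i j Z) * exp (s * X Z))"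
      by (intro sum.cong refl) (simp only: exch_left exX mult_ac)
    also have "\<dots> = (\<Sum>j<N. \<Sum>Z\<in>Om. a i (Z j) * (exp (s * d i j Z) - 1) * exp (s * X Z))"
    proof -
      have "(\<Sum>j<N. \<Sum>Z\<in>Om. a i (Z j) * exp (s * X Z)) = (\<Sum>Z\<in>Om. (\<Sum>j<N. a i (Z j)) * exp (s * X Z))"
        by (subst sum.swap) (simp add: sum_distrib_right)
      also have "\<dots> = 0" by (intro sum.neutral) (use rowZ i in auto)
      finally show ?thesis by (simp add: algebra_simps sum_subtractf)
    qed
    also have "\<dots> \<le> (\<Sum>j<N. \<Sum>Z\<in>Om. (a i (Z j) * d i j Z) * (s * exp (s * X Z)) + 16 * \<eta>^3 * exp (s * X Z))"
    proof (intro sum_mono)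
      fix j Z assume jZ: "j \<in> {..<N}" "Z \<in> Om"
      let ?x = "s * d i j Z"
      have x: "\<bar>?x\<bar> \<le> 4 * \<eta>" using sdbd jZ i by auto
      have "\<bar>exp ?x - 1 - ?x\<bar> \<le> ?x\<^sup>2" using exp_minus_one_bounds(1)[of ?x] x eta by auto
      also have "\<dots> \<le> (4 * \<eta>)\<^sup>2" using x by (metis abs_ge_zero power2_abs power_mono)
      finally have "\<bar>a i (Z j) * (exp ?x - 1 - ?x)\<bar> \<le> \<eta> * (4 * \<eta>)\<^sup>2"
        unfolding abs_mult using bdZ jZ i eta0 by (intro mult_mono) auto
      then have "a i (Z j) * (exp ?x - 1) \<le> a i (Z j) * ?x + 16 * \<eta>^3"
        by (auto simp: power2_eq_square power3_eq_cube algebra_simps abs_le_iff)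
      then have "a i (Z j) * (exp ?x - 1) * exp (s * X Z) \<le> (a i (Z j) * ?x + 16 * \<eta>^3) * exp (s * X Z)"
        by (intro mult_right_mono) auto
      then show "a i (Z j) * (exp ?x - 1) * exp (s * X Z) \<le> (a i (Z j) * d i j Z) * (s * exp (s * X Z)) + 16 * \<eta>^3 * exp (s * X Z)"
        by (simp add: algebra_simps)
    qed
    also have "\<dots> = (\<Sum>Z\<in>Om. (\<Sum>j<N. a i (Z j) * d i j Z) * (s * exp (s * X Z))) + N * (16 * \<eta>^3) * m"
      unfolding sum.distrib sum_distrib_right m_def sum_distrib_left
      by (subst sum.swap) (simp add: sum_distrib_left mult_ac)
    finally show ?thesis .
  qed
  have "real N * (\<Sum>Z\<in>Om. X Z * exp (s * X Z)) = (\<Sum>i<N. real N * (\<Sum>Z\<in>Om. a i (Z i) * exp (s * X Z)))"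
    unfolding X_def linstat_def sum_distrib_right by (subst sum.swap) (simp add: sum_distrib_left)
  also have "\<dots> \<le> (\<Sum>i<N. (\<Sum>Z\<in>Om. (\<Sum>j<N. a i (Z j) * d i j Z) * (s * exp (s * X Z))) + N * (16 * \<eta>^3) * m)"
    by (intro sum_mono one) auto
  also have "\<dots> = (\<Sum>Z\<in>Om. (\<Sum>i<N. \<Sum>j<N. a i (Z j) * d i j Z) * (s * exp (s * X Z))) + N * (N * (16 * \<eta>^3) * m)"
    unfolding sum.distrib sum_distrib_right by (subst sum.swap) simp
  also have "(\<Sum>Z\<in>Om. (\<Sum>i<N. \<Sum>j<N. a i (Z j) * d i j Z) * (s * exp (s * X Z)))
     = (\<Sum>Z\<in>Om. (?V + R Z) * (s * exp (s * X Z)))"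
    by (intro sum.cong refl) (simp add: quad)
  also have "\<dots> = s * ?V * m + s * (\<Sum>Z\<in>Om. R Z * exp (s * X Z))"
  proof -
    have "(v + R Z) * (s * exp (s * X Z)) = s * v * exp (s * X Z) + s * (R Z * exp (s * X Z))" for v Z
      by (simp add: algebra_simps)
    then show ?thesis by (simp only: m_def sum.distrib flip: sum_distrib_left)
  qed
  also have "\<dots> \<le> s * ?V * m + 1 * ((3 * N * \<eta>\<^sup>2 + 8 * N\<^sup>2 * \<eta>^3) * m)"
  proof (intro add_left_mono)
    have "s * (\<Sum>Z\<in>Om. R Z * exp (s * X Z)) \<le> s * ((3 * N * \<eta>\<^sup>2 + 8 * N\<^sup>2 * \<eta>^3) * m)"
      using Rbd s by (intro mult_left_mono) auto
    also have "\<dots> \<le> 1 * ((3 * N * \<eta>\<^sup>2 + 8 * N\<^sup>2 * \<eta>^3) * m)"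
      using s m0 eta0 by (intro mult_right_mono) auto
    finally show "s * (\<Sum>Z\<in>Om. R Z * exp (s * X Z)) \<le> 1 * ((3 * N * \<eta>\<^sup>2 + 8 * N\<^sup>2 * \<eta>^3) * m)" .
  qed
  finally have *: "real N * (\<Sum>Z\<in>Om. X Z * exp (s * X Z))
     \<le> s * ?V * m + 1 * ((3 * N * \<eta>\<^sup>2 + 8 * N\<^sup>2 * \<eta>^3) * m) + N * (N * (16 * \<eta>^3) * m)"
    by linarith
  \<comment> \<open>The constant 24 adds 16 from the exponential remainder to 8 from the bound on
    \<open>R\<close>.\<close>
  have "s * v * m + 1 * ((3 * N * \<eta>\<^sup>2 + 8 * N\<^sup>2 * \<eta>^3) * m) + N * (N * (16 * \<eta>^3) * m)
      = real N * ((s * (v / N) + 24 * N * \<eta>^3 + 3 * \<eta>\<^sup>2) * m)" for v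
    using Npos by (simp add: field_simps power2_eq_square)
  from *[unfolded this] show ?thesis using Npos unfolding m_def by simp
qed

section \<open>Moment generating functions and Chernoff bounds\<close>

lemma mgf_doubly_centred:
  fixes a :: "nat \<Rightarrow> 'z \<Rightarrow> real" and \<eta> :: real
  assumes row: "\<And>i. i < N \<Longrightarrow> (\<Sum>z\<in>L. real (n z) * a i z) = 0"
    and col: "\<And>z. z \<in> L \<Longrightarrow> (\<Sum>i<N. a i z) = 0"
    and bd: "\<And>i z. i < N \<Longrightarrow> z \<in> L \<Longrightarrow> \<bar>a i z\<bar> \<le> \<eta>"
    and eta: "4 * \<eta> \<le> 1"
  shows "(\<Sum>Z\<in>Om. exp (linstat N a Z)) \<le> card Om *
     exp ((\<Sum>i<N. \<Sum>z\<in>L. real (n z) * (a i z)\<^sup>2) / N / 2 + 24 * N * \<eta>^3 + 3 * \<eta>\<^sup>2)"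
proof -
  define V where "V = (\<Sum>i<N. \<Sum>z\<in>L. real (n z) * (a i z)\<^sup>2) / N"
  define c where "c = 24 * N * \<eta>^3 + 3 * \<eta>\<^sup>2"
  let ?X = "linstat N a"
  define m where "m s = (\<Sum>Z\<in>Om. exp (s * ?X Z))" for s
  \<comment> \<open>A Gronwall argument: \<open>q\<close> is the primitive of
    \<open>V * s + c\<close> vanishing at 0. The differential inequality for \<open>m\<close> from
    \<open>tilted_first_order\<close> makes \<open>m s * exp (- q s)\<close> nonincreasing on the
    unit interval.\<close>
  define q where "q s = V * s\<^sup>2 / 2 + c * s" for s
  have dm: "(m has_real_derivative (\<Sum>Z\<in>Om. ?X Z * exp (s * ?X Z))) (at s)" for s
    unfolding m_def by (auto intro!: derivative_eq_intros sum.cong)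
  have dq: "(q has_real_derivative (V * s + c)) (at s)" for s
    unfolding q_def by (auto intro!: derivative_eq_intros)
  have "m 1 * exp (- q 1) \<le> m 0 * exp (- q 0)"
  proof (rule DERIV_nonpos_imp_nonincreasing[where f = "\<lambda>s. m s * exp (- q s)"])
    fix s :: real assume s: "0 \<le> s" "s \<le> 1"
    let ?m' = "\<Sum>Z\<in>Om. ?X Z * exp (s * ?X Z)"
    have "((\<lambda>s. m s * exp (- q s)) has_real_derivative ((?m' - (V * s + c) * m s) * exp (- q s))) (at s)"
      by (auto intro!: derivative_eq_intros dm dq simp: algebra_simps)
    moreover have "?m' - (V * s + c) * m s \<le> 0"
      using tilted_first_order[OF row col bd eta s] unfolding m_def V_def c_def by (simp add: algebra_simps)
    then have "(?m' - (V * s + c) * m s) * exp (- q s) \<le> 0"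
      by (intro mult_nonpos_nonneg) auto
    ultimately show "\<exists>y. ((\<lambda>s. m s * exp (- q s)) has_real_derivative y) (at s) \<and> y \<le> 0" by blast
  qed simp
  moreover have "m 0 = card Om" "q 0 = 0" by (simp_all add: m_def q_def)
  moreover have "m 1 = (m 1 * exp (- q 1)) * exp (q 1)" by (simp add: exp_minus)
  ultimately have "m 1 \<le> card Om * exp (q 1)"
    by (metis exp_ge_zero minus_zero exp_zero mult.right_neutral mult_right_mono)
  then show ?thesis by (simp add: m_def q_def V_def c_def add.assoc)
qed

text \<open>Row centring is obtained by subtracting the row means \<open>b i\<close>. They sum to
  zero, so the statistic is unchanged; the second moments can only decrease, by
  \<open>N * (b i)\<^sup>2\<close> in row \<open>i\<close>; and the entries at most double, which is
  why \<open>2 * A * \<theta>\<close> takes the place of \<open>\<eta>\<close>.\<close>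

lemma mgf_bound:
  fixes a :: "nat \<Rightarrow> 'z \<Rightarrow> real" and A \<theta> :: real
  assumes col: "\<And>z. z \<in> L \<Longrightarrow> (\<Sum>i<N. a i z) = 0"
    and bd: "\<And>i z. i < N \<Longrightarrow> z \<in> L \<Longrightarrow> \<bar>a i z\<bar> \<le> A"
    and th: "0 \<le> \<theta>" "8 * A * \<theta> \<le> 1"
  shows "(\<Sum>Z\<in>Om. exp (\<theta> * linstat N a Z)) \<le> card Om *
     exp (\<theta>\<^sup>2 * ((\<Sum>i<N. \<Sum>z\<in>L. real (n z) * (a i z)\<^sup>2) / N) / 2 + 24 * N * (2 * A * \<theta>)^3 + 3 * (2 * A * \<theta>)\<^sup>2)"
proof -
  define b where "b i = (\<Sum>z\<in>L. real (n z) * a i z) / N" for i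
  have Npos: "0 < real N" using N_ge2 by simp
  have b_sum: "(\<Sum>i<N. b i) = 0"
  proof -
    have "(\<Sum>i<N. b i) = (\<Sum>z\<in>L. real (n z) * (\<Sum>i<N. a i z)) / N"
      unfolding b_def sum_divide_distrib[symmetric] by (subst sum.swap) (simp add: sum_distrib_left)
    also have "(\<Sum>z\<in>L. real (n z) * (\<Sum>i<N. a i z)) = 0" by (intro sum.neutral) (simp add: col)
    finally show ?thesis by simp
  qed
  have b_bd: "\<bar>b i\<bar> \<le> A" if "i < N" for i
  proof -
    have "\<bar>\<Sum>z\<in>L. real (n z) * a i z\<bar> \<le> (\<Sum>z\<in>L. real (n z) * A)"
      using bd[OF that] by (intro order_trans[OF sum_abs] sum_mono) (auto simp: abs_mult intro!: mult_left_mono)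
    also have "\<dots> = N * A" by (simp add: sum_n flip: sum_distrib_right)
    finally show ?thesis using Npos by (simp add: b_def field_simps)
  qed
  define a' where "a' i z = \<theta> * (a i z - b i)" for i z
  have "(\<Sum>Z\<in>Om. exp (linstat N a' Z)) \<le> card Om *
     exp ((\<Sum>i<N. \<Sum>z\<in>L. real (n z) * (a' i z)\<^sup>2) / N / 2 + 24 * N * (2 * A * \<theta>)^3 + 3 * (2 * A * \<theta>)\<^sup>2)"
  proof (rule mgf_doubly_centred)
    show "(\<Sum>z\<in>L. real (n z) * a' i z) = 0" if "i < N" for i
    proof -
      have "(\<Sum>z\<in>L. real (n z) * a' i z) = \<theta> * ((\<Sum>z\<in>L. real (n z) * a i z) - (\<Sum>z\<in>L. real (n z)) * b i)"
        by (simp add: a'_def sum_distrib_left sum_distrib_right algebra_simps sum_subtractf)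
      then show ?thesis using Npos by (simp add: sum_n b_def)
    qed
    show "(\<Sum>i<N. a' i z) = 0" if "z \<in> L" for z
      by (simp add: a'_def sum_subtractf col[OF that] b_sum flip: sum_distrib_left)
    show "\<bar>a' i z\<bar> \<le> 2 * A * \<theta>" if "i < N" "z \<in> L" for i z
    proof -
      have "\<bar>a i z - b i\<bar> \<le> 2 * A" using bd[OF that] b_bd[OF that(1)] by linarith
      then show ?thesis using th by (simp add: a'_def abs_mult mult.commute mult_left_mono)
    qed
    show "4 * (2 * A * \<theta>) \<le> 1" using th by simp
  qed
  moreover have "linstat N a' Z = \<theta> * linstat N a Z" for Z
    by (simp add: linstat_def a'_def sum_subtractf b_sum flip: sum_distrib_left)
  moreover have "(\<Sum>i<N. \<Sum>z\<in>L. real (n z) * (a' i z)\<^sup>2) \<le> \<theta>\<^sup>2 * (\<Sum>i<N. \<Sum>z\<in>L. real (n z) * (a i z)\<^sup>2)"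
  proof -
    have "(\<Sum>z\<in>L. real (n z) * (a' i z)\<^sup>2) \<le> \<theta>\<^sup>2 * (\<Sum>z\<in>L. real (n z) * (a i z)\<^sup>2)" for i
    proof -
      have "(\<Sum>z\<in>L. real (n z) * (a i z - b i)\<^sup>2)
         = (\<Sum>z\<in>L. real (n z) * (a i z)\<^sup>2) - 2 * b i * (\<Sum>z\<in>L. real (n z) * a i z) + (b i)\<^sup>2 * (\<Sum>z\<in>L. real (n z))"
        by (simp add: power2_eq_square algebra_simps sum_distrib_left sum.distrib sum_subtractf)
      also have "(\<Sum>z\<in>L. real (n z) * a i z) = N * b i" using Npos by (simp add: b_def)
      also have "(\<Sum>z\<in>L. real (n z) * (a i z)\<^sup>2) - 2 * b i * (N * b i) + (b i)\<^sup>2 * (\<Sum>z\<in>L. real (n z))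
         = (\<Sum>z\<in>L. real (n z) * (a i z)\<^sup>2) - N * (b i)\<^sup>2" by (simp add: sum_n power2_eq_square)
      also have "\<dots> \<le> (\<Sum>z\<in>L. real (n z) * (a i z)\<^sup>2)" by simp
      finally have "\<theta>\<^sup>2 * (\<Sum>z\<in>L. real (n z) * (a i z - b i)\<^sup>2) \<le> \<theta>\<^sup>2 * (\<Sum>z\<in>L. real (n z) * (a i z)\<^sup>2)"
        by (intro mult_left_mono) auto
      then show ?thesis by (simp add: a'_def power_mult_distrib sum_distrib_left mult_ac)
    qed
    then show ?thesis by (simp add: sum_distrib_left[of "\<theta>\<^sup>2"] sum_mono)
  qed
  then have "(\<Sum>i<N. \<Sum>z\<in>L. real (n z) * (a' i z)\<^sup>2) / N / 2 \<le>
      \<theta>\<^sup>2 * ((\<Sum>i<N. \<Sum>z\<in>L. real (n z) * (a i z)\<^sup>2) / N) / 2"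
    using Npos by (simp add: divide_right_mono)
  then have "card Om * exp ((\<Sum>i<N. \<Sum>z\<in>L. real (n z) * (a' i z)\<^sup>2) / N / 2 + 24 * N * (2 * A * \<theta>)^3 + 3 * (2 * A * \<theta>)\<^sup>2)
     \<le> card Om * exp (\<theta>\<^sup>2 * ((\<Sum>i<N. \<Sum>z\<in>L. real (n z) * (a i z)\<^sup>2) / N) / 2 + 24 * N * (2 * A * \<theta>)^3 + 3 * (2 * A * \<theta>)\<^sup>2)"
    by (intro mult_left_mono) auto
  ultimately show ?thesis by simp
qed

lemma card_tail_le:
  fixes f :: "(nat \<Rightarrow> 'z) \<Rightarrow> real"
  shows "real (card {Z\<in>Om. x \<le> f Z}) \<le> exp (- x) * (\<Sum>Z\<in>Om. exp (f Z))"
proof -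
  have "exp x * card {Z\<in>Om. x \<le> f Z} = (\<Sum>Z\<in>{Z\<in>Om. x \<le> f Z}. exp x)" by simp
  also have "\<dots> \<le> (\<Sum>Z\<in>{Z\<in>Om. x \<le> f Z}. exp (f Z))" by (intro sum_mono) auto
  also have "\<dots> \<le> (\<Sum>Z\<in>Om. exp (f Z))" using fin_Om by (intro sum_mono2) auto
  finally show ?thesis by (simp add: exp_minus field_simps)
qed

text \<open>The exponential Markov inequality is applied to \<open>a\<close> and to
  \<open>- a\<close>, whose second moments agree. The tilt \<open>\<theta>\<close> is left free and
  tuned in \<open>effect_tail\<close>.\<close>

lemma tail_bound:
  fixes a :: "nat \<Rightarrow> 'z \<Rightarrow> real" and A \<theta> x :: real
  assumes col: "\<And>z. z \<in> L \<Longrightarrow> (\<Sum>i<N. a i z) = 0"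
    and bd: "\<And>i z. i < N \<Longrightarrow> z \<in> L \<Longrightarrow> \<bar>a i z\<bar> \<le> A"
    and th: "0 < \<theta>" "8 * A * \<theta> \<le> 1"
  shows "real (card {Z\<in>Om. x \<le> \<bar>linstat N a Z\<bar>}) \<le> 2 * card Om *
     exp (\<theta>\<^sup>2 * ((\<Sum>i<N. \<Sum>z\<in>L. real (n z) * (a i z)\<^sup>2) / N) / 2 - \<theta> * x + 24 * N * (2 * A * \<theta>)^3 + 3 * (2 * A * \<theta>)\<^sup>2)"
    (is "_ \<le> 2 * card Om * exp (?V - \<theta> * x + ?r + ?q)")
proof -
  have one: "real (card {Z\<in>Om. x \<le> linstat N a Z}) \<le> card Om * exp (?V - \<theta> * x + ?r + ?q)"
    if col: "\<And>z. z \<in> L \<Longrightarrow> (\<Sum>i<N. a i z) = 0"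
      and bd: "\<And>i z. i < N \<Longrightarrow> z \<in> L \<Longrightarrow> \<bar>a i z\<bar> \<le> A"
      and V: "\<theta>\<^sup>2 * ((\<Sum>i<N. \<Sum>z\<in>L. real (n z) * (a i z)\<^sup>2) / N) / 2 = ?V" for a
  proof -
    have "{Z\<in>Om. x \<le> linstat N a Z} = {Z\<in>Om. \<theta> * x \<le> \<theta> * linstat N a Z}" using th by auto
    then have "real (card {Z\<in>Om. x \<le> linstat N a Z}) \<le> exp (- (\<theta> * x)) * (\<Sum>Z\<in>Om. exp (\<theta> * linstat N a Z))"
      using card_tail_le[of "\<theta> * x" "\<lambda>Z. \<theta> * linstat N a Z"] by simp
    also have "\<dots> \<le> exp (- (\<theta> * x)) * (card Om * exp (?V + ?r + ?q))"
      using mgf_bound[of a A \<theta>] col bd th unfolding V by (intro mult_left_mono) auto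
    also have "\<dots> = card Om * exp (?V - \<theta> * x + ?r + ?q)"
      by (simp add: exp_add exp_diff exp_minus field_simps)
    finally show ?thesis .
  qed
  have "card {Z\<in>Om. x \<le> \<bar>linstat N a Z\<bar>} \<le> card ({Z\<in>Om. x \<le> linstat N a Z} \<union> {Z\<in>Om. x \<le> linstat N (\<lambda>i z. - a i z) Z})"
    using fin_Om by (intro card_mono) (auto simp: linstat_def sum_negf)
  also have "\<dots> \<le> card {Z\<in>Om. x \<le> linstat N a Z} + card {Z\<in>Om. x \<le> linstat N (\<lambda>i z. - a i z) Z}"
    by (rule card_Un_le)
  finally have "real (card {Z\<in>Om. x \<le> \<bar>linstat N a Z\<bar>}) \<le>
      real (card {Z\<in>Om. x \<le> linstat N a Z}) + real (card {Z\<in>Om. x \<le> linstat N (\<lambda>i z. - a i z) Z})" by simp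
  also have "\<dots> \<le> card Om * exp (?V - \<theta> * x + ?r + ?q) + card Om * exp (?V - \<theta> * x + ?r + ?q)"
    by (intro add_mono one) (use col bd in \<open>auto simp: sum_negf\<close>)
  finally show ?thesis by simp
qed

section \<open>Second moments from the generator of random exchanges\<close>

definition exch_gen :: "((nat \<Rightarrow> 'z) \<Rightarrow> real) \<Rightarrow> (nat \<Rightarrow> 'z) \<Rightarrow> real" where
  "exch_gen f Z = (\<Sum>k<N. \<Sum>l<N. f (exch k l Z) - f Z)"

text \<open>A Poincare-type inequality that needs no spectral gap: it suffices that the exchange
  generator maps \<open>f\<close> to a multiple of itself up to a statistic \<open>g\<close> of known variance.\<close>

lemma second_moment_exch_gen:
  fixes f g :: "(nat \<Rightarrow> 'z) \<Rightarrow> real" and lam c \<mu> :: real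
  assumes gen: "\<And>Z. Z \<in> Om \<Longrightarrow> exch_gen f Z = - lam * (f Z - g Z)" and lam: "0 < lam"
    and c: "\<And>Z k l. Z \<in> Om \<Longrightarrow> k < N \<Longrightarrow> l < N \<Longrightarrow> \<bar>f (exch k l Z) - f Z\<bar> \<le> c"
  shows "(\<Sum>Z\<in>Om. (f Z - \<mu>)\<^sup>2) \<le> card Om * (N\<^sup>2 * c\<^sup>2 / lam) + (\<Sum>Z\<in>Om. (g Z - \<mu>)\<^sup>2)"
proof -
  \<comment> \<open>Reversibility: reindexing by the same exchange and averaging the two expressions
    turns the sum into minus half the sum of the squared increments.\<close>
  have kl: "(\<Sum>Z\<in>Om. (f (exch k l Z) - f Z) * (f Z - \<mu>)) \<ge> - (card Om * c\<^sup>2 / 2)" if "k < N" "l < N" for k l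
  proof -
    have "(\<Sum>Z\<in>Om. (f (exch k l Z) - f Z) * (f Z - \<mu>)) = (\<Sum>Z\<in>Om. (f Z - f (exch k l Z)) * (f (exch k l Z) - \<mu>))"
      using sum_exch[OF that, where f = "\<lambda>Z. (f (exch k l Z) - f Z) * (f Z - \<mu>)"] by simp
    then have "2 * (\<Sum>Z\<in>Om. (f (exch k l Z) - f Z) * (f Z - \<mu>)) =
        (\<Sum>Z\<in>Om. (f (exch k l Z) - f Z) * (f Z - \<mu>) + (f Z - f (exch k l Z)) * (f (exch k l Z) - \<mu>))"
      by (simp add: sum.distrib)
    also have "\<dots> = (\<Sum>Z\<in>Om. - (f (exch k l Z) - f Z)\<^sup>2)"
      by (intro sum.cong refl) (simp add: power2_eq_square algebra_simps)
    also have "\<dots> \<ge> (\<Sum>Z\<in>Om. - c\<^sup>2)"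
    proof (rule sum_mono)
      fix Z assume "Z \<in> Om"
      have "(f (exch k l Z) - f Z)\<^sup>2 \<le> c\<^sup>2"
        using c[OF \<open>Z \<in> Om\<close> that] by (metis abs_ge_zero power2_abs power_mono)
      then show "- c\<^sup>2 \<le> - (f (exch k l Z) - f Z)\<^sup>2" by simp
    qed
    finally show ?thesis by simp
  qed
  have "- (N\<^sup>2 * (card Om * c\<^sup>2 / 2)) = (\<Sum>k<N. \<Sum>l<N. - (card Om * c\<^sup>2 / 2))"
    by (simp add: power2_eq_square)
  also have "\<dots> \<le> (\<Sum>k<N. \<Sum>l<N. \<Sum>Z\<in>Om. (f (exch k l Z) - f Z) * (f Z - \<mu>))"
    by (intro sum_mono kl) auto
  also have "\<dots> = (\<Sum>Z\<in>Om. exch_gen f Z * (f Z - \<mu>))"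
    unfolding exch_gen_def sum_distrib_right by (subst sum.swap, subst (2) sum.swap) simp
  also have "\<dots> = (\<Sum>Z\<in>Om. - lam * (f Z - g Z) * (f Z - \<mu>))"
    by (intro sum.cong refl) (simp add: gen)
  also have "\<dots> \<le> (\<Sum>Z\<in>Om. lam / 2 * ((g Z - \<mu>)\<^sup>2 - (f Z - \<mu>)\<^sup>2))"
  proof (rule sum_mono)
    fix Z
    \<comment> \<open>With \<open>u = f Z - \<mu>\<close> and \<open>v = g Z - \<mu>\<close>, the
      identity \<open>2 * u * (u - v) = u\<^sup>2 - v\<^sup>2 + (u - v)\<^sup>2\<close> is used and
      the last square dropped.\<close>
    have "0 \<le> lam / 2 * (f Z - g Z)\<^sup>2" using lam by simp
    then show "- lam * (f Z - g Z) * (f Z - \<mu>) \<le> lam / 2 * ((g Z - \<mu>)\<^sup>2 - (f Z - \<mu>)\<^sup>2)"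
      by (simp add: power2_eq_square algebra_simps)
  qed
  also have "\<dots> = lam / 2 * ((\<Sum>Z\<in>Om. (g Z - \<mu>)\<^sup>2) - (\<Sum>Z\<in>Om. (f Z - \<mu>)\<^sup>2))"
    by (simp only: sum_subtractf flip: sum_distrib_left)
  finally show ?thesis using lam by (simp add: field_simps)
qed

text \<open>A linear statistic minus its mean is an eigenfunction of the exchange generator with
  eigenvalue \<open>- 2 * N\<close>, so \<open>second_moment_exch_gen\<close> applies with constant
  \<open>g\<close>. An exchange changes four terms, hence the increment bound
  \<open>4 * B\<close>.\<close>

lemma second_moment_linstat:
  fixes a :: "nat \<Rightarrow> 'z \<Rightarrow> real" and B :: real
  assumes bd: "\<And>i z. i < N \<Longrightarrow> z \<in> L \<Longrightarrow> \<bar>a i z\<bar> \<le> B"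
  shows "(\<Sum>Z\<in>Om. (linstat N a Z - (\<Sum>i<N. \<Sum>z\<in>L. real (n z) * a i z) / N)\<^sup>2) \<le> card Om * (8 * N * B\<^sup>2)"
proof -
  let ?\<mu> = "(\<Sum>i<N. \<Sum>z\<in>L. real (n z) * a i z) / N"
  have Npos: "0 < real N" using N_ge2 by simp
  have "(\<Sum>Z\<in>Om. (linstat N a Z - ?\<mu>)\<^sup>2) \<le> card Om * (N\<^sup>2 * (4 * B)\<^sup>2 / (2 * real N)) + (\<Sum>Z\<in>Om. (?\<mu> - ?\<mu>)\<^sup>2)"
  proof (rule second_moment_exch_gen)
    fix Z assume Z: "Z \<in> Om"
    have "exch_gen (linstat N a) Z = (\<Sum>k<N. \<Sum>l<N. a k (Z l) + a l (Z k) - a k (Z k) - a l (Z l))"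
      unfolding exch_gen_def by (intro sum.cong refl) (simp add: linstat_exch)
    also have "\<dots> = 2 * (\<Sum>k<N. \<Sum>l<N. a k (Z l)) - 2 * N * linstat N a Z"
      unfolding sum.distrib sum_subtractf linstat_def by (subst (2) sum.swap) (simp add: sum_distrib_left sum_negf mult_ac)
    also have "(\<Sum>k<N. \<Sum>l<N. a k (Z l)) = (\<Sum>i<N. \<Sum>z\<in>L. real (n z) * a i z)"
      by (intro sum.cong refl sum_over_units Z)
    finally show "exch_gen (linstat N a) Z = - (2 * real N) * (linstat N a Z - ?\<mu>)"
      using Npos by (simp add: algebra_simps)
  next
    fix Z k l assume Z: "Z \<in> Om" "k < N" "l < N"
    have "\<bar>a k (Z l)\<bar> \<le> B" "\<bar>a l (Z k)\<bar> \<le> B" "\<bar>a k (Z k)\<bar> \<le> B" "\<bar>a l (Z l)\<bar> \<le> B"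
      using Z bd in_L by auto
    then show "\<bar>linstat N a (exch k l Z) - linstat N a Z\<bar> \<le> 4 * B"
      unfolding linstat_exch[OF Z(2,3)] by linarith
  qed (use Npos in auto)
  then show ?thesis using Npos by (simp add: field_simps power2_eq_square)
qed

text \<open>The square of a centred group sum is an eigenfunction up to a linear statistic of the
  squared outcomes and a constant. The factor \<open>4 * (real N - 1)\<close> comes from
  \<open>4 * N\<close>, due to the linear part of the increment, minus 4, due to its square.\<close>

lemma exch_gen_group_square:
  fixes y :: "nat \<Rightarrow> real" and z :: 'z
  defines "S p Z \<equiv> (\<Sum>i<N. p i * of_bool (Z i = z))"
  assumes y: "(\<Sum>i<N. y i) = 0" and Z: "Z \<in> Om" and z: "z \<in> L"
  shows "exch_gen (\<lambda>Z. (S y Z)\<^sup>2) Z =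
    - 4 * (real N - 1) * (S y Z)\<^sup>2 + 2 * (real N - 2 * real (n z)) * S (\<lambda>i. (y i)\<^sup>2) Z + 2 * real (n z) * (\<Sum>i<N. (y i)\<^sup>2)"
proof -
  define I where "I i = (of_bool (Z i = z) :: real)" for i
  have II: "I i * I i = I i" for i by (simp add: I_def)
  have sumI: "(\<Sum>i<N. I i) = n z"
    using counts[OF Z z] by (simp add: I_def sum.If_cases Int_def)
  define D where "D k l = y k * I l + y l * I k - y k * I k - y l * I l" for k l
  have S_lin: "S y W = linstat N (\<lambda>i w. y i * of_bool (w = z)) W" for W
    by (simp add: S_def linstat_def)
  have dS: "S y (exch k l Z) = S y Z + D k l" if "k < N" "l < N" for k l
    using linstat_exch[OF that, of "\<lambda>i w. y i * of_bool (w = z)" Z] by (simp add: S_lin D_def I_def)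
  have "exch_gen (\<lambda>Z. (S y Z)\<^sup>2) Z = (\<Sum>k<N. \<Sum>l<N. 2 * S y Z * D k l + (D k l)\<^sup>2)"
    unfolding exch_gen_def by (intro sum.cong refl) (simp add: dS power2_eq_square algebra_simps)
  also have "\<dots> = 2 * S y Z * (\<Sum>k<N. \<Sum>l<N. D k l) + (\<Sum>k<N. \<Sum>l<N. (D k l)\<^sup>2)"
    by (simp only: sum.distrib flip: sum_distrib_left)
  also have "(\<Sum>k<N. \<Sum>l<N. D k l) = - 2 * N * S y Z"
    unfolding D_def sum.distrib sum_subtractf
    by (simp add: y S_def I_def flip: sum_distrib_left sum_distrib_right)
  \<comment> \<open>As indicators are idempotent, the square expands into nine terms, each a
    function of \<open>k\<close> times a function of \<open>l\<close>. Every double sum then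
    factorises, and those with a bare factor \<open>y k\<close> or \<open>y l\<close> vanish by
    centring.\<close>
  also have "(\<Sum>k<N. \<Sum>l<N. (D k l)\<^sup>2) =
    (\<Sum>k<N. \<Sum>l<N. (y k)\<^sup>2 * I l + ((y k)\<^sup>2 * I k) * 1 - 2 * ((y k)\<^sup>2 * I k * I l) - 2 * (y k * (y l * I l))
       - 2 * (y k * I k * y l) + 4 * (y k * I k * (y l * I l)) + 1 * ((y l)\<^sup>2 * I l) + I k * (y l)\<^sup>2 - 2 * (I k * ((y l)\<^sup>2 * I l)))"
  proof (intro sum.cong refl)
    fix k l
    have "I k = 0 \<or> I k = 1" "I l = 0 \<or> I l = 1" by (auto simp: I_def)
    then show "(D k l)\<^sup>2 = (y k)\<^sup>2 * I l + ((y k)\<^sup>2 * I k) * 1 - 2 * ((y k)\<^sup>2 * I k * I l) - 2 * (y k * (y l * I l))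
       - 2 * (y k * I k * y l) + 4 * (y k * I k * (y l * I l)) + 1 * ((y l)\<^sup>2 * I l) + I k * (y l)\<^sup>2 - 2 * (I k * ((y l)\<^sup>2 * I l))"
      unfolding D_def by (elim disjE) (simp_all add: power2_eq_square algebra_simps)
  qed
  also have "\<dots> = 4 * (S y Z)\<^sup>2 + 2 * (real N - 2 * real (n z)) * S (\<lambda>i. (y i)\<^sup>2) Z + 2 * real (n z) * (\<Sum>i<N. (y i)\<^sup>2)"
  proof -
    have yI: "(\<Sum>i<N. y i * I i) = S y Z" "(\<Sum>i<N. (y i)\<^sup>2 * I i) = S (\<lambda>i. (y i)\<^sup>2) Z"
      by (simp_all add: S_def I_def)
    show ?thesis
      unfolding sum.distrib sum_subtractf
      by (simp only: y yI sumI sum_constant card_lessThan flip: sum_distrib_left sum_distrib_right)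
         (simp add: power2_eq_square algebra_simps)
  qed
  finally show ?thesis by (simp add: power2_eq_square algebra_simps)
qed

lemma exch_gen_weighted_sum:
  "exch_gen (\<lambda>Z. \<Sum>z\<in>L. w z * f z Z) Z = (\<Sum>z\<in>L. w z * exch_gen (f z) Z)"
proof -
  have "exch_gen (\<lambda>Z. \<Sum>z\<in>L. w z * f z Z) Z = (\<Sum>k<N. \<Sum>l<N. \<Sum>z\<in>L. w z * (f z (exch k l Z) - f z Z))"
    unfolding exch_gen_def by (simp add: sum_subtractf right_diff_distrib)
  also have "\<dots> = (\<Sum>z\<in>L. w z * exch_gen (f z) Z)"
    unfolding exch_gen_def sum_distrib_left by (subst (2) sum.swap, subst sum.swap) simp
  finally show ?thesis .
qed

lemma sum_group_linstat:
  assumes "Z \<in> Om"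
  shows "(\<Sum>z\<in>L. w z * (\<Sum>i<N. p i z * of_bool (Z i = z))) = linstat N (\<lambda>i z. w z * p i z) Z"
proof -
  have "(\<Sum>z\<in>L. w z * (\<Sum>i<N. p i z * of_bool (Z i = z))) = (\<Sum>i<N. \<Sum>z\<in>L. w z * p i z * of_bool (Z i = z))"
    unfolding sum_distrib_left by (subst sum.swap) (simp add: mult.assoc)
  also have "\<dots> = linstat N (\<lambda>i z. w z * p i z) Z"
    unfolding linstat_def
  proof (rule sum.cong)
    fix i assume "i \<in> {..<N}"
    then have "Z i \<in> L" using in_L assms by auto
    then show "(\<Sum>z\<in>L. w z * p i z * of_bool (Z i = z)) = w (Z i) * p i (Z i)"
      using fin_L by (subst sum.remove[of _ "Z i"]) auto
  qed simp
  finally show ?thesis .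
qed

text \<open>The statistic is the sum of the within-group variance estimates divided by the group
  sizes. It splits as \<open>P - H\<close> with \<open>P\<close> linear and \<open>H\<close> a
  weighted sum of squared group sums. The generator sends \<open>H\<close> to a multiple of
  \<open>H - (G + cc)\<close> with \<open>G\<close> linear, so the fluctuation of everything reduces
  to \<open>second_moment_linstat\<close>.\<close>

lemma group_variance_second_moment:
  fixes y :: "nat \<Rightarrow> 'z \<Rightarrow> real" and Y0 \<nu> :: real
  defines "S p z Z \<equiv> (\<Sum>i<N. p i * of_bool (Z i = z))"
  assumes y: "\<And>z. z \<in> L \<Longrightarrow> (\<Sum>i<N. y i z) = 0"
    and bd: "\<And>i z. i < N \<Longrightarrow> z \<in> L \<Longrightarrow> \<bar>y i z\<bar> \<le> Y0"
    and n2: "\<And>z. z \<in> L \<Longrightarrow> 2 \<le> n z" and nu: "0 < \<nu>" "\<And>z. z \<in> L \<Longrightarrow> \<nu> \<le> n z"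
  shows "(\<Sum>Z\<in>Om. ((\<Sum>z\<in>L. (S (\<lambda>i. (y i z)\<^sup>2) z Z - (S (\<lambda>i. y i z) z Z)\<^sup>2 / n z) / (n z * (real (n z) - 1)))
        - (\<Sum>z\<in>L. (\<Sum>i<N. (y i z)\<^sup>2) / (n z * (real N - 1))))\<^sup>2)
     \<le> card Om * (384 * N * (Y0\<^sup>2 / \<nu>\<^sup>2)\<^sup>2)"
proof -
  define al where "al z = 1 / (n z * (real (n z) - 1))" for z
  define be where "be z = al z / n z" for z
  \<comment> \<open>The coefficient of the linear statistic produced by the generator, divided by
    the eigenvalue factor \<open>4 * (real N - 1)\<close>.\<close>
  define ga where "ga z = be z * (real N - 2 * real (n z)) / (2 * (real N - 1))" for z
  define T2 where "T2 z = (\<Sum>i<N. (y i z)\<^sup>2)" for z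
  define H where "H Z = (\<Sum>z\<in>L. be z * (S (\<lambda>i. y i z) z Z)\<^sup>2)" for Z
  define cc where "cc = (\<Sum>z\<in>L. be z * n z * T2 z / (2 * (real N - 1)))"
  define P where "P = linstat N (\<lambda>i z. al z * (y i z)\<^sup>2)"
  define G where "G = linstat N (\<lambda>i z. ga z * (y i z)\<^sup>2)"
  define muP where "muP = (\<Sum>i<N. \<Sum>z\<in>L. real (n z) * (al z * (y i z)\<^sup>2)) / N"
  define muG where "muG = (\<Sum>i<N. \<Sum>z\<in>L. real (n z) * (ga z * (y i z)\<^sup>2)) / N"
  define r where "r = Y0\<^sup>2 / \<nu>\<^sup>2"
  have N1: "0 < real N - 1" "0 < real N" "real N \<le> 2 * (real N - 1)" using N_ge2 by auto
  have nN: "real (n z) \<le> N" if "z \<in> L" for z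
  proof -
    have "real (n z) \<le> (\<Sum>z\<in>L. real (n z))" using that fin_L by (intro member_le_sum) auto
    then show ?thesis by (simp add: sum_n)
  qed
  have n1: "0 < real (n z)" "0 < real (n z) - 1" if "z \<in> L" for z using n2[OF that] by auto
  have al_pos: "0 < al z" if "z \<in> L" for z using n1[OF that] by (simp add: al_def)
  have Y0: "0 \<le> Y0"
  proof -
    obtain Z where "Z \<in> Om" using Om_ne by auto
    then have "\<bar>y 0 (Z 0)\<bar> \<le> Y0" using bd in_L N_ge2 by auto
    then show ?thesis by linarith
  qed
  have al_le: "al z \<le> 2 / \<nu>\<^sup>2" if z: "z \<in> L" for z
  \<comment> \<open>Since \<open>n z\<close> is at least 2, \<open>n z - 1\<close> is at least half
    of \<open>n z\<close>; this is the source of the factor 2.\<close>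
  proof -
    have "\<nu>\<^sup>2 \<le> (real (n z))\<^sup>2" using nu(1) nu(2)[OF z] by (intro power_mono) auto
    also have "\<dots> \<le> 2 * (n z * (real (n z) - 1))"
    proof -
      have "real (n z) * 2 \<le> n z * real (n z)" using n2[OF z] by (intro mult_left_mono) auto
      then show ?thesis by (simp add: power2_eq_square algebra_simps)
    qed
    finally show ?thesis unfolding al_def using n1[OF z] nu(1) by (simp add: divide_simps mult_ac)
  qed
  have ysq: "(y i z)\<^sup>2 \<le> Y0\<^sup>2" if "i < N" "z \<in> L" for i z
    using bd[OF that] by (metis abs_ge_zero power2_abs power_mono)
  have alY: "al z * Y0\<^sup>2 \<le> 2 * r" if "z \<in> L" for z
    using mult_right_mono[OF al_le[OF that], of "Y0\<^sup>2"] by (simp add: r_def)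
  have aly: "\<bar>al z * (y i z)\<^sup>2\<bar> \<le> 2 * r" if "i < N" "z \<in> L" for i z
  proof -
    have "al z * (y i z)\<^sup>2 \<le> al z * Y0\<^sup>2" using ysq[OF that] al_pos[OF that(2)] by (intro mult_left_mono) auto
    also note alY[OF that(2)]
    finally show ?thesis using al_pos[OF that(2)] by (simp add: abs_mult)
  qed
  have ga_le: "\<bar>ga z\<bar> \<le> al z" if z: "z \<in> L" for z
  proof -
    have be0: "0 \<le> be z" "be z \<le> al z" using al_pos[OF z] n1[OF z] n2[OF z]
      by (auto simp: be_def divide_le_eq mult_le_cancel_left1)
    have "\<bar>real N - 2 * real (n z)\<bar> \<le> 2 * (real N - 1)" using nN[OF z] N1 by linarith
    then have "\<bar>(real N - 2 * real (n z)) / (2 * (real N - 1))\<bar> \<le> 1" using N1 by (simp add: abs_divide)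
    then have "be z * \<bar>(real N - 2 * real (n z)) / (2 * (real N - 1))\<bar> \<le> be z * 1"
      using be0(1) by (rule mult_left_mono)
    moreover have "\<bar>ga z\<bar> = be z * \<bar>(real N - 2 * real (n z)) / (2 * (real N - 1))\<bar>"
      using be0 by (simp add: ga_def abs_mult flip: times_divide_eq_right)
    ultimately show ?thesis using be0 by simp
  qed
  have gay: "\<bar>ga z * (y i z)\<^sup>2\<bar> \<le> 2 * r" if "i < N" "z \<in> L" for i z
  proof -
    have "\<bar>ga z * (y i z)\<^sup>2\<bar> \<le> al z * (y i z)\<^sup>2" using ga_le[OF that(2)] by (simp add: abs_mult mult_right_mono)
    then show ?thesis using aly[OF that] by linarith
  qed
  have Pmom: "(\<Sum>Z\<in>Om. (P Z - muP)\<^sup>2) \<le> card Om * (8 * N * (2 * r)\<^sup>2)"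
    unfolding P_def muP_def by (rule second_moment_linstat) (rule aly)
  have Gmom: "(\<Sum>Z\<in>Om. (G Z - muG)\<^sup>2) \<le> card Om * (8 * N * (2 * r)\<^sup>2)"
    unfolding G_def muG_def by (rule second_moment_linstat) (rule gay)

  have SG: "(\<Sum>z\<in>L. ga z * S (\<lambda>i. (y i z)\<^sup>2) z Z) = G Z" if "Z \<in> Om" for Z
    unfolding S_def G_def using sum_group_linstat[OF that, of ga "\<lambda>i z. (y i z)\<^sup>2"] by simp
  have SP: "(\<Sum>z\<in>L. al z * S (\<lambda>i. (y i z)\<^sup>2) z Z) = P Z" if "Z \<in> Om" for Z
    unfolding S_def P_def using sum_group_linstat[OF that, of al "\<lambda>i z. (y i z)\<^sup>2"] by simp

  have Hmom: "(\<Sum>Z\<in>Om. (H Z - (muG + cc))\<^sup>2) \<le> card Om * (N\<^sup>2 * (16 * r)\<^sup>2 / (4 * (real N - 1))) + (\<Sum>Z\<in>Om. (G Z + cc - (muG + cc))\<^sup>2)"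
  proof (rule second_moment_exch_gen)
    fix Z assume Z: "Z \<in> Om"
    have "exch_gen H Z = (\<Sum>z\<in>L. be z * exch_gen (\<lambda>Z. (S (\<lambda>i. y i z) z Z)\<^sup>2) Z)"
      unfolding H_def by (rule exch_gen_weighted_sum)
    also have "\<dots> = (\<Sum>z\<in>L. be z * (- 4 * (real N - 1) * (S (\<lambda>i. y i z) z Z)\<^sup>2
          + 2 * (real N - 2 * real (n z)) * S (\<lambda>i. (y i z)\<^sup>2) z Z + 2 * real (n z) * T2 z))"
      unfolding S_def T2_def by (intro sum.cong refl) (simp only: exch_gen_group_square[OF y Z])
    also have "\<dots> = (\<Sum>z\<in>L. - (4 * (real N - 1)) * (be z * (S (\<lambda>i. y i z) z Z)\<^sup>2)
          + 4 * (real N - 1) * (ga z * S (\<lambda>i. (y i z)\<^sup>2) z Z) + 4 * (real N - 1) * (be z * n z * T2 z / (2 * (real N - 1))))"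
    proof (intro sum.cong refl)
      fix z
      have "4 * (x * (b / (2 * x))) = 2 * b" if "x \<noteq> 0" for x b :: real
        using that by simp
      from this[of "real N - 1"] have four: "4 * ((real N - 1) * (b / (2 * (real N - 1)))) = 2 * b" for b
        using N1(1) by simp
      have e1: "4 * (real N - 1) * ga z = 2 * be z * (real N - 2 * real (n z))"
        and e2: "4 * (real N - 1) * (be z * n z * T2 z / (2 * (real N - 1))) = 2 * be z * n z * T2 z"
        unfolding ga_def by (simp_all only: four mult.assoc)
      have e1': "4 * (real N - 1) * (ga z * s) = 2 * be z * (real N - 2 * real (n z)) * s" for s
        using e1 by (metis mult.assoc)
      show "be z * (- 4 * (real N - 1) * (S (\<lambda>i. y i z) z Z)\<^sup>2
          + 2 * (real N - 2 * real (n z)) * S (\<lambda>i. (y i z)\<^sup>2) z Z + 2 * real (n z) * T2 z) =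
          - (4 * (real N - 1)) * (be z * (S (\<lambda>i. y i z) z Z)\<^sup>2)
          + 4 * (real N - 1) * (ga z * S (\<lambda>i. (y i z)\<^sup>2) z Z) + 4 * (real N - 1) * (be z * n z * T2 z / (2 * (real N - 1)))"
        unfolding e1' e2 by (simp add: algebra_simps)
    qed
    also have "\<dots> = - (4 * (real N - 1)) * H Z + 4 * (real N - 1) * G Z + 4 * (real N - 1) * cc"
      unfolding SG[OF Z, symmetric] H_def cc_def by (simp only: sum.distrib flip: sum_distrib_left)
    finally show "exch_gen H Z = - (4 * (real N - 1)) * (H Z - (G Z + cc))"
      by (simp add: algebra_simps)
  next
    fix Z k l assume Z: "Z \<in> Om" "k < N" "l < N"
    define A where "A z = S (\<lambda>i. y i z) z" for z
    have Abd: "\<bar>A z W\<bar> \<le> n z * Y0" if "W \<in> Om" "z \<in> L" for W z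
    proof -
      have "\<bar>A z W\<bar> \<le> (\<Sum>i<N. Y0 * of_bool (W i = z))" unfolding A_def S_def
        using bd that by (intro order_trans[OF sum_abs] sum_mono) (auto simp: abs_mult)
      also have "\<dots> = n z * Y0" using counts[OF that]
        by (simp add: sum.If_cases Int_def flip: sum_distrib_left)
      finally show ?thesis .
    qed
    \<comment> \<open>Only the two levels \<open>Z k\<close> and \<open>Z l\<close> can change their
      group sums. For each of them a difference of squares is the change, at most
      \<open>2 * Y0\<close>, times the sum, at most \<open>2 * n z * Y0\<close>; two such levels
      give \<open>16 * r\<close>.\<close>
    have "\<bar>be z * ((A z (exch k l Z))\<^sup>2 - (A z Z)\<^sup>2)\<bar> \<le> 8 * r * of_bool (z \<in> {Z k, Z l})" if z: "z \<in> L" for z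
    proof -
      have dA: "A z (exch k l Z) - A z Z = (y k z - y l z) * (of_bool (Z l = z) - of_bool (Z k = z))"
        using linstat_exch[OF Z(2,3), of "\<lambda>i w. y i z * of_bool (w = z)" Z]
        by (simp add: A_def S_def linstat_def algebra_simps)
      show ?thesis
      proof (cases "z \<in> {Z k, Z l}")
        case False
        then have "A z (exch k l Z) = A z Z" using dA by auto
        then show ?thesis using False by simp
      next
        case True
        have "\<bar>(y k z - y l z) * (of_bool (Z l = z) - of_bool (Z k = z))\<bar> \<le> 2 * Y0 * 1"
          unfolding abs_mult using bd[OF Z(2) z] bd[OF Z(3) z] by (intro mult_mono) auto
        then have "\<bar>A z (exch k l Z) - A z Z\<bar> * \<bar>A z (exch k l Z) + A z Z\<bar> \<le> 2 * Y0 * (2 * (n z * Y0))"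
          unfolding dA[symmetric]
          using Abd[OF exch_Om[OF Z] z] Abd[OF Z(1) z] Y0 by (intro mult_mono) auto
        then have "\<bar>(A z (exch k l Z))\<^sup>2 - (A z Z)\<^sup>2\<bar> \<le> 4 * n z * Y0\<^sup>2"
          by (simp add: power2_eq_square square_diff_square_factored abs_mult mult_ac)
        then have "be z * \<bar>(A z (exch k l Z))\<^sup>2 - (A z Z)\<^sup>2\<bar> \<le> be z * (4 * n z * Y0\<^sup>2)"
          using al_pos[OF z] by (intro mult_left_mono) (auto simp: be_def)
        also have "\<dots> = 4 * (al z * Y0\<^sup>2)" using n1[OF z] by (simp add: be_def)
        also have "\<dots> \<le> 8 * r" using alY[OF z] by simp
        finally show ?thesis using True al_pos[OF z] by (simp add: abs_mult be_def)
      qed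
    qed
    then have "\<bar>\<Sum>z\<in>L. be z * ((A z (exch k l Z))\<^sup>2 - (A z Z)\<^sup>2)\<bar> \<le> (\<Sum>z\<in>L. 8 * r * of_bool (z \<in> {Z k, Z l}))"
      by (intro order_trans[OF sum_abs] sum_mono) auto
    also have "\<dots> = 8 * r * card (L \<inter> {Z k, Z l})"
      unfolding sum_distrib_left[symmetric] of_bool_def sum.If_cases[OF fin_L] by (simp only: Collect_mem_eq) simp
    also have "\<dots> \<le> 8 * r * 2"
    proof -
      have "card (L \<inter> {Z k, Z l}) \<le> card {Z k, Z l}" by (intro card_mono) auto
      also have "\<dots> \<le> 2" by (simp add: card_insert_if)
      finally show ?thesis by (intro mult_left_mono) (auto simp: r_def)
    qed
    finally show "\<bar>H (exch k l Z) - H Z\<bar> \<le> 16 * r"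
      by (simp add: H_def A_def sum_subtractf right_diff_distrib)
  qed (use N1 in auto)

  have mu: "(\<Sum>z\<in>L. T2 z / (n z * (real N - 1))) = muP - (muG + cc)"
  proof -
    have sw: "(\<Sum>i<N. \<Sum>z\<in>L. real (n z) * (w z * (y i z)\<^sup>2)) / N = (\<Sum>z\<in>L. n z * w z * T2 z / N)" for w :: "'z \<Rightarrow> real"
      unfolding T2_def sum_divide_distrib[symmetric] by (subst sum.swap) (simp add: sum_distrib_left mult.assoc)
    have "muP - (muG + cc) = (\<Sum>z\<in>L. n z * al z * T2 z / N - (n z * ga z * T2 z / N + be z * n z * T2 z / (2 * (real N - 1))))"
      unfolding muP_def muG_def cc_def sw by (simp add: sum_subtractf sum.distrib)
    also have "\<dots> = (\<Sum>z\<in>L. T2 z / (n z * (real N - 1)))"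
    proof (intro sum.cong refl)
      fix z assume z: "z \<in> L"
      have "n z * al z / N - (n z * ga z / N + be z * n z / (2 * (real N - 1))) = 1 / (n z * (real N - 1))"
        using n1[OF z] N1 unfolding ga_def be_def al_def by (intro variance_estimator_mean_identity) auto
      then have "(n z * al z / N - (n z * ga z / N + be z * n z / (2 * (real N - 1)))) * T2 z = 1 / (n z * (real N - 1)) * T2 z"
        by simp
      then show "n z * al z * T2 z / N - (n z * ga z * T2 z / N + be z * n z * T2 z / (2 * (real N - 1))) = T2 z / (n z * (real N - 1))"
        by (simp add: algebra_simps)
    qed
    finally show ?thesis by simp
  qed
  have F: "(\<Sum>z\<in>L. (S (\<lambda>i. (y i z)\<^sup>2) z Z - (S (\<lambda>i. y i z) z Z)\<^sup>2 / n z) / (n z * (real (n z) - 1))) = P Z - H Z"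
    if "Z \<in> Om" for Z
    unfolding SP[OF that, symmetric] H_def sum_subtractf[symmetric]
    by (intro sum.cong refl) (simp add: al_def be_def diff_divide_distrib)
  have "(\<Sum>Z\<in>Om. ((\<Sum>z\<in>L. (S (\<lambda>i. (y i z)\<^sup>2) z Z - (S (\<lambda>i. y i z) z Z)\<^sup>2 / n z) / (n z * (real (n z) - 1)))
        - (\<Sum>z\<in>L. T2 z / (n z * (real N - 1))))\<^sup>2) = (\<Sum>Z\<in>Om. ((P Z - muP) - (H Z - (muG + cc)))\<^sup>2)"
    by (intro sum.cong refl) (simp only: F mu, simp add: algebra_simps)
  also have "\<dots> \<le> (\<Sum>Z\<in>Om. 2 * (P Z - muP)\<^sup>2 + 2 * (H Z - (muG + cc))\<^sup>2)"
  proof (rule sum_mono)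
    fix Z
    have "(u - v)\<^sup>2 \<le> 2 * u\<^sup>2 + 2 * v\<^sup>2" for u v :: real
      using zero_le_power2[of "u + v"] unfolding power2_sum power2_diff by linarith
    then show "((P Z - muP) - (H Z - (muG + cc)))\<^sup>2 \<le> 2 * (P Z - muP)\<^sup>2 + 2 * (H Z - (muG + cc))\<^sup>2" .
  qed
  also have "\<dots> = 2 * (\<Sum>Z\<in>Om. (P Z - muP)\<^sup>2) + 2 * (\<Sum>Z\<in>Om. (H Z - (muG + cc))\<^sup>2)"
    by (simp only: sum.distrib flip: sum_distrib_left)
  also have "\<dots> \<le> 2 * (card Om * (8 * N * (2 * r)\<^sup>2)) + 2 * (card Om * (N\<^sup>2 * (16 * r)\<^sup>2 / (4 * (real N - 1))) + card Om * (8 * N * (2 * r)\<^sup>2))"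
  proof -
    have eq: "(\<Sum>Z\<in>Om. (G Z + cc - (muG + cc))\<^sup>2) = (\<Sum>Z\<in>Om. (G Z - muG)\<^sup>2)" by simp
    have comb: "2 * p + 2 * h \<le> 2 * a + 2 * (b + a)" if "p \<le> a" "h \<le> b + g'" "g' = g" "g \<le> a" for p h g g' a b :: real
      using that unfolding distrib_left by linarith
    show ?thesis by (rule comb[OF Pmom Hmom eq Gmom])
  qed
  also have "\<dots> \<le> 2 * (card Om * (8 * N * (2 * r)\<^sup>2)) + 2 * (card Om * (N * 128 * r\<^sup>2) + card Om * (8 * N * (2 * r)\<^sup>2))"
  proof -
    have "real N * N / (4 * (real N - 1)) \<le> N / 2"
      using N1 by (simp add: divide_simps)
    then have "real N * N / (4 * (real N - 1)) * (256 * r\<^sup>2) \<le> N / 2 * (256 * r\<^sup>2)"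
      by (intro mult_right_mono) auto
    then have "N\<^sup>2 * (16 * r)\<^sup>2 / (4 * (real N - 1)) \<le> N * 128 * r\<^sup>2"
      by (simp add: power2_eq_square mult_ac)
    then show ?thesis by (intro add_left_mono mult_left_mono add_right_mono) auto
  qed
  \<comment> \<open>64 from \<open>P\<close>, 256 from the increments of \<open>H\<close> and 64
    from \<open>G\<close>.\<close>
  also have "\<dots> = card Om * (384 * N * r\<^sup>2)" by (simp add: power2_eq_square algebra_simps)
  finally show ?thesis by (simp add: T2_def r_def)
qed

end

section \<open>The factorial design at a fixed sample size\<close>

text \<open>Supplies the nonemptiness of the set of assignments. In the induction, a new level
  receives a block of fresh units behind the old ones.\<close>

lemma ex_assignment:
  assumes "finite L"
  shows "\<exists>Z. (\<forall>i<(\<Sum>z\<in>L. n z). Z i \<in> L) \<and> (\<forall>z\<in>L. card {i. i < (\<Sum>z\<in>L. n z) \<and> Z i = z} = n z)"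
  using assms
proof (induction L rule: finite_induct)
  case (insert z L)
  let ?s = "\<Sum>z\<in>L. n z"
  obtain Z where Z: "\<And>i. i < ?s \<Longrightarrow> Z i \<in> L" "\<And>w. w \<in> L \<Longrightarrow> card {i. i < ?s \<and> Z i = w} = n w"
    using insert.IH by blast
  define Z' where "Z' i = (if i < ?s then Z i else z)" for i
  have s: "(\<Sum>z\<in>insert z L. n z) = n z + ?s" using insert.hyps by simp
  have "{i. i < n z + ?s \<and> Z' i = z} = {?s..<n z + ?s}"
    using Z(1) insert.hyps by (auto simp: Z'_def split: if_splits) (metis leI)+
  moreover have "{i. i < n z + ?s \<and> Z' i = w} = {i. i < ?s \<and> Z i = w}" if "w \<in> L" for w
    using that insert.hyps by (auto simp: Z'_def)
  ultimately have "(\<forall>i<n z + ?s. Z' i \<in> insert z L) \<and> (\<forall>w\<in>insert z L. card {i. i < n z + ?s \<and> Z' i = w} = n w)"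
    using Z by (auto simp: Z'_def)
  then show ?case unfolding s by blast
qed simp

lemma finite_levels [simp]: "finite (levels K)"
  by (simp add: levels_def)

lemma card_levels [simp]: "card (levels K) = 2 ^ K"
  by (simp add: levels_def card_Pow)

lemma card_exch:
  assumes "i < N" "j < N"
  shows "card {k. k < N \<and> exch i j Z k = z} = card {k. k < N \<and> Z k = z}"
proof -
  define f where "f k = (if k = i then j else if k = j then i else k)" for k
  have "bij_betw f {k. k < N \<and> exch i j Z k = z} {k. k < N \<and> Z k = z}"
    by (rule bij_betw_byWitness[where f' = f]) (use assms in \<open>auto simp: f_def exch_def split: if_splits\<close>)
  then show ?thesis by (rule bij_betw_same_card)
qed

lemma exchangeable_design_assignments:
  assumes N: "(\<Sum>z\<in>levels K. Nz z) = N" and ge2: "\<And>z. z \<in> levels K \<Longrightarrow> 2 \<le> Nz z"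
  shows "exchangeable_design N (levels K) Nz (assignments K N Nz)"
proof
  show "finite (levels K)" by simp
  \<comment> \<open>The default value \<open>{}\<close> at all indices from \<open>N\<close> on is
    what makes the set of assignments finite.\<close>
  have "finite {f :: nat \<Rightarrow> nat set. \<forall>i. (i \<in> {..<N} \<longrightarrow> f i \<in> levels K) \<and> (i \<notin> {..<N} \<longrightarrow> f i = {})}"
    by (rule finite_set_of_finite_funs) auto
  then show "finite (assignments K N Nz)"
    by (rule rev_finite_subset) (auto simp: assignments_def)
  obtain Z where Z: "\<forall>i<N. Z i \<in> levels K" "\<forall>z\<in>levels K. card {i. i < N \<and> Z i = z} = Nz z"
    using ex_assignment[of "levels K" Nz] unfolding N by auto
  have "{i. i < N \<and> (if i < N then Z i else {}) = z} = {i. i < N \<and> Z i = z}" for z by auto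
  then have "(\<lambda>i. if i < N then Z i else {}) \<in> assignments K N Nz"
    using Z by (auto simp: assignments_def)
  then show "assignments K N Nz \<noteq> {}" by auto
  have "2 \<le> Nz {}" by (rule ge2) (simp add: levels_def)
  also have "\<dots> \<le> N" unfolding N[symmetric] by (rule member_le_sum) (auto simp: levels_def)
  finally show "2 \<le> N" .
next
  fix Z i j assume Z: "Z \<in> assignments K N Nz" "i < N" "j < N"
  have "\<forall>z\<in>levels K. card {k. k < N \<and> exch i j Z k = z} = Nz z"
    unfolding card_exch[OF Z(2,3)] using Z(1) by (simp add: assignments_def)
  moreover have "\<forall>k<N. exch i j Z k \<in> levels K" "\<forall>k. N \<le> k \<longrightarrow> exch i j Z k = {}"
    using Z by (auto simp: assignments_def exch_def)
  ultimately show "exch i j Z \<in> assignments K N Nz"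
    unfolding assignments_def by blast
qed (auto simp: assignments_def)

lemma gvec_square:
  assumes "finite \<K>"
  shows "(gvec \<K> z)\<^sup>2 = 1"
proof -
  have "(\<Prod>k\<in>\<K>. (2 * (if k \<in> z then 1 else 0) - 1 :: real)\<^sup>2) = 1"
    by (intro prod.neutral) auto
  then show ?thesis by (simp add: gvec_def prod_power_distrib)
qed

lemma abs_gvec: "finite \<K> \<Longrightarrow> \<bar>gvec \<K> z\<bar> = 1"
  using gvec_square[of \<K> z] by (simp add: power2_eq_1_iff abs_if) auto

text \<open>The design and regularity conditions at one sample size, with constants that stay fixed
  along the sequence. Positive variances matter for \<open>bounded\<close>: with a zero minimum the
  convention \<open>x / 0 = 0\<close> would empty it of content.\<close>

locale regular_factorial_design =
  fixes K N :: nat and Nz :: "nat set \<Rightarrow> nat" and Y :: "nat \<Rightarrow> nat set \<Rightarrow> real"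
    and c_lo c_hi \<Delta> M N0 :: real
  assumes total: "(\<Sum>z\<in>levels K. Nz z) = N" and ge2: "\<And>z. z \<in> levels K \<Longrightarrow> 2 \<le> Nz z"
    and c_lo: "0 < c_lo" and N0: "0 < N0"
    and Nz_bounds: "\<And>z. z \<in> levels K \<Longrightarrow> c_lo * N0 \<le> Nz z" "\<And>z. z \<in> levels K \<Longrightarrow> Nz z \<le> c_hi * N0"
    and cov_pos: "\<And>z. z \<in> levels K \<Longrightarrow> 0 < cov_Yhat K N Nz Y z z"
    and fourth: "\<And>z. z \<in> levels K \<Longrightarrow> (\<Sum>i<N. (Y i z - Ybar N Y z) ^ 4) / N \<le> \<Delta> ^ 4"
    and bounded: "\<And>i z. i < N \<Longrightarrow> z \<in> levels K \<Longrightarrow>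
        \<bar>Y i z - Ybar N Y z\<bar> / sqrt (Min ((\<lambda>w. Spop N Y w w) ` levels K)) \<le> M"
begin

sublocale exchangeable_design N "levels K" Nz "assignments K N Nz"
  using total ge2 by (rule exchangeable_design_assignments)

abbreviation Om where "Om \<equiv> assignments K N Nz"
abbreviation Q :: real where "Q \<equiv> 2 ^ K"

definition y where "y i z = Y i z - Ybar N Y z"

definition T2 where "T2 z = (\<Sum>i<N. (y i z)\<^sup>2)"

definition smin where "smin = Min ((\<lambda>w. Spop N Y w w) ` levels K)"

text \<open>The mean of the variance estimator; it is at least the variance of every estimated effect.\<close>

definition sig2 where "sig2 = (\<Sum>z\<in>levels K. T2 z / (Nz z * (real N - 1))) / Q\<^sup>2"

definition \<rho> where "\<rho> = c_hi / c_lo"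

text \<open>Up to the factor \<open>1 / sqrt N\<close>, \<open>\<kappa>\<close> bounds the
  contribution of a single unit to an estimated effect in units of \<open>sqrt sig2\<close>; see the
  bound on \<open>A\<close> in \<open>effect_tail\<close>.\<close>

definition \<kappa> where "\<kappa> = M * \<rho> * sqrt \<rho>"

lemma empty_level: "{} \<in> levels K" by (simp add: levels_def)

lemma N_pos: "0 < real N" "0 < real N - 1" "real N \<le> 2 * (real N - 1)"
  using N_ge2 by auto

lemma Nz_pos: "z \<in> levels K \<Longrightarrow> 0 < real (Nz z)" "z \<in> levels K \<Longrightarrow> 0 < real (Nz z) - 1"
  using ge2[of z] by auto

lemma sum_y: "(\<Sum>i<N. y i z) = 0"
  using N_pos by (simp add: y_def sum_subtractf Ybar_def)

lemma Spop_T2: "Spop N Y z z = T2 z / (real N - 1)"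
  by (simp add: Spop_def T2_def y_def power2_eq_square)

lemma c_hi: "c_lo \<le> c_hi" "0 < c_hi"
proof -
  have "c_lo * N0 \<le> c_hi * N0" using Nz_bounds[OF empty_level] by linarith
  then show "c_lo \<le> c_hi" using N0 by simp
  then show "0 < c_hi" using c_lo by linarith
qed

lemma rho_ge1: "1 \<le> \<rho>"
  using c_hi c_lo by (simp add: \<rho>_def)

lemma N_bounds: "c_lo * (Q * N0) \<le> N" "N \<le> c_hi * (Q * N0)"
proof -
  have "(\<Sum>z\<in>levels K. c_lo * N0) \<le> (\<Sum>z\<in>levels K. real (Nz z))"
    "(\<Sum>z\<in>levels K. real (Nz z)) \<le> (\<Sum>z\<in>levels K. c_hi * N0)"
    by (intro sum_mono Nz_bounds; simp)+
  then show "c_lo * (Q * N0) \<le> N" "N \<le> c_hi * (Q * N0)"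
    by (simp_all add: sum_n mult_ac)
qed

lemma two_power_le: "2 ^ K \<le> N"
proof -
  have "(\<Sum>z\<in>levels K. 1) \<le> (\<Sum>z\<in>levels K. Nz z)" using ge2 by (intro sum_mono) force
  then show ?thesis by (simp add: total)
qed

lemma set_pmf_CRE: "set_pmf (CRE K N Nz) = Om"
  unfolding CRE_def using fin_Om Om_ne by simp

lemma prob_CRE: "measure_pmf.prob (CRE K N Nz) {Z. P Z} = card {Z\<in>Om. P Z} / card Om"
  unfolding CRE_def using fin_Om Om_ne by (simp add: measure_pmf_of_set Int_def)

lemma Yhat_centred:
  assumes Z: "Z \<in> Om" and z: "z \<in> levels K"
  shows "Yhat N Nz Y Z z - Ybar N Y z = (\<Sum>i<N. y i z * of_bool (Z i = z)) / Nz z"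
proof -
  have "(\<Sum>i\<in>{i. i < N \<and> Z i = z}. Y i (Z i)) = (\<Sum>i\<in>{i. i < N \<and> Z i = z}. y i z + Ybar N Y z)"
    by (intro sum.cong) (auto simp: y_def)
  also have "\<dots> = (\<Sum>i\<in>{i. i < N \<and> Z i = z}. y i z) + Nz z * Ybar N Y z"
    using counts[OF Z z] by (simp add: sum.distrib)
  also have "(\<Sum>i\<in>{i. i < N \<and> Z i = z}. y i z) = (\<Sum>i<N. y i z * of_bool (Z i = z))"
    by (intro sum.mono_neutral_cong_left) auto
  finally show ?thesis using Nz_pos[OF z] by (simp add: Yhat_def field_simps)
qed

text \<open>If the population variance vanished, all outcomes at this level would coincide, the
  group mean would be constant over assignments, and its variance would be zero.\<close>

lemma Spop_pos:
  assumes z: "z \<in> levels K"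
  shows "0 < Spop N Y z z"
proof (rule ccontr)
  assume "\<not> 0 < Spop N Y z z"
  then have "T2 z \<le> 0" unfolding Spop_T2 using N_pos(2) by (meson divide_pos_pos not_le)
  moreover have "0 \<le> T2 z" unfolding T2_def by (intro sum_nonneg) auto
  ultimately have "\<forall>i\<in>{..<N}. (y i z)\<^sup>2 = 0"
    unfolding T2_def by (subst sum_nonneg_eq_0_iff[symmetric]) auto
  then have "\<And>Z. Z \<in> Om \<Longrightarrow> Yhat N Nz Y Z z = Ybar N Y z"
    using Yhat_centred[OF _ z] by simp
  then have "cov_Yhat K N Nz Y z z = 0"
    using Om_ne fin_Om card_Om_pos
    by (simp add: cov_Yhat_def Let_def CRE_def integral_pmf_of_set)
  then show False using cov_pos[OF z] by simp
qed

lemma smin: "0 < smin" "z \<in> levels K \<Longrightarrow> smin \<le> Spop N Y z z"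
proof -
  show "0 < smin"
    unfolding smin_def using Spop_pos empty_level by (subst Min_gr_iff) auto
  show "z \<in> levels K \<Longrightarrow> smin \<le> Spop N Y z z"
    unfolding smin_def by (intro Min_le) auto
qed

lemma y_bound:
  assumes "i < N" "z \<in> levels K"
  shows "\<bar>y i z\<bar> \<le> M * sqrt smin"
  using bounded[OF assms] smin(1) unfolding y_def[symmetric] smin_def[symmetric]
  by (simp add: divide_le_eq)

lemma M_nonneg: "0 \<le> M"
proof -
  have "0 \<le> M * sqrt smin" using y_bound[of 0, OF _ empty_level] N_pos by force
  then show ?thesis using smin(1) by (simp add: zero_le_mult_iff)
qed

lemma kappa_nonneg: "0 \<le> \<kappa>"
  using M_nonneg rho_ge1 by (simp add: \<kappa>_def)

text \<open>Cauchy-Schwarz against the constant 1, from the fourth moment condition.\<close>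

lemma T2_le: assumes z: "z \<in> levels K" shows "T2 z \<le> N * \<Delta>\<^sup>2"
proof -
  have "(T2 z)\<^sup>2 \<le> (\<Sum>i<N. ((y i z)\<^sup>2)\<^sup>2) * (\<Sum>i<N. 1\<^sup>2)"
    unfolding T2_def using Cauchy_Schwarz_ineq_sum[of "\<lambda>i. (y i z)\<^sup>2" "\<lambda>_. 1" "{..<N}"] by simp
  also have "\<dots> = (\<Sum>i<N. (y i z) ^ 4) * N" by simp
  also have "\<dots> \<le> (\<Delta> ^ 4 * N) * N"
    using fourth[OF z] N_pos unfolding y_def by (intro mult_right_mono) (auto simp: field_simps)
  also have "\<dots> = (N * \<Delta>\<^sup>2)\<^sup>2" by (simp add: power2_eq_square power4_eq_xxxx mult_ac)
  finally show ?thesis by (rule power2_le_imp_le) simp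
qed

lemma T2_div_le: assumes z: "z \<in> levels K" shows "T2 z / (real N - 1) \<le> 2 * \<Delta>\<^sup>2"
proof -
  have "N * \<Delta>\<^sup>2 \<le> (2 * (real N - 1)) * \<Delta>\<^sup>2" using N_pos by (intro mult_right_mono) auto
  with T2_le[OF z] have "T2 z \<le> (2 * (real N - 1)) * \<Delta>\<^sup>2" by linarith
  then show ?thesis unfolding pos_divide_le_eq[OF N_pos(2)] by (simp only: mult_ac)
qed

lemma smin_le: "smin \<le> 2 * \<Delta>\<^sup>2"
  using T2_div_le[OF empty_level] smin(2)[OF empty_level] unfolding Spop_T2 by linarith

text \<open>Each group has at most \<open>c_hi * N0\<close> units and each population variance is at
  least \<open>smin\<close>. This converts the standardisation by \<open>smin\<close> in the
  boundedness condition into one by \<open>sig2\<close>.\<close>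

lemma sig2_ge: "smin / (\<rho> * N) \<le> sig2"
proof -
  have "smin / (c_hi * N0) \<le> T2 z / (Nz z * (real N - 1))" if z: "z \<in> levels K" for z
  proof -
    have "smin / (c_hi * N0) \<le> smin / Nz z"
      using Nz_bounds(2)[OF z] smin(1) Nz_pos[OF z] c_hi N0 by (intro divide_left_mono mult_pos_pos) auto
    also have "\<dots> \<le> Spop N Y z z / Nz z"
      using smin(2)[OF z] by (intro divide_right_mono) auto
    finally show ?thesis by (simp add: Spop_T2 mult_ac)
  qed
  then have "(\<Sum>z\<in>levels K. smin / (c_hi * N0)) \<le> (\<Sum>z\<in>levels K. T2 z / (Nz z * (real N - 1)))"
    by (rule sum_mono)
  then have "Q * (smin / (c_hi * N0)) / Q\<^sup>2 \<le> sig2"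
    unfolding sig2_def by (intro divide_right_mono) auto
  moreover have "Q * (smin / (c_hi * N0)) / Q\<^sup>2 = smin / (c_hi * (Q * N0))"
    by (simp add: power2_eq_square)
  moreover have "smin / (\<rho> * N) \<le> smin / (c_hi * (Q * N0))"
  proof -
    have "c_hi * (Q * N0) \<le> \<rho> * N"
    proof -
      have "\<rho> * (c_lo * (Q * N0)) \<le> \<rho> * N" using N_bounds(1) rho_ge1 by (intro mult_left_mono) auto
      then show ?thesis using c_lo by (simp add: \<rho>_def)
    qed
    then show ?thesis using smin(1) c_hi N0 N_pos rho_ge1
      by (intro divide_left_mono mult_pos_pos) auto
  qed
  ultimately show ?thesis by linarith
qed

lemma sig2_pos: "0 < sig2"
proof -
  have "0 < smin / (\<rho> * N)" using smin(1) N_pos rho_ge1 by simp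
  then show ?thesis using sig2_ge by linarith
qed

lemma inv_QN0: "1 / (c_lo * (Q * N0)) \<le> \<rho> / N"
proof -
  have "N \<le> \<rho> * (c_lo * (Q * N0))" using N_bounds(2) c_lo by (simp add: \<rho>_def)
  then show ?thesis using N_pos c_lo N0 by (simp add: divide_simps mult_ac)
qed

lemma sig2_le: "sig2 \<le> 2 * \<Delta>\<^sup>2 * \<rho> / N"
proof -
  have "T2 z / (Nz z * (real N - 1)) \<le> 2 * \<Delta>\<^sup>2 * (1 / (c_lo * N0))" if z: "z \<in> levels K" for z
  proof -
    have 2: "1 / Nz z \<le> 1 / (c_lo * N0)"
      using Nz_bounds(1)[OF z] Nz_pos[OF z] c_lo N0 by (intro divide_left_mono mult_pos_pos) auto
    have "T2 z / (real N - 1) * (1 / Nz z) \<le> 2 * \<Delta>\<^sup>2 * (1 / (c_lo * N0))"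
      by (intro mult_mono T2_div_le[OF z] 2) auto
    then show ?thesis by (simp add: mult_ac)
  qed
  then have "(\<Sum>z\<in>levels K. T2 z / (Nz z * (real N - 1))) \<le> (\<Sum>z\<in>levels K. 2 * \<Delta>\<^sup>2 * (1 / (c_lo * N0)))"
    by (rule sum_mono)
  then have "sig2 \<le> Q * (2 * \<Delta>\<^sup>2 * (1 / (c_lo * N0))) / Q\<^sup>2"
    unfolding sig2_def by (intro divide_right_mono) auto
  also have "\<dots> = 2 * \<Delta>\<^sup>2 * (1 / (c_lo * (Q * N0)))" by (simp add: power2_eq_square)
  also have "\<dots> \<le> 2 * \<Delta>\<^sup>2 * (\<rho> / N)" by (intro mult_left_mono inv_QN0) auto
  finally show ?thesis by simp
qed

section \<open>The variance estimator: common value, deterministic upper bound, lower tail\<close>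

lemma Shat_eq:
  assumes Z: "Z \<in> Om" and z: "z \<in> levels K"
  shows "Shat N Nz Y Z z = ((\<Sum>i<N. (y i z)\<^sup>2 * of_bool (Z i = z)) - (\<Sum>i<N. y i z * of_bool (Z i = z))\<^sup>2 / Nz z) / (real (Nz z) - 1)"
proof -
  let ?I = "{i. i < N \<and> Z i = z}"
  define m where "m = (\<Sum>i<N. y i z * of_bool (Z i = z)) / Nz z"
  have 1: "(\<Sum>i\<in>?I. y i z) = Nz z * m"
    using Nz_pos[OF z] unfolding m_def by (simp, intro sum.mono_neutral_cong_left) auto
  have 2: "(\<Sum>i\<in>?I. (y i z)\<^sup>2) = (\<Sum>i<N. (y i z)\<^sup>2 * of_bool (Z i = z))"
    by (intro sum.mono_neutral_cong_left) auto
  have "Yhat N Nz Y Z z = Ybar N Y z + m" using Yhat_centred[OF Z z] by (simp add: m_def)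
  then have "(\<Sum>i\<in>?I. (Y i (Z i) - Yhat N Nz Y Z z)\<^sup>2) = (\<Sum>i\<in>?I. (y i z)\<^sup>2 - 2 * m * y i z + m\<^sup>2)"
    by (intro sum.cong) (auto simp: y_def power2_eq_square algebra_simps)
  also have "\<dots> = (\<Sum>i\<in>?I. (y i z)\<^sup>2) - 2 * m * (Nz z * m) + Nz z * m\<^sup>2"
    using counts[OF Z z] by (simp add: sum.distrib sum_subtractf flip: sum_distrib_left 1)
  also have "\<dots> = (\<Sum>i<N. (y i z)\<^sup>2 * of_bool (Z i = z)) - (Nz z * m)\<^sup>2 / Nz z"
    unfolding 2 using Nz_pos[OF z] by (simp add: power2_eq_square)
  finally show ?thesis using Nz_pos[OF z] by (simp add: Shat_def m_def)
qed

lemma sigma_hat_sq_eq: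
  assumes Z: "Z \<in> Om" and "finite \<K>"
  shows "sigma_hat_sq K N Nz Y Z \<K> = (\<Sum>z\<in>levels K. ((\<Sum>i<N. (y i z)\<^sup>2 * of_bool (Z i = z)) -
    (\<Sum>i<N. y i z * of_bool (Z i = z))\<^sup>2 / Nz z) / (Nz z * (real (Nz z) - 1))) / Q\<^sup>2"
proof -
  have "gvec \<K> z * s * gvec \<K> z = s" for z s
    using gvec_square[OF assms(2), of z] by (simp add: power2_eq_square)
  then have "gvec \<K> z * (s / real (Nz z)) * gvec \<K> z = s / real (Nz z)" for z s by blast
  then show ?thesis
    unfolding sigma_hat_sq_def by (simp only:) (simp add: Shat_eq[OF Z] mult.commute)
qed

lemma sigma_hat_sq_indep:
  assumes "Z \<in> Om" "finite \<K>"
  shows "sigma_hat_sq K N Nz Y Z \<K> = sigma_hat_sq K N Nz Y Z {}"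
  using assms by (simp add: sigma_hat_sq_eq)

text \<open>This holds for every assignment: the squared group mean is dropped and each squared
  outcome bounded by \<open>M\<^sup>2 * smin\<close>. Power is therefore controlled without an upper
  tail of the variance estimator.\<close>

lemma sigma_hat_sq_le:
  assumes Z: "Z \<in> Om" and "finite \<K>"
  shows "sigma_hat_sq K N Nz Y Z \<K> \<le> 4 * M\<^sup>2 * \<Delta>\<^sup>2 * \<rho> / N"
proof -
  have "((\<Sum>i<N. (y i z)\<^sup>2 * of_bool (Z i = z)) - (\<Sum>i<N. y i z * of_bool (Z i = z))\<^sup>2 / Nz z) / (Nz z * (real (Nz z) - 1))
      \<le> 2 * (M\<^sup>2 * smin) * (1 / (c_lo * N0))" (is "?l / _ \<le> _") if z: "z \<in> levels K" for z
  proof -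
    have "?l \<le> (\<Sum>i<N. (y i z)\<^sup>2 * of_bool (Z i = z))" by simp
    also have "\<dots> \<le> (\<Sum>i<N. M\<^sup>2 * smin * of_bool (Z i = z))"
    proof (intro sum_mono mult_right_mono)
      fix i assume "i \<in> {..<N}"
      then have "\<bar>y i z\<bar>\<^sup>2 \<le> (M * sqrt smin)\<^sup>2" using y_bound z by (intro power_mono) auto
      then show "(y i z)\<^sup>2 \<le> M\<^sup>2 * smin" using smin(1) by (simp add: power_mult_distrib)
    qed auto
    also have "\<dots> = M\<^sup>2 * smin * Nz z"
      using counts[OF Z z] by (simp add: sum.If_cases Int_def flip: sum_distrib_left)
    finally have "?l / (Nz z * (real (Nz z) - 1)) \<le> M\<^sup>2 * smin * Nz z / (Nz z * (real (Nz z) - 1))"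
      using Nz_pos[OF z] by (intro divide_right_mono) auto
    also have "\<dots> = M\<^sup>2 * smin * (1 / (real (Nz z) - 1))" using Nz_pos[OF z] by simp
    also have "\<dots> \<le> M\<^sup>2 * smin * (2 * (1 / (c_lo * N0)))"
    proof (rule mult_left_mono)
      have "c_lo * N0 \<le> 2 * (real (Nz z) - 1)" proof -
      have "2 \<le> real (Nz z)" using ge2[OF z] by simp
      then have "real (Nz z) \<le> 2 * (real (Nz z) - 1)" by simp
      then show ?thesis by (rule order_trans[OF Nz_bounds(1)[OF z]])
    qed
      then show "1 / (real (Nz z) - 1) \<le> 2 * (1 / (c_lo * N0))"
        using Nz_pos[OF z] c_lo N0 by (simp add: divide_simps)
    qed (use smin(1) in simp)
    finally show ?thesis by (simp add: mult_ac)
  qed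
  then have "sigma_hat_sq K N Nz Y Z \<K> \<le> (\<Sum>z\<in>levels K. 2 * (M\<^sup>2 * smin) * (1 / (c_lo * N0))) / Q\<^sup>2"
    unfolding sigma_hat_sq_eq[OF assms] by (intro divide_right_mono sum_mono) auto
  also have "\<dots> = 2 * (M\<^sup>2 * smin) * (1 / (c_lo * (Q * N0)))" by (simp add: power2_eq_square mult_ac)
  also have "\<dots> \<le> 2 * (M\<^sup>2 * (2 * \<Delta>\<^sup>2)) * (\<rho> / N)"
    using smin smin_le c_lo N0 by (intro mult_mono mult_left_mono inv_QN0) auto
  finally show ?thesis by simp
qed

lemma kappa_pow: "\<kappa>\<^sup>2 = M\<^sup>2 * \<rho> ^ 3" "\<kappa> ^ 4 = M ^ 4 * \<rho> ^ 6"
proof -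
  show 1: "\<kappa>\<^sup>2 = M\<^sup>2 * \<rho> ^ 3"
    using rho_ge1 by (simp add: \<kappa>_def power_mult_distrib power2_eq_square power3_eq_cube)
  have "\<kappa> ^ 4 = (\<kappa>\<^sup>2)\<^sup>2" by simp
  then show "\<kappa> ^ 4 = M ^ 4 * \<rho> ^ 6" unfolding 1 by (simp add: power_mult_distrib flip: power_mult)
qed

text \<open>Chebyshev's inequality with the second moment from
  \<open>group_variance_second_moment\<close>. Overestimating the variance cannot cause a false
  rejection, so one side is enough.\<close>

lemma variance_estimator_lower_tail:
  assumes eps: "0 < \<epsilon>"
  shows "measure_pmf.prob (CRE K N Nz) {Z. sigma_hat_sq K N Nz Y Z {} \<le> (1 - \<epsilon>) * sig2} \<le> 384 * \<kappa> ^ 4 / (\<epsilon>\<^sup>2 * N)"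
proof -
  define F where "F Z = (\<Sum>z\<in>levels K. ((\<Sum>i<N. (y i z)\<^sup>2 * of_bool (Z i = z)) -
    (\<Sum>i<N. y i z * of_bool (Z i = z))\<^sup>2 / Nz z) / (Nz z * (real (Nz z) - 1)))" for Z
  define B where "B = {Z\<in>Om. sigma_hat_sq K N Nz Y Z {} \<le> (1 - \<epsilon>) * sig2}"
  have mean: "(\<Sum>z\<in>levels K. T2 z / (Nz z * (real N - 1))) = Q\<^sup>2 * sig2"
    by (simp add: sig2_def)
  have mom: "(\<Sum>Z\<in>Om. (F Z - Q\<^sup>2 * sig2)\<^sup>2) \<le> card Om * (384 * N * ((M * sqrt smin)\<^sup>2 / (c_lo * N0)\<^sup>2)\<^sup>2)"
    using group_variance_second_moment[of y "M * sqrt smin" "c_lo * N0"] sum_y y_bound ge2 c_lo N0 Nz_bounds(1)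
    unfolding F_def mean[symmetric] T2_def by simp
  have dev: "(\<epsilon> * (Q\<^sup>2 * sig2))\<^sup>2 \<le> (F Z - Q\<^sup>2 * sig2)\<^sup>2" if "Z \<in> B" for Z
  proof -
    have "F Z / Q\<^sup>2 \<le> (1 - \<epsilon>) * sig2"
      using that sigma_hat_sq_eq[of Z "{}"] by (simp add: B_def F_def)
    then have "F Z \<le> (1 - \<epsilon>) * sig2 * Q\<^sup>2" by (simp add: pos_divide_le_eq)
    then have "\<epsilon> * (Q\<^sup>2 * sig2) \<le> Q\<^sup>2 * sig2 - F Z" by (simp add: algebra_simps)
    then have "(\<epsilon> * (Q\<^sup>2 * sig2))\<^sup>2 \<le> (Q\<^sup>2 * sig2 - F Z)\<^sup>2" using eps sig2_pos by (intro power_mono) auto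
    then show ?thesis by (simp add: power2_commute)
  qed
  have "card B * (\<epsilon> * (Q\<^sup>2 * sig2))\<^sup>2 = (\<Sum>Z\<in>B. (\<epsilon> * (Q\<^sup>2 * sig2))\<^sup>2)" by simp
  also have "\<dots> \<le> (\<Sum>Z\<in>B. (F Z - Q\<^sup>2 * sig2)\<^sup>2)" by (intro sum_mono dev)
  also have "\<dots> \<le> (\<Sum>Z\<in>Om. (F Z - Q\<^sup>2 * sig2)\<^sup>2)" using fin_Om by (intro sum_mono2) (auto simp: B_def)
  also note mom
  finally have 1: "card B * (\<epsilon> * (Q\<^sup>2 * sig2))\<^sup>2 \<le> card Om * (384 * N * ((M * sqrt smin)\<^sup>2 / (c_lo * N0)\<^sup>2)\<^sup>2)" .
  have 2: "384 * N * ((M * sqrt smin)\<^sup>2 / (c_lo * N0)\<^sup>2)\<^sup>2 \<le> 384 * \<kappa> ^ 4 / (\<epsilon>\<^sup>2 * N) * (\<epsilon> * (Q\<^sup>2 * sig2))\<^sup>2"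
  proof -
    have a: "1 / (c_lo * N0)\<^sup>2 \<le> Q\<^sup>2 * (\<rho> / N)\<^sup>2"
    proof -
      have "(1 / (c_lo * (Q * N0)))\<^sup>2 \<le> (\<rho> / N)\<^sup>2" using inv_QN0 c_lo N0 by (intro power_mono) auto
      then have "Q\<^sup>2 * (1 / (c_lo * (Q * N0)))\<^sup>2 \<le> Q\<^sup>2 * (\<rho> / N)\<^sup>2" by (intro mult_left_mono) auto
      then show ?thesis by (simp add: power_mult_distrib power_divide)
    qed
    \<comment> \<open>The moment bound is stated through \<open>smin\<close> and \<open>N0\<close>;
      trading them for \<open>sig2\<close> and \<open>N\<close> makes it a relative error, and the
      powers of \<open>\<rho>\<close> are absorbed into \<open>\<kappa>\<close>.\<close>
    have "smin * (1 / (c_lo * N0)\<^sup>2) \<le> (\<rho> * N * sig2) * (Q\<^sup>2 * (\<rho> / N)\<^sup>2)"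
    proof (intro mult_mono a)
      show "smin \<le> \<rho> * N * sig2"
        using sig2_ge rho_ge1 N_pos by (simp add: divide_le_eq mult_ac)
    qed (use rho_ge1 sig2_pos in auto)
    also have "\<dots> = Q\<^sup>2 * sig2 * \<rho> ^ 3 / N"
      using N_pos by (simp add: power2_eq_square power3_eq_cube)
    finally have "(M\<^sup>2 * (smin * (1 / (c_lo * N0)\<^sup>2)))\<^sup>2 \<le> (M\<^sup>2 * (Q\<^sup>2 * sig2 * \<rho> ^ 3 / N))\<^sup>2"
      using smin(1) by (intro power_mono mult_left_mono) auto
    then have "384 * N * (M\<^sup>2 * (smin * (1 / (c_lo * N0)\<^sup>2)))\<^sup>2 \<le> 384 * N * (M\<^sup>2 * (Q\<^sup>2 * sig2 * \<rho> ^ 3 / N))\<^sup>2"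
      by (intro mult_left_mono) auto
    also have "\<dots> = 384 * N * (\<kappa>\<^sup>2 * (Q\<^sup>2 * sig2) / N)\<^sup>2" unfolding kappa_pow by (simp add: mult_ac)
    also have "\<dots> = 384 * \<kappa> ^ 4 / (\<epsilon>\<^sup>2 * N) * (\<epsilon> * (Q\<^sup>2 * sig2))\<^sup>2"
      using N_pos eps by (simp add: power_mult_distrib power_divide power2_eq_square power4_eq_xxxx)
    finally show ?thesis using smin(1) by (simp add: power_mult_distrib)
  qed
  have "card B * (\<epsilon> * (Q\<^sup>2 * sig2))\<^sup>2 \<le> card Om * (384 * \<kappa> ^ 4 / (\<epsilon>\<^sup>2 * N) * (\<epsilon> * (Q\<^sup>2 * sig2))\<^sup>2)"
    by (rule order_trans[OF 1]) (intro mult_left_mono 2, simp)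
  then have "(card B) * (\<epsilon> * (Q\<^sup>2 * sig2))\<^sup>2 \<le> (card Om * (384 * \<kappa> ^ 4 / (\<epsilon>\<^sup>2 * N))) * (\<epsilon> * (Q\<^sup>2 * sig2))\<^sup>2"
    by (simp only: mult.assoc)
  moreover have "0 < (\<epsilon> * (Q\<^sup>2 * sig2))\<^sup>2" using eps sig2_pos by simp
  ultimately have "card B \<le> card Om * (384 * \<kappa> ^ 4 / (\<epsilon>\<^sup>2 * N))" by (rule mult_right_le_imp_le)
  then show ?thesis unfolding prob_CRE B_def[symmetric] using card_Om_pos by (simp add: divide_le_eq mult_ac)
qed

section \<open>Deviation of a single estimated effect\<close>

lemma tau_hat_linstat:
  assumes Z: "Z \<in> Om"
  shows "tau_hat K N Nz Y Z \<K> - tau K N Y \<K> = linstat N (\<lambda>i z. gvec \<K> z / (Nz z * Q) * y i z) Z"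
proof -
  have "tau_hat K N Nz Y Z \<K> - tau K N Y \<K> = (\<Sum>z\<in>levels K. gvec \<K> z * (Yhat N Nz Y Z z - Ybar N Y z)) / Q"
    by (simp add: tau_hat_def tau_def right_diff_distrib sum_subtractf diff_divide_distrib)
  also have "\<dots> = (\<Sum>z\<in>levels K. gvec \<K> z / (Nz z * Q) * (\<Sum>i<N. y i z * of_bool (Z i = z)))"
    unfolding sum_divide_distrib by (intro sum.cong refl) (simp add: Yhat_centred[OF Z])
  also have "\<dots> = linstat N (\<lambda>i z. gvec \<K> z / (Nz z * Q) * y i z) Z"
    by (rule sum_group_linstat[OF Z])
  finally show ?thesis .
qed

text \<open>A Chernoff bound with the Gaussian exponent \<open>r\<^sup>2 * t\<^sup>2 / 2\<close>.
  The error terms depend only on \<open>u\<close>, which bounds the tilt times the largest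
  contribution of one unit.\<close>

lemma effect_tail:
  fixes r t u :: real
  assumes fin: "finite \<K>" and t: "0 < t" and r: "0 < r" "r \<le> 1" and small: "8 * (\<kappa> * t / sqrt N) \<le> 1"
  defines "u \<equiv> \<kappa> * t / sqrt N"
  shows "measure_pmf.prob (CRE K N Nz) {Z. r * t * sqrt sig2 \<le> \<bar>tau_hat K N Nz Y Z \<K> - tau K N Y \<K>\<bar>}
     \<le> 2 * exp (- (r\<^sup>2 * t\<^sup>2 / 2) + 24 * N * (2 * u)^3 + 3 * (2 * u)\<^sup>2)"
proof -
  define a where "a i z = gvec \<K> z / (Nz z * Q) * y i z" for i z
  define A where "A = M * sqrt smin * (\<rho> / N)"
  \<comment> \<open>The minimiser of
    \<open>\<theta>\<^sup>2 * sig2 / 2 - \<theta> * (r * t * sqrt sig2)\<close>.\<close>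
  define \<theta> where "\<theta> = r * t / sqrt sig2"
  have th: "0 < \<theta>" using t r sig2_pos by (simp add: \<theta>_def)
  have A0: "0 \<le> A" using M_nonneg smin(1) rho_ge1 by (simp add: A_def)
  have u0: "0 \<le> u" using kappa_nonneg t by (simp add: u_def)
  have Ath: "A * \<theta> \<le> u"
  proof -
    have "sqrt smin \<le> sqrt (\<rho> * N * sig2)"
      using sig2_ge rho_ge1 N_pos by (simp add: divide_le_eq mult_ac)
    then have "A \<le> M * sqrt (\<rho> * N * sig2) * (\<rho> / N)"
      unfolding A_def using M_nonneg rho_ge1 by (intro mult_right_mono mult_left_mono) auto
    also have "\<dots> = \<kappa> * sqrt sig2 * (sqrt N / N)"
      by (simp add: \<kappa>_def real_sqrt_mult)
    also have "sqrt N / N = 1 / sqrt N" using N_pos by (simp add: real_div_sqrt field_simps)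
    finally have "A * \<theta> \<le> \<kappa> * sqrt sig2 * (1 / sqrt N) * \<theta>" using th by (intro mult_right_mono) auto
    also have "\<dots> = r * u" using sig2_pos by (simp add: \<theta>_def u_def)
    also have "\<dots> \<le> 1 * u" using r u0 by (intro mult_right_mono) auto
    finally show ?thesis by simp
  qed
  have tail: "real (card {Z\<in>Om. r * t * sqrt sig2 \<le> \<bar>linstat N a Z\<bar>}) \<le> 2 * card Om *
     exp (\<theta>\<^sup>2 * ((\<Sum>i<N. \<Sum>z\<in>levels K. real (Nz z) * (a i z)\<^sup>2) / N) / 2 - \<theta> * (r * t * sqrt sig2) + 24 * N * (2 * A * \<theta>)^3 + 3 * (2 * A * \<theta>)\<^sup>2)"
  proof (rule tail_bound)
    show "(\<Sum>i<N. a i z) = 0" for z unfolding a_def by (simp add: sum_y flip: sum_distrib_left sum_divide_distrib)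
    show "\<bar>a i z\<bar> \<le> A" if "i < N" "z \<in> levels K" for i z
    proof -
      have "1 / (Nz z * Q) \<le> 1 / (c_lo * N0 * Q)"
        using Nz_bounds(1)[OF that(2)] Nz_pos(1)[OF that(2)] c_lo N0 by (intro divide_left_mono mult_right_mono mult_pos_pos) auto
      also have "\<dots> \<le> \<rho> / N" using inv_QN0 by (simp add: mult_ac)
      finally have "1 / (Nz z * Q) * \<bar>y i z\<bar> \<le> \<rho> / N * (M * sqrt smin)"
        using y_bound[OF that] rho_ge1 by (intro mult_mono) auto
      moreover have "\<bar>a i z\<bar> = 1 / (Nz z * Q) * \<bar>y i z\<bar>"
        using abs_gvec[OF fin, of z] by (simp add: a_def abs_mult)
      ultimately show ?thesis unfolding A_def by (metis mult.commute)
    qed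
    show "8 * A * \<theta> \<le> 1" using Ath small by (simp add: u_def)
  qed (use th in auto)
  have V: "(\<Sum>i<N. \<Sum>z\<in>levels K. real (Nz z) * (a i z)\<^sup>2) / N \<le> sig2"
  proof -
    have "(\<Sum>i<N. \<Sum>z\<in>levels K. real (Nz z) * (a i z)\<^sup>2) = (\<Sum>z\<in>levels K. T2 z / (Nz z * Q\<^sup>2))"
    proof -
      have "real (Nz z) * (a i z)\<^sup>2 = (y i z)\<^sup>2 / (Nz z * Q\<^sup>2)" if "z \<in> levels K" for i z
        using Nz_pos(1)[OF that] gvec_square[OF fin, of z]
        by (simp add: a_def power_mult_distrib power_divide) (simp add: power2_eq_square)
      then have "(\<Sum>i<N. \<Sum>z\<in>levels K. real (Nz z) * (a i z)\<^sup>2) = (\<Sum>i<N. \<Sum>z\<in>levels K. (y i z)\<^sup>2 / (Nz z * Q\<^sup>2))"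
        by (intro sum.cong refl) auto
      also have "\<dots> = (\<Sum>z\<in>levels K. T2 z / (Nz z * Q\<^sup>2))"
        unfolding T2_def sum_divide_distrib by (rule sum.swap)
      finally show ?thesis .
    qed
    also have "\<dots> / N = (\<Sum>z\<in>levels K. T2 z / (Nz z * N)) / Q\<^sup>2"
      unfolding sum_divide_distrib by (intro sum.cong refl) (simp add: mult_ac)
    also have "\<dots> \<le> sig2"
      unfolding sig2_def
    proof (intro divide_right_mono sum_mono divide_left_mono)
      fix z assume "z \<in> levels K"
      then show "Nz z * (real N - 1) \<le> Nz z * N" "0 \<le> T2 z" "0 < real (Nz z * N) * (real (Nz z) * (real N - 1))"
        using Nz_pos N_pos by (auto simp: T2_def intro!: mult_left_mono mult_pos_pos sum_nonneg)
    qed auto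
    finally show ?thesis .
  qed
  have "\<theta>\<^sup>2 * ((\<Sum>i<N. \<Sum>z\<in>levels K. real (Nz z) * (a i z)\<^sup>2) / N) / 2 - \<theta> * (r * t * sqrt sig2) \<le> \<theta>\<^sup>2 * sig2 / 2 - \<theta> * (r * t * sqrt sig2)"
    using V by (intro diff_right_mono divide_right_mono mult_left_mono) auto
  also have "\<theta>\<^sup>2 * sig2 = r\<^sup>2 * t\<^sup>2" using sig2_pos by (simp add: \<theta>_def power_divide power_mult_distrib)
  finally have "\<theta>\<^sup>2 * ((\<Sum>i<N. \<Sum>z\<in>levels K. real (Nz z) * (a i z)\<^sup>2) / N) / 2 - \<theta> * (r * t * sqrt sig2)
      \<le> r\<^sup>2 * t\<^sup>2 / 2 - \<theta> * (r * t * sqrt sig2)" .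
  moreover have "\<theta> * (r * t * sqrt sig2) = r\<^sup>2 * t\<^sup>2" using sig2_pos by (simp add: \<theta>_def power2_eq_square)
  ultimately have e1: "\<theta>\<^sup>2 * ((\<Sum>i<N. \<Sum>z\<in>levels K. real (Nz z) * (a i z)\<^sup>2) / N) / 2 - \<theta> * (r * t * sqrt sig2) \<le> - (r\<^sup>2 * t\<^sup>2 / 2)"
    by linarith
  have le: "2 * A * \<theta> \<le> 2 * u" and ge: "0 \<le> 2 * A * \<theta>" using Ath A0 th by auto
  have "(2 * A * \<theta>)^3 \<le> (2 * u)^3" "(2 * A * \<theta>)\<^sup>2 \<le> (2 * u)\<^sup>2"
    using power_mono[OF le ge] by blast+
  then have e2: "24 * N * (2 * A * \<theta>)^3 + 3 * (2 * A * \<theta>)\<^sup>2 \<le> 24 * N * (2 * u)^3 + 3 * (2 * u)\<^sup>2"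
    by (intro add_mono mult_left_mono) auto
  have "real (card {Z\<in>Om. r * t * sqrt sig2 \<le> \<bar>linstat N a Z\<bar>}) \<le> 2 * card Om * exp (- (r\<^sup>2 * t\<^sup>2 / 2) + 24 * N * (2 * u)^3 + 3 * (2 * u)\<^sup>2)"
    by (rule order_trans[OF tail]) (use e1 e2 in \<open>intro mult_left_mono, auto\<close>)
  moreover have "{Z\<in>Om. r * t * sqrt sig2 \<le> \<bar>tau_hat K N Nz Y Z \<K> - tau K N Y \<K>\<bar>} = {Z\<in>Om. r * t * sqrt sig2 \<le> \<bar>linstat N a Z\<bar>}"
    unfolding a_def using tau_hat_linstat by auto
  ultimately show ?thesis
    unfolding prob_CRE using card_Om_pos by (simp add: divide_le_eq mult_ac)
qed

end

text \<open>On the event that every test on the ideal path decides correctly, the procedure follows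
  that path.\<close>

lemma screen_eq:
  assumes heredity: "\<And>\<K>. \<K> \<subseteq> {1..K} \<Longrightarrow> 2 \<le> card \<K> \<Longrightarrow> tau K N Y \<K> \<noteq> 0 \<Longrightarrow>
      (case h of Weak \<Rightarrow> (\<exists>\<K>'\<in>parents \<K>. tau K N Y \<K>' \<noteq> 0) | Strong \<Rightarrow> (\<forall>\<K>'\<in>parents \<K>. tau K N Y \<K>' \<noteq> 0))"
    and decide: "\<And>d \<K>. 1 \<le> d \<Longrightarrow> d \<le> D \<Longrightarrow> \<K> \<in> candidates h K d (insert {} (Mstar_upto K N Y (d - 1))) \<Longrightarrow>
      Phi_inv (1 - min (\<alpha> d / real (card (candidates h K d (insert {} (Mstar_upto K N Y (d - 1)))))) 1 / 2)
        \<le> \<bar>tau_hat K N Nz Y Z \<K> / sqrt (sigma_hat_sq K N Nz Y Z \<K>)\<bar> \<longleftrightarrow> tau K N Y \<K> \<noteq> 0"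
    and "d \<le> D"
  shows "screen h K N Nz Y \<alpha> Z d = insert {} (Mstar_upto K N Y d)"
  using \<open>d \<le> D\<close>
proof (induction d)
  case 0
  then show ?case by (simp add: Mstar_upto_def)
next
  case (Suc d)
  let ?M = "insert {} (Mstar_upto K N Y d)"
  let ?C = "candidates h K (Suc d) ?M"
  have IH: "screen h K N Nz Y \<alpha> Z d = ?M" using Suc by simp
  have sub: "Mstar K N Y (Suc d) \<subseteq> ?C"
  proof
    fix \<K> assume "\<K> \<in> Mstar K N Y (Suc d)"
    then have \<K>: "\<K> \<subseteq> {1..K}" "card \<K> = Suc d" "tau K N Y \<K> \<noteq> 0" by (auto simp: Mstar_def)
    have fin: "finite \<K>" using \<K>(1) by (rule finite_subset) simp
    have par: "\<K>' \<subseteq> {1..K}" "finite \<K>'" "card \<K>' = d" if "\<K>' \<in> parents \<K>" for \<K>'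
      using that \<K> fin by (auto simp: parents_def intro: finite_subset)
    show "\<K> \<in> ?C"
    \<comment> \<open>Heredity is assumed from order two on. The only parent of a main effect is the
      empty set, with which the procedure starts, so every singleton is a candidate under both
      types.\<close>
    proof (cases "d = 0")
      case True
      have "parents \<K> = {{}}"
      proof
        show "parents \<K> \<subseteq> {{}}" using par True by auto
        show "{{}} \<subseteq> parents \<K>" using \<K>(2) True by (auto simp: parents_def)
      qed
      then show ?thesis using \<K> by (cases h) (auto simp: candidates_def)
    next
      case False
      then have her: "case h of Weak \<Rightarrow> (\<exists>\<K>'\<in>parents \<K>. tau K N Y \<K>' \<noteq> 0) | Strong \<Rightarrow> (\<forall>\<K>'\<in>parents \<K>. tau K N Y \<K>' \<noteq> 0)"
        using heredity[OF \<K>(1) _ \<K>(3)] \<K>(2) by simp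
      have "\<K>' \<in> ?M" if "\<K>' \<in> parents \<K>" "tau K N Y \<K>' \<noteq> 0" for \<K>'
        using par[OF that(1)] that(2) False by (auto simp: Mstar_upto_def Mstar_def)
      then show ?thesis using her \<K> by (cases h) (auto simp: candidates_def)
    qed
  qed
  have "retained h K N Nz Y \<alpha> Z (Suc d) ?M = {\<K>\<in>?C. tau K N Y \<K> \<noteq> 0}"
    unfolding retained_def Let_def using decide[of "Suc d"] Suc.prems by auto
  also have "\<dots> = Mstar K N Y (Suc d)"
    using sub by (auto simp: candidates_def Mstar_def)
  finally have "screen h K N Nz Y \<alpha> Z (Suc d) = ?M \<union> Mstar K N Y (Suc d)"
    by (simp add: IH Let_def)
  also have "Mstar_upto K N Y (Suc d) = Mstar_upto K N Y d \<union> Mstar K N Y (Suc d)"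
    by (simp add: Mstar_upto_def atLeastAtMostSuc_conv Un_commute)
  then have "?M \<union> Mstar K N Y (Suc d) = insert {} (Mstar_upto K N Y (Suc d))" by auto
  finally show ?case .
qed

lemma empty_notin_Mstar_upto: "{} \<notin> Mstar_upto K N Y D"
  by (auto simp: Mstar_upto_def Mstar_def)

section \<open>Critical values\<close>

definition std_normal :: "real measure" where
  "std_normal = density lborel std_normal_density"

lemma real_distribution_std_normal: "real_distribution std_normal"
proof -
  interpret prob_space std_normal
    unfolding std_normal_def by (rule prob_space_normal_density) simp
  show ?thesis by standard (simp_all add: std_normal_def)
qed

interpretation std_normal: real_distribution std_normal
  by (rule real_distribution_std_normal)

lemma Phi_cdf: "Phi = cdf std_normal"
  by (simp add: fun_eq_iff Phi_def cdf_def std_normal_def)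

lemma std_normal_density_eq: "std_normal_density x = exp (- x\<^sup>2 / 2) / sqrt (2 * pi)"
  by (simp add: normal_density_def)

lemma std_normal_interval_ge:
  assumes "a < b" "\<And>u. a < u \<Longrightarrow> u \<le> b \<Longrightarrow> c \<le> std_normal_density u" "0 \<le> c"
  shows "c * (b - a) \<le> Phi b - Phi a"
proof -
  have "ennreal (c * (b - a)) = (\<integral>\<^sup>+u. ennreal c * indicator {a<..b} u \<partial>lborel)"
    using assms by (simp add: nn_integral_cmult_indicator ennreal_mult)
  also have "\<dots> \<le> (\<integral>\<^sup>+u. ennreal (std_normal_density u) * indicator {a<..b} u \<partial>lborel)"
    using assms(2) by (intro nn_integral_mono) (auto simp: indicator_def intro!: ennreal_leI)
  also have "\<dots> = emeasure std_normal {a<..b}"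
    unfolding std_normal_def by (subst emeasure_density) auto
  also have "\<dots> = ennreal (measure std_normal {a<..b})" by (rule std_normal.emeasure_eq_measure)
  also have "measure std_normal {a<..b} = Phi b - Phi a"
    unfolding Phi_cdf using std_normal.cdf_diff_eq[OF assms(1)] by simp
  finally show ?thesis
    using std_normal.cdf_nondecreasing[of a b] assms(1) by (simp add: Phi_cdf)
qed

lemma strict_mono_Phi: "strict_mono Phi"
proof (rule strict_monoI)
  fix a b :: real assume ab: "a < b"
  define c where "c = std_normal_density (\<bar>a\<bar> + \<bar>b\<bar>)"
  have c: "0 < c" by (simp add: c_def normal_density_pos)
  have "c * (b - a) \<le> Phi b - Phi a"
  proof (rule std_normal_interval_ge[OF ab])
    fix u assume "a < u" "u \<le> b"
    then have "\<bar>u\<bar> \<le> \<bar>a\<bar> + \<bar>b\<bar>" by linarith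
    then have "\<bar>u\<bar>\<^sup>2 \<le> (\<bar>a\<bar> + \<bar>b\<bar>)\<^sup>2" by (intro power_mono) auto
    then show "c \<le> std_normal_density u"
      unfolding c_def std_normal_density_eq by (intro divide_right_mono) auto
  qed (use c in simp)
  moreover have "0 < c * (b - a)" using c ab by simp
  ultimately show "Phi a < Phi b" by linarith
qed

lemma continuous_Phi: "isCont Phi x"
proof -
  have "emeasure std_normal {x} = (\<integral>\<^sup>+u. ennreal (std_normal_density u) * indicator {x} u \<partial>lborel)"
    unfolding std_normal_def by (subst emeasure_density) auto
  also have "\<dots> = 0" by (subst nn_integral_indicator_singleton) auto
  finally show ?thesis
    unfolding Phi_cdf std_normal.isCont_cdf by (simp add: measure_def)
qed

text \<open>The density decreases on the unit interval beyond \<open>t\<close>, so its value at the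
  right end bounds the mass there. The shift by 1 costs only an arbitrarily small factor in the
  exponent.\<close>

lemma Phi_tail_ge:
  assumes "0 \<le> t"
  shows "std_normal_density (t + 1) \<le> 1 - Phi t"
proof -
  have "std_normal_density (t + 1) * (t + 1 - t) \<le> Phi (t + 1) - Phi t"
  proof (rule std_normal_interval_ge)
    fix u assume "t < u" "u \<le> t + 1"
    then have "u\<^sup>2 \<le> (t + 1)\<^sup>2" using assms by (intro power_mono) auto
    then show "std_normal_density (t + 1) \<le> std_normal_density u"
      unfolding std_normal_density_eq by (intro divide_right_mono) auto
  qed auto
  moreover have "Phi (t + 1) \<le> 1" unfolding Phi_cdf by (rule std_normal.cdf_bounded_prob)
  ultimately show ?thesis by simp
qed

text \<open>Tilting by 1: the standard normal density is \<open>exp (1 / 2 - u)\<close> times the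
  normal density with mean 1. A linear exponent suffices to make critical values logarithmic in the
  level.\<close>

lemma Phi_tail_le: "1 - Phi t \<le> exp (1 / 2 - t)"
proof -
  interpret N1: prob_space "density lborel (normal_density 1 1)"
    by (rule prob_space_normal_density) simp
  have "ennreal (1 - Phi t) = emeasure std_normal {t<..}"
    unfolding std_normal.emeasure_eq_measure Phi_cdf cdf_def
    using std_normal.prob_compl[of "{..t}"] by (simp add: Compl_atMost[symmetric] Compl_eq_Diff_UNIV)
  also have "\<dots> = (\<integral>\<^sup>+u. ennreal (std_normal_density u) * indicator {t<..} u \<partial>lborel)"
    unfolding std_normal_def by (subst emeasure_density) auto
  also have "\<dots> \<le> (\<integral>\<^sup>+u. ennreal (exp (1 / 2 - t)) * (ennreal (normal_density 1 1 u) * indicator UNIV u) \<partial>lborel)"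
  proof (rule nn_integral_mono)
    fix u :: real
    have "std_normal_density u \<le> exp (1 / 2 - t) * normal_density 1 1 u" if "t < u"
    proof -
      have "exp (- u\<^sup>2 / 2) = exp (1 / 2 - u) * exp (- (u - 1)\<^sup>2 / 2)"
        by (simp add: power2_eq_square field_simps flip: exp_add)
      also have "\<dots> \<le> exp (1 / 2 - t) * exp (- (u - 1)\<^sup>2 / 2)"
        using that by (intro mult_right_mono) auto
      finally show ?thesis
        by (simp add: normal_density_def divide_right_mono)
    qed
    then show "ennreal (std_normal_density u) * indicator {t<..} u \<le> ennreal (exp (1 / 2 - t)) * (ennreal (normal_density 1 1 u) * indicator UNIV u)"
      by (auto simp: indicator_def simp flip: ennreal_mult intro!: ennreal_leI)
  qed
  also have "\<dots> = ennreal (exp (1 / 2 - t)) * emeasure (density lborel (normal_density 1 1)) UNIV"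
    by (subst emeasure_density) (auto intro!: nn_integral_cmult)
  also have "emeasure (density lborel (normal_density 1 1)) UNIV = 1"
    using N1.emeasure_space_1 by simp
  finally show ?thesis by simp
qed

text \<open>Shows that the definite description in \<open>Phi_inv\<close> denotes: existence by the
  intermediate value theorem, uniqueness by strict monotonicity.\<close>

lemma Phi_Phi_inv:
  assumes "0 < q" "q < 1"
  shows "Phi (Phi_inv q) = q"
proof -
  have "\<forall>\<^sub>F x in at_bot. Phi x < q"
    using std_normal.cdf_lim_at_bot assms(1) unfolding Phi_cdf by (rule order_tendstoD)
  then obtain x where x: "Phi x < q" using eventually_happens'[OF trivial_limit_at_bot_linorder] by blast
  have "\<forall>\<^sub>F x in at_top. q < Phi x"
    using std_normal.cdf_lim_at_top_prob assms(2) unfolding Phi_cdf by (rule order_tendstoD)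
  then obtain y where y: "q < Phi y" using eventually_happens'[OF trivial_limit_at_top_linorder] by blast
  have "x \<le> y" using x y strict_mono_less[OF strict_mono_Phi, of x y] by linarith
  then obtain t where "Phi t = q" using IVT'[of Phi x q y] x y continuous_Phi
    by (meson continuous_at_imp_continuous_on less_imp_le)
  moreover have "t' = t" if "Phi t' = q" for t'
    using that \<open>Phi t = q\<close> strict_mono_eq[OF strict_mono_Phi] by metis
  ultimately show ?thesis unfolding Phi_inv_def by (rule theI)
qed

text \<open>\<open>Phi_tail_le\<close> bounds the critical value from above. Conversely
  \<open>Phi_tail_ge\<close> bounds a Gaussian exponential at the critical value by a multiple of
  the nominal level; used at 0, it also makes \<open>t\<close> positive for small
  \<open>p\<close>.\<close>

lemma Phi_inv_bounds:
  assumes p: "0 < p" "p < 2 * std_normal_density 1" "p < 1"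
  defines "t \<equiv> Phi_inv (1 - p / 2)"
  shows "0 < t" "t \<le> 1 / 2 + ln (2 / p)"
    and "0 < \<eta> \<Longrightarrow> exp (- (1 + \<eta>) * t\<^sup>2 / 2) \<le> sqrt (2 * pi) / 2 * exp ((1 + 1 / \<eta>) / 2) * p"
proof -
  have t: "Phi t = 1 - p / 2" unfolding t_def using p by (intro Phi_Phi_inv) auto
  have "Phi 0 < Phi t" using Phi_tail_ge[of 0] p t by simp
  then show t0: "0 < t" by (simp add: strict_mono_less[OF strict_mono_Phi])
  have "p / 2 \<le> exp (1 / 2 - t)" using Phi_tail_le[of t] t by simp
  then have "ln (p / 2) \<le> ln (exp (1 / 2 - t))" using p by (intro ln_mono) auto
  then have "ln (p / 2) \<le> 1 / 2 - t" by simp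
  moreover have "ln (p / 2) = - ln (2 / p)" using p by (simp add: ln_div)
  ultimately show "t \<le> 1 / 2 + ln (2 / p)" by simp
  show "exp (- (1 + \<eta>) * t\<^sup>2 / 2) \<le> sqrt (2 * pi) / 2 * exp ((1 + 1 / \<eta>) / 2) * p" if eta: "0 < \<eta>"
  proof -
    \<comment> \<open>Young's inequality \<open>2 * t \<le> \<eta> * t\<^sup>2 + 1 / \<eta>\<close>
      absorbs the cross term of \<open>(t + 1)\<^sup>2\<close>.\<close>
    have "0 \<le> (\<eta> * t - 1)\<^sup>2 / \<eta>" using eta by simp
    also have "\<dots> = \<eta> * t\<^sup>2 - 2 * t + 1 / \<eta>" using eta by (simp add: power2_eq_square field_simps)
    finally have "(t + 1)\<^sup>2 \<le> (1 + \<eta>) * t\<^sup>2 + (1 + 1 / \<eta>)" by (simp add: power2_eq_square algebra_simps)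
    moreover have "- b / 2 \<le> c / 2 + - a / 2" if "a \<le> b + c" for a b c :: real
      using that by (simp add: field_simps)
    ultimately have "- (1 + \<eta>) * t\<^sup>2 / 2 \<le> (1 + 1 / \<eta>) / 2 + - (t + 1)\<^sup>2 / 2"
      unfolding mult_minus_left by blast
    then have "exp (- (1 + \<eta>) * t\<^sup>2 / 2) \<le> exp ((1 + 1 / \<eta>) / 2) * exp (- (t + 1)\<^sup>2 / 2)"
      unfolding exp_add[symmetric] by simp
    also have "exp (- (t + 1)\<^sup>2 / 2) = sqrt (2 * pi) * std_normal_density (t + 1)"
      by (simp add: std_normal_density_eq)
    also have "\<dots> \<le> sqrt (2 * pi) * (p / 2)"
      using Phi_tail_ge[of t] t t0 by (intro mult_left_mono) auto
    finally show ?thesis by (simp add: mult_ac)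
  qed
qed

section \<open>Error probability of the procedure at a fixed sample size\<close>

context regular_factorial_design
begin

text \<open>One event concerns the variance estimator, the others the deviation of each candidate
  effect. A stage with \<open>c\<close> candidates costs \<open>c * (\<beta> / c)\<close>, so the
  stages together cost at most \<open>D * \<beta>\<close>. The level condition covers every possible
  candidate count \<open>c\<close>.\<close>

lemma screening_error:
  fixes \<epsilon> T \<beta> :: real and \<alpha> :: "nat \<Rightarrow> real"
  assumes heredity: "\<And>\<K>. \<K> \<subseteq> {1..K} \<Longrightarrow> 2 \<le> card \<K> \<Longrightarrow> tau K N Y \<K> \<noteq> 0 \<Longrightarrow>
      (case h of Weak \<Rightarrow> (\<exists>\<K>'\<in>parents \<K>. tau K N Y \<K>' \<noteq> 0) | Strong \<Rightarrow> (\<forall>\<K>'\<in>parents \<K>. tau K N Y \<K>' \<noteq> 0))"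
    and eps: "0 < \<epsilon>" "\<epsilon> < 1"
    and level: "\<And>d c. d \<in> {1..D} \<Longrightarrow> 1 \<le> c \<Longrightarrow> c \<le> N \<Longrightarrow>
      0 < Phi_inv (1 - min (\<alpha> d / real c) 1 / 2) \<and> Phi_inv (1 - min (\<alpha> d / real c) 1 / 2) \<le> T \<and>
      2 * exp (- ((1 - \<epsilon>) * (Phi_inv (1 - min (\<alpha> d / real c) 1 / 2))\<^sup>2 / 2) + 1) \<le> \<beta> / c"
    and beta: "0 \<le> \<beta>"
    and T1: "8 * (\<kappa> * T / sqrt N) \<le> 1"
    and T2: "24 * N * (2 * (\<kappa> * T / sqrt N))^3 + 3 * (2 * (\<kappa> * T / sqrt N))\<^sup>2 \<le> 1"
    and signal: "\<And>\<K>. \<K> \<in> Mstar_upto K N Y D \<Longrightarrow>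
      T * (sqrt (2 * \<Delta>\<^sup>2 * \<rho> / N) + sqrt (4 * M\<^sup>2 * \<Delta>\<^sup>2 * \<rho> / N)) \<le> \<bar>tau K N Y \<K>\<bar>"
  shows "1 - (384 * \<kappa> ^ 4 / (\<epsilon>\<^sup>2 * N) + D * \<beta>) \<le>
    measure_pmf.prob (CRE K N Nz) {Z. screen h K N Nz Y \<alpha> Z D - {{}} = Mstar_upto K N Y D}"
proof -
  let ?P = "measure_pmf.prob (CRE K N Nz)"
  \<comment> \<open>These candidate sets follow the true effects and not the data, so the union
    bound runs over fixed sets although the procedure itself is adaptive.\<close>
  define C where "C d = candidates h K d (insert {} (Mstar_upto K N Y (d - 1)))" for d
  define t where "t d = Phi_inv (1 - min (\<alpha> d / real (card (C d))) 1 / 2)" for d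
  \<comment> \<open>The deviation threshold \<open>r * t d * sqrt sig2\<close> is the critical value
    times the square root of \<open>(1 - \<epsilon>) * sig2\<close>, the level above which the
    variance estimator stays outside \<open>B0\<close>.\<close>
  define r where "r = sqrt (1 - \<epsilon>)"
  define B0 where "B0 = {Z. sigma_hat_sq K N Nz Y Z {} \<le> (1 - \<epsilon>) * sig2}"
  define B where "B d \<K> = {Z. r * t d * sqrt sig2 \<le> \<bar>tau_hat K N Nz Y Z \<K> - tau K N Y \<K>\<bar>}" for d \<K>
  define Bad where "Bad = B0 \<union> (\<Union>d\<in>{1..D}. \<Union>\<K>\<in>C d. B d \<K>)"
  have r: "0 < r" "r \<le> 1" "r\<^sup>2 = 1 - \<epsilon>" using eps by (auto simp: r_def)
  have C_sub: "C d \<subseteq> Pow {1..K}" for d by (auto simp: C_def candidates_def)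
  then have C_fin: "finite (C d)" for d by (rule finite_subset) simp
  have C_le: "card (C d) \<le> N" for d
  proof -
    have "card (C d) \<le> card (Pow {1..K})" using C_sub by (intro card_mono) auto
    also have "\<dots> = 2 ^ K" by (simp add: card_Pow)
    finally show ?thesis using two_power_le by simp
  qed
  have C_elem: "finite \<K>" if "\<K> \<in> C d" for \<K> d
    using that C_sub finite_subset[of \<K> "{1..K}"] by auto
  have C_ge1: "1 \<le> card (C d)" if "\<K> \<in> C d" for \<K> d
    using that C_fin card_gt_0_iff[of "C d"] by (metis One_nat_def Suc_leI empty_iff)
  have lev: "0 < t d" "t d \<le> T" "2 * exp (- ((1 - \<epsilon>) * (t d)\<^sup>2 / 2) + 1) \<le> \<beta> / card (C d)"
    if "d \<in> {1..D}" "\<K> \<in> C d" for d \<K>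
    using level[OF that(1) C_ge1[OF that(2)] C_le] unfolding t_def by auto

  have PB: "?P (B d \<K>) \<le> \<beta> / card (C d)" if d: "d \<in> {1..D}" and \<K>: "\<K> \<in> C d" for d \<K>
  proof -
    note l = lev[OF d \<K>]
    have u: "\<kappa> * t d / sqrt N \<le> \<kappa> * T / sqrt N" "0 \<le> \<kappa> * t d / sqrt N"
      using l kappa_nonneg by (auto intro!: divide_right_mono mult_left_mono)
    have "?P (B d \<K>) \<le> 2 * exp (- (r\<^sup>2 * (t d)\<^sup>2 / 2) + 24 * N * (2 * (\<kappa> * t d / sqrt N))^3 + 3 * (2 * (\<kappa> * t d / sqrt N))\<^sup>2)"
      unfolding B_def using effect_tail[OF C_elem[OF \<K>] l(1) r(1,2)] u T1 by simp
    also have "\<dots> \<le> 2 * exp (- (r\<^sup>2 * (t d)\<^sup>2 / 2) + 1)"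
    proof -
      have "24 * N * (2 * (\<kappa> * t d / sqrt N))^3 + 3 * (2 * (\<kappa> * t d / sqrt N))\<^sup>2
        \<le> 24 * N * (2 * (\<kappa> * T / sqrt N))^3 + 3 * (2 * (\<kappa> * T / sqrt N))\<^sup>2"
        using u by (intro add_mono mult_left_mono power_mono) auto
      then show ?thesis using T2 by simp
    qed
    also have "\<dots> \<le> \<beta> / card (C d)" using l(3) by (simp add: r(3))
    finally show ?thesis .
  qed
  have "?P Bad \<le> ?P B0 + ?P (\<Union>d\<in>{1..D}. \<Union>\<K>\<in>C d. B d \<K>)"
    unfolding Bad_def by (rule measure_Un_le) auto
  also have "?P B0 \<le> 384 * \<kappa> ^ 4 / (\<epsilon>\<^sup>2 * N)"
    unfolding B0_def using eps by (intro variance_estimator_lower_tail) auto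
  also have "?P (\<Union>d\<in>{1..D}. \<Union>\<K>\<in>C d. B d \<K>) \<le> (\<Sum>d\<in>{1..D}. ?P (\<Union>\<K>\<in>C d. B d \<K>))"
    by (rule measure_UNION_le) auto
  also have "\<dots> \<le> (\<Sum>d\<in>{1..D}. \<beta>)"
  proof (rule sum_mono)
    fix d assume d: "d \<in> {1..D}"
    have "?P (\<Union>\<K>\<in>C d. B d \<K>) \<le> (\<Sum>\<K>\<in>C d. ?P (B d \<K>))"
      by (rule measure_UNION_le) (auto simp: C_fin)
    also have "\<dots> \<le> (\<Sum>\<K>\<in>C d. \<beta> / card (C d))" by (intro sum_mono PB d)
    also have "\<dots> \<le> \<beta>" using beta by simp
    finally show "?P (\<Union>\<K>\<in>C d. B d \<K>) \<le> \<beta>" .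
  qed
  finally have bad: "?P Bad \<le> 384 * \<kappa> ^ 4 / (\<epsilon>\<^sup>2 * N) + D * \<beta>" by simp

  have good: "screen h K N Nz Y \<alpha> Z D - {{}} = Mstar_upto K N Y D" if Z: "Z \<in> Om" "Z \<notin> Bad" for Z
  proof -
    define sh where "sh = sigma_hat_sq K N Nz Y Z {}"
    have sh: "(1 - \<epsilon>) * sig2 < sh" using Z(2) by (auto simp: Bad_def B0_def sh_def)
    moreover have "0 < (1 - \<epsilon>) * sig2" using eps sig2_pos by simp
    ultimately have sh0: "0 < sh" by linarith
    have "screen h K N Nz Y \<alpha> Z D = insert {} (Mstar_upto K N Y D)"
    proof (rule screen_eq[OF heredity])
      fix d \<K> assume d: "1 \<le> d" "d \<le> D" and "\<K> \<in> candidates h K d (insert {} (Mstar_upto K N Y (d - 1)))"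
      then have \<K>: "\<K> \<in> C d" by (simp add: C_def)
      have d': "d \<in> {1..D}" using d by simp
      note l = lev[OF d' \<K>]
      have sK: "sigma_hat_sq K N Nz Y Z \<K> = sh"
        unfolding sh_def by (rule sigma_hat_sq_indep[OF Z(1) C_elem[OF \<K>]])
      have dev: "\<bar>tau_hat K N Nz Y Z \<K> - tau K N Y \<K>\<bar> < r * t d * sqrt sig2"
        using Z(2) d' \<K> by (force simp: Bad_def B_def)
      have "t d \<le> \<bar>tau_hat K N Nz Y Z \<K> / sqrt sh\<bar> \<longleftrightarrow> tau K N Y \<K> \<noteq> 0"
      proof (cases "tau K N Y \<K> = 0")
        case True
        have "\<bar>tau_hat K N Nz Y Z \<K>\<bar> < t d * sqrt ((1 - \<epsilon>) * sig2)"
          using dev True by (simp add: r_def real_sqrt_mult mult_ac)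
        also have "\<dots> \<le> t d * sqrt sh" using l(1) sh by (intro mult_left_mono) auto
        finally show ?thesis using True sh0 by (simp add: pos_le_divide_eq)
      next
        case False
        have "\<K> \<in> Mstar_upto K N Y D"
          using False \<K> d' by (auto simp: C_def candidates_def Mstar_upto_def Mstar_def)
        note sig = signal[OF this]
        \<comment> \<open>A nonzero effect must exceed the deviation plus the rejection threshold
          \<open>t d * sqrt sh\<close>; the two summands in the signal condition bound exactly
          these.\<close>
        have "r * t d * sqrt sig2 + t d * sqrt sh \<le> T * sqrt (2 * \<Delta>\<^sup>2 * \<rho> / N) + T * sqrt (4 * M\<^sup>2 * \<Delta>\<^sup>2 * \<rho> / N)"
        proof (rule add_mono)
          have "r * t d \<le> 1 * T" using r l by (intro mult_mono) auto
          then show "r * t d * sqrt sig2 \<le> T * sqrt (2 * \<Delta>\<^sup>2 * \<rho> / N)"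
            using sig2_le l sig2_pos by (intro mult_mono) auto
          show "t d * sqrt sh \<le> T * sqrt (4 * M\<^sup>2 * \<Delta>\<^sup>2 * \<rho> / N)"
            using sigma_hat_sq_le[OF Z(1), of "{}"] l sh0 unfolding sh_def[symmetric] by (intro mult_mono) auto
        qed
        then have "r * t d * sqrt sig2 + t d * sqrt sh \<le> \<bar>tau K N Y \<K>\<bar>"
          using sig by (simp only: distrib_left)
        then have "t d * sqrt sh \<le> \<bar>tau_hat K N Nz Y Z \<K>\<bar>" using dev by linarith
        then show ?thesis using False sh0 by (simp add: pos_le_divide_eq)
      qed
      then show "Phi_inv (1 - min (\<alpha> d / real (card (candidates h K d (insert {} (Mstar_upto K N Y (d - 1)))))) 1 / 2)
        \<le> \<bar>tau_hat K N Nz Y Z \<K> / sqrt (sigma_hat_sq K N Nz Y Z \<K>)\<bar> \<longleftrightarrow> tau K N Y \<K> \<noteq> 0"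
        unfolding sK t_def C_def .
    qed auto
    then show ?thesis using empty_notin_Mstar_upto by auto
  qed

  have "1 - ?P Bad = ?P (- Bad)"
    using measure_pmf.prob_compl[of Bad "CRE K N Nz"] by (simp add: Compl_eq_Diff_UNIV)
  also have "\<dots> = ?P (- Bad \<inter> set_pmf (CRE K N Nz))" by (rule measure_Int_set_pmf[symmetric])
  also have "\<dots> \<le> ?P {Z. screen h K N Nz Y \<alpha> Z D - {{}} = Mstar_upto K N Y D}"
    unfolding set_pmf_CRE using good by (intro measure_pmf.finite_measure_mono) auto
  finally show ?thesis using bad by linarith
qed

end

section \<open>Asymptotics\<close>

text \<open>Passes from the level \<open>a / c\<close> to bounds uniform in the candidate count. The
  choice of \<open>\<eta>\<close> gives \<open>1 + \<eta> = 1 / s\<close>, so the power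
  \<open>s\<^sup>2\<close> of the Gaussian exponential in \<open>Phi_inv_bounds\<close> has exponent
  \<open>- s * t\<^sup>2 / 2\<close>.\<close>

lemma threshold_bounds:
  fixes b1 b2 \<delta>' s n :: real and c :: nat
  defines "\<eta> \<equiv> 1 / s - 1"
  defines "C \<equiv> sqrt (2 * pi) / 2 * exp ((1 + 1 / \<eta>) / 2)"
  assumes s: "0 < s" "s < 1" and b: "0 < b1" "b1 * n powr (- \<delta>') \<le> a" "a \<le> b2 * n powr (- \<delta>')"
    and small: "b2 * n powr (- \<delta>') < 2 * std_normal_density 1" "b2 * n powr (- \<delta>') < 1"
    and c: "1 \<le> c" "c \<le> n" and n: "0 < n"
  defines "t \<equiv> Phi_inv (1 - min (a / real c) 1 / 2)"
  shows "0 < t" "t \<le> 1 / 2 + ln (2 * n powr (1 + \<delta>') / b1)"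
    and "2 * exp (- (s * t\<^sup>2 / 2) + 1) \<le> 2 * exp 1 * (C * b2 * n powr (- \<delta>')) powr (s\<^sup>2) * n powr (1 - s\<^sup>2) / c"
proof -
  define p where "p = a / real c"
  have a0: "0 < a" proof -
    have "0 < b1 * n powr (- \<delta>')" using b n by simp
    then show ?thesis using b by linarith
  qed
  have cpos: "0 < real c" using c by simp
  have p0: "0 < p" using a0 cpos by (simp add: p_def)
  have "p \<le> a" using a0 c by (simp add: p_def divide_le_eq mult_le_cancel_left1)
  then have p: "0 < p" "p < 2 * std_normal_density 1" "p < 1" using p0 b small by auto
  have t_eq: "t = Phi_inv (1 - p / 2)" using p by (simp add: t_def p_def)
  note bounds = Phi_inv_bounds[OF p, folded t_eq]
  show "0 < t" by (rule bounds)
  have eta: "0 < \<eta>" using s by (simp add: \<eta>_def)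
  have C: "0 < C" by (simp add: C_def)
  have "2 / p \<le> 2 * n powr (1 + \<delta>') / b1"
  proof -
    have "b1 * n powr (- \<delta>') / n \<le> p"
      unfolding p_def using b c cpos a0 n by (intro frac_le) auto
    moreover have "b1 * n powr (- \<delta>') / n = b1 / n powr (1 + \<delta>')"
      using n by (simp add: powr_minus powr_add field_simps)
    ultimately have "b1 / n powr (1 + \<delta>') \<le> p" by simp
    then show ?thesis using b n p by (simp add: field_simps)
  qed
  then have "ln (2 / p) \<le> ln (2 * n powr (1 + \<delta>') / b1)" using p by (intro ln_mono) auto
  then show "t \<le> 1 / 2 + ln (2 * n powr (1 + \<delta>') / b1)" using bounds(2) by linarith
  have "exp (- (s * t\<^sup>2 / 2)) = exp (- (1 + \<eta>) * t\<^sup>2 / 2) powr (s\<^sup>2)"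
    using s by (simp add: powr_def \<eta>_def power2_eq_square)
  also have "\<dots> \<le> (C * p) powr (s\<^sup>2)"
    using bounds(3)[OF eta] unfolding C_def by (intro powr_mono2) auto
  \<comment> \<open>The power \<open>s\<^sup>2\<close> is below 1, so one factor
    \<open>1 / c\<close> is split off for the union bound; the surplus
    \<open>c powr (1 - s\<^sup>2)\<close> is then replaced by its value at \<open>n\<close>.\<close>
  also have "\<dots> = (C * a) powr (s\<^sup>2) * (real c powr (1 - s\<^sup>2) / c)"
    using C a0 cpos by (simp add: p_def powr_divide powr_diff)
  also have "\<dots> \<le> (C * b2 * n powr (- \<delta>')) powr (s\<^sup>2) * (n powr (1 - s\<^sup>2) / c)"
  proof (rule mult_mono)
    have "C * a \<le> C * (b2 * n powr (- \<delta>'))" using C b by (intro mult_left_mono) auto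
    then show "(C * a) powr (s\<^sup>2) \<le> (C * b2 * n powr (- \<delta>')) powr (s\<^sup>2)"
      using C a0 by (intro powr_mono2) (auto simp: mult_ac)
    have "0 \<le> 1 - s\<^sup>2" using s by (simp add: power_le_one)
    then show "real c powr (1 - s\<^sup>2) / c \<le> n powr (1 - s\<^sup>2) / c"
      using c by (intro divide_right_mono powr_mono2) auto
  qed auto
  finally have "2 * exp 1 * exp (- (s * t\<^sup>2 / 2)) \<le> 2 * exp 1 * ((C * b2 * n powr (- \<delta>')) powr (s\<^sup>2) * (n powr (1 - s\<^sup>2) / c))"
    by (intro mult_left_mono) auto
  then show "2 * exp (- (s * t\<^sup>2 / 2) + 1) \<le> 2 * exp 1 * (C * b2 * n powr (- \<delta>')) powr (s\<^sup>2) * n powr (1 - s\<^sup>2) / c"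
    unfolding exp_add by (simp add: mult_ac)
qed

text \<open>\<open>T\<close> grows logarithmically. The cubic limit controls the Chernoff error, the
  second the admissible tilt, and the third puts the test threshold below signals of order
  \<open>n powr \<delta>\<close>, since \<open>\<delta>\<close> exceeds \<open>-1/2\<close>.\<close>

lemma log_growth_limits:
  fixes b1 \<delta> \<delta>' :: real
  assumes "0 < b1" "0 < \<delta>'" "-1/2 < \<delta>"
  defines "T \<equiv> \<lambda>n. 1 / 2 + ln (2 * n powr (1 + \<delta>') / b1)"
  shows "((\<lambda>n. T n ^ 3 / sqrt n) \<longlongrightarrow> 0) at_top" "((\<lambda>n. T n / sqrt n) \<longlongrightarrow> 0) at_top"
    and "((\<lambda>n. T n * n powr (- 1/2 - \<delta>)) \<longlongrightarrow> 0) at_top"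
proof -
  define A where "A = 1 / 2 + ln 2 - ln b1"
  have T: "T n = A + (1 + \<delta>') * ln n" if "0 < n" for n
    using that assms by (simp add: T_def A_def ln_div ln_mult ln_powr)
  have ev: "\<forall>\<^sub>F n in at_top. T n = A + (1 + \<delta>') * ln n"
    using eventually_gt_at_top[of 0] by eventually_elim (rule T)
  have "((\<lambda>n. (A + (1 + \<delta>') * ln n) ^ 3 / sqrt n) \<longlongrightarrow> 0) at_top"
    using assms by real_asymp
  then show "((\<lambda>n. T n ^ 3 / sqrt n) \<longlongrightarrow> 0) at_top"
    by (rule Lim_transform_eventually) (use ev in \<open>auto elim: eventually_mono\<close>)
  have "((\<lambda>n. (A + (1 + \<delta>') * ln n) / sqrt n) \<longlongrightarrow> 0) at_top"
    using assms by real_asymp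
  then show "((\<lambda>n. T n / sqrt n) \<longlongrightarrow> 0) at_top"
    by (rule Lim_transform_eventually) (use ev in \<open>auto elim: eventually_mono\<close>)
  define e where "e = 1/2 + \<delta>"
  have e: "0 < e" "- 1/2 - \<delta> = - e" using assms by (auto simp: e_def)
  have "((\<lambda>n. (A + (1 + \<delta>') * ln n) * n powr (- e)) \<longlongrightarrow> 0) at_top"
    using assms e by real_asymp
  then show "((\<lambda>n. T n * n powr (- 1/2 - \<delta>)) \<longlongrightarrow> 0) at_top"
    unfolding e by (rule Lim_transform_eventually) (use ev in \<open>auto elim: eventually_mono\<close>)
qed

text \<open>The powers of \<open>n\<close> combine to \<open>1 - w * (1 + \<delta>')\<close>, which
  is negative and beats the logarithmic number of stages.\<close>

lemma type_one_limit:
  fixes A w \<delta>' c :: real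
  assumes "0 < w" "w < 1" "1 < w * (1 + \<delta>')" "0 < A"
  shows "((\<lambda>n. c / n + ln n / ln 2 * (2 * exp 1 * (A * n powr (- \<delta>')) powr w * n powr (1 - w))) \<longlongrightarrow> 0) at_top"
proof -
  define e where "e = w * (1 + \<delta>') - 1"
  have e: "0 < e" using assms by (simp add: e_def)
  define B where "B = 2 * exp 1 * A powr w / ln 2"
  have "0 < B" using assms by (simp add: B_def)
  then have "((\<lambda>n. B * (ln n * n powr (- e))) \<longlongrightarrow> 0) at_top"
    using e by real_asymp
  moreover have "((\<lambda>n. c / n) \<longlongrightarrow> 0) at_top" by real_asymp
  ultimately have "((\<lambda>n. c / n + B * (ln n * n powr (- e))) \<longlongrightarrow> 0) at_top"
    by (intro tendsto_add_zero)
  then show ?thesis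
  proof (rule Lim_transform_eventually)
    show "\<forall>\<^sub>F n in at_top. c / n + B * (ln n * n powr (- e)) =
        c / n + ln n / ln 2 * (2 * exp 1 * (A * n powr (- \<delta>')) powr w * n powr (1 - w))"
      using eventually_gt_at_top[of 0]
    proof eventually_elim
      case (elim n)
      have "(A * n powr (- \<delta>')) powr w * n powr (1 - w) = A powr w * n powr (- e)"
        using elim assms by (simp add: powr_mult powr_powr e_def algebra_simps flip: powr_add)
      then show ?case by (simp add: B_def mult.assoc)
    qed
  qed
qed

theorem theorem1:
  fixes h :: heredity
    and K D Nn :: "nat \<Rightarrow> nat"
    and Nz :: "nat \<Rightarrow> nat set \<Rightarrow> nat"
    and Y :: "nat \<Rightarrow> nat \<Rightarrow> nat set \<Rightarrow> real"
    and \<alpha> :: "nat \<Rightarrow> nat \<Rightarrow> real"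
    and \<delta> \<delta>' \<delta>'' c_lo c_hi \<sigma> \<Delta> M :: real
  assumes K_ge2: "\<forall>m. 2 \<le> K m"
    and D_le_K: "\<forall>m. D m \<le> K m"
    and N_to_inf: "filterlim Nn at_top sequentially"
    and design: "\<forall>m. (\<Sum>z\<in>levels (K m). Nz m z) = Nn m \<and> (\<forall>z\<in>levels (K m). 2 \<le> Nz m z)"
    \<comment> \<open>(C1) nearly uniform design\<close>
    and C1: "0 < c_lo" "c_lo \<le> c_hi"
      "\<forall>m. \<exists>N0::nat. 0 < N0 \<and>
          (\<forall>z\<in>levels (K m). \<exists>c. c_lo \<le> c \<and> c \<le> c_hi \<and> real (Nz m z) = c * real N0)"
    \<comment> \<open>(C2) order of parameters\<close>
    and C2_i: "-1/2 < \<delta>" "\<delta> \<le> 0"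
      "\<exists>a1 a2. 0 < a1 \<and> 0 < a2 \<and> (\<forall>\<^sub>F m in sequentially.
          \<forall>\<K>\<in>Mstar_upto (K m) (Nn m) (Y m) (D m).
             a1 * real (Nn m) powr \<delta> \<le> \<bar>tau (K m) (Nn m) (Y m) \<K>\<bar> \<and>
             \<bar>tau (K m) (Nn m) (Y m) \<K>\<bar> \<le> a2 * real (Nn m) powr \<delta>)"
    and C2_ii: "0 < \<delta>'"
      "\<exists>b1 b2. 0 < b1 \<and> 0 < b2 \<and> (\<forall>\<^sub>F m in sequentially.
          \<forall>d\<in>{1..D m}. b1 * real (Nn m) powr (-\<delta>') \<le> \<alpha> m d \<and> \<alpha> m d \<le> b2 * real (Nn m) powr (-\<delta>'))"
    and C2_iii: "0 \<le> \<delta>''" "\<delta>'' < 1/3"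
      "\<exists>e1 e2. 0 < e1 \<and> 0 < e2 \<and> (\<forall>\<^sub>F m in sequentially.
          e1 * real (Nn m) powr \<delta>'' \<le> (\<Sum>d\<in>{1..D m}. real (card (Mstar (K m) (Nn m) (Y m) d))) \<and>
          (\<Sum>d\<in>{1..D m}. real (card (Mstar (K m) (Nn m) (Y m) d))) \<le> e2 * real (Nn m) powr \<delta>'')"
    \<comment> \<open>(C3) regularity conditions\<close>
    and C3_i: "0 < \<sigma>"
      "\<forall>m. (\<forall>z\<in>levels (K m). 0 < cov_Yhat (K m) (Nn m) (Nz m) (Y m) z z) \<and>
           (\<forall>l\<in>eigenvalues_on (levels (K m)) (corr_Yhat (K m) (Nn m) (Nz m) (Y m)). 0 < l) \<and>
           condition_number (levels (K m)) (corr_Yhat (K m) (Nn m) (Nz m) (Y m)) \<le> \<sigma>^2"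
    and C3_ii: "\<forall>m. \<forall>z\<in>levels (K m).
          (\<Sum>i<Nn m. (Y m i z - Ybar (Nn m) (Y m) z) ^ 4) / real (Nn m) \<le> \<Delta> ^ 4"
    and C3_iii: "\<forall>m. \<forall>i<Nn m. \<forall>z\<in>levels (K m).
          \<bar>Y m i z - Ybar (Nn m) (Y m) z\<bar> /
            sqrt (Min ((\<lambda>w. Spop (Nn m) (Y m) w w) ` levels (K m))) \<le> M"
    \<comment> \<open>(C4) heredity, of the same type h as used by the procedure\<close>
    and C4: "\<forall>m. \<forall>\<K>. \<K> \<subseteq> {1..K m} \<and> 2 \<le> card \<K> \<and> tau (K m) (Nn m) (Y m) \<K> \<noteq> 0 \<longrightarrow>
          (case h of
             Weak \<Rightarrow> (\<exists>\<K>'\<in>parents \<K>. tau (K m) (Nn m) (Y m) \<K>' \<noteq> 0)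
           | Strong \<Rightarrow> (\<forall>\<K>'\<in>parents \<K>. tau (K m) (Nn m) (Y m) \<K>' \<noteq> 0))"
  shows "(\<lambda>m. measure_pmf.prob (CRE (K m) (Nn m) (Nz m))
            {Z. screen h (K m) (Nn m) (Nz m) (Y m) (\<alpha> m) Z (D m) - {{}} =
                Mstar_upto (K m) (Nn m) (Y m) (D m)}) \<longlonglongrightarrow> 1"
proof -
  let ?n = "\<lambda>m. real (Nn m)"
  obtain a1 a2 where a1: "0 < a1" and order: "\<forall>\<^sub>F m in sequentially.
      \<forall>\<K>\<in>Mstar_upto (K m) (Nn m) (Y m) (D m).
         a1 * ?n m powr \<delta> \<le> \<bar>tau (K m) (Nn m) (Y m) \<K>\<bar> \<and> \<bar>tau (K m) (Nn m) (Y m) \<K>\<bar> \<le> a2 * ?n m powr \<delta>"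
    using C2_i(3) by blast
  have signal: "\<forall>\<^sub>F m in sequentially.
      \<forall>\<K>\<in>Mstar_upto (K m) (Nn m) (Y m) (D m). a1 * ?n m powr \<delta> \<le> \<bar>tau (K m) (Nn m) (Y m) \<K>\<bar>"
    using order by (rule eventually_mono) auto
  obtain b1 b2 where b: "0 < b1" "0 < b2" and level: "\<forall>\<^sub>F m in sequentially. \<forall>d\<in>{1..D m}.
      b1 * ?n m powr (-\<delta>') \<le> \<alpha> m d \<and> \<alpha> m d \<le> b2 * ?n m powr (-\<delta>')"
    using C2_ii(2) by auto
  have N_inf: "filterlim ?n at_top sequentially"
    using N_to_inf filterlim_compose[OF filterlim_real_sequentially] by auto

  \<comment> \<open>\<open>w\<close> must lie strictly between \<open>1 / (1 + \<delta>')\<close>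
    and 1 for \<open>type_one_limit\<close>. The exponent loss \<open>s\<close> is its square root,
    because \<open>threshold_bounds\<close> produces the power \<open>s\<^sup>2\<close>.\<close>
  define w where "w = (1 + \<delta>' / 2) / (1 + \<delta>')"
  define s where "s = sqrt w"
  define \<epsilon> where "\<epsilon> = 1 - s"
  have w: "0 < w" "w < 1" "1 < w * (1 + \<delta>')" using C2_ii(1) by (auto simp: w_def)
  have s: "0 < s" "s < 1" "s\<^sup>2 = w" using w by (auto simp: s_def)
  have eps: "0 < \<epsilon>" "\<epsilon> < 1" "1 - \<epsilon> = s" using s by (auto simp: \<epsilon>_def)

  define C where "C = sqrt (2 * pi) / 2 * exp ((1 + 1 / (1 / s - 1)) / 2)"
  define rh where "rh = c_hi / c_lo"
  define ka where "ka = M * rh * sqrt rh"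
  define T where "T n = 1 / 2 + ln (2 * n powr (1 + \<delta>') / b1)" for n
  define \<beta> where "\<beta> n = 2 * exp 1 * (C * b2 * n powr (- \<delta>')) powr w * n powr (1 - w)" for n
  define cs where "cs = sqrt (2 * \<Delta>\<^sup>2 * rh) + sqrt (4 * M\<^sup>2 * \<Delta>\<^sup>2 * rh)"
  define err where "err n = 384 * ka ^ 4 / \<epsilon>\<^sup>2 / n + ln n / ln 2 * \<beta> n" for n
  note T_lim = log_growth_limits[OF b(1) C2_ii(1) C2_i(1), folded T_def]

  have err_lim: "(err \<longlongrightarrow> 0) at_top"
    unfolding err_def \<beta>_def using w b by (intro type_one_limit) (auto simp: C_def)
  have "((\<lambda>n. b2 * n powr (- \<delta>')) \<longlongrightarrow> 0) at_top"
    using C2_ii(1) by real_asymp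
  then have small: "\<forall>\<^sub>F n in at_top. b2 * n powr (- \<delta>') < min 1 (2 * std_normal_density 1)"
    by (rule order_tendstoD) (simp add: normal_density_pos)
  have "((\<lambda>n. 8 * (ka * T n / sqrt n)) \<longlongrightarrow> 0) at_top"
    using tendsto_mult_left[OF T_lim(2), of "8 * ka"] by (simp add: mult.assoc)
  then have T1: "\<forall>\<^sub>F n in at_top. 8 * (ka * T n / sqrt n) < 1"
    by (rule order_tendstoD) simp
  have "((\<lambda>n. 24 * 8 * ka^3 * (T n ^ 3 / sqrt n) + 12 * (ka * (T n / sqrt n))\<^sup>2) \<longlongrightarrow> 24 * 8 * ka^3 * 0 + 12 * (ka * 0)\<^sup>2) at_top"
    by (intro tendsto_intros T_lim)
  then have "\<forall>\<^sub>F n in at_top. 24 * 8 * ka^3 * (T n ^ 3 / sqrt n) + 12 * (ka * (T n / sqrt n))\<^sup>2 < 1"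
    by (rule order_tendstoD) simp
  then have T2: "\<forall>\<^sub>F n in at_top. 24 * n * (2 * (ka * T n / sqrt n))^3 + 3 * (2 * (ka * T n / sqrt n))\<^sup>2 < 1"
    using eventually_gt_at_top[of 0]
  proof eventually_elim
    case (elim n)
    have "sqrt n ^ 3 = n * sqrt n" using elim by (simp add: power3_eq_cube)
    then have cube: "n * (T n / sqrt n) ^ 3 = T n ^ 3 / sqrt n" using elim by (simp add: power_divide)
    have "24 * n * (2 * (ka * q))^3 = 24 * 8 * ka^3 * (n * q ^ 3)" for q
      by (simp add: power_mult_distrib)
    from this[of "T n / sqrt n"] have "24 * n * (2 * (ka * T n / sqrt n))^3 = 24 * 8 * ka^3 * (T n ^ 3 / sqrt n)"
      unfolding cube times_divide_eq_right[of ka] .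
    moreover have "3 * (2 * (ka * T n / sqrt n))\<^sup>2 = 12 * (ka * (T n / sqrt n))\<^sup>2"
      by (simp add: power_mult_distrib power_divide)
    ultimately show ?case using elim by linarith
  qed
  have "((\<lambda>n. cs * (T n * n powr (- 1/2 - \<delta>))) \<longlongrightarrow> cs * 0) at_top"
    by (intro tendsto_intros T_lim)
  then have "\<forall>\<^sub>F n in at_top. cs * (T n * n powr (- 1/2 - \<delta>)) < a1"
    by (rule order_tendstoD) (simp add: a1)
  then have T3: "\<forall>\<^sub>F n in at_top. T n * (cs / sqrt n) < a1 * n powr \<delta>"
    using eventually_gt_at_top[of 0]
  proof eventually_elim
    case (elim n)
    have "cs * (T n * n powr (- 1/2 - \<delta>)) * n powr \<delta> < a1 * n powr \<delta>" using elim by simp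
    also have "cs * (T n * n powr (- 1/2 - \<delta>)) * n powr \<delta> = cs * T n * n powr (- (1/2))"
      by (simp flip: powr_add)
    also have "n powr (- (1/2)) = 1 / sqrt n" using elim by (simp add: powr_minus powr_half_sqrt field_simps)
    finally show ?case by (simp add: mult_ac)
  qed

  let ?p = "\<lambda>m. measure_pmf.prob (CRE (K m) (Nn m) (Nz m))
            {Z. screen h (K m) (Nn m) (Nz m) (Y m) (\<alpha> m) Z (D m) - {{}} = Mstar_upto (K m) (Nn m) (Y m) (D m)}"
  have lower: "1 - err (?n m) \<le> ?p m"
    if signal: "\<forall>\<K>\<in>Mstar_upto (K m) (Nn m) (Y m) (D m). a1 * ?n m powr \<delta> \<le> \<bar>tau (K m) (Nn m) (Y m) \<K>\<bar>"
      and level: "\<forall>d\<in>{1..D m}. b1 * ?n m powr (-\<delta>') \<le> \<alpha> m d \<and> \<alpha> m d \<le> b2 * ?n m powr (-\<delta>')"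
      and small: "b2 * ?n m powr (- \<delta>') < min 1 (2 * std_normal_density 1)"
      and T1: "8 * (ka * T (?n m) / sqrt (?n m)) < 1"
      and T2: "24 * ?n m * (2 * (ka * T (?n m) / sqrt (?n m)))^3 + 3 * (2 * (ka * T (?n m) / sqrt (?n m)))\<^sup>2 < 1"
      and T3: "T (?n m) * (cs / sqrt (?n m)) < a1 * ?n m powr \<delta>" for m
  proof -
    obtain N0 :: nat where N0: "0 < N0" "\<forall>z\<in>levels (K m). \<exists>c. c_lo \<le> c \<and> c \<le> c_hi \<and> real (Nz m z) = c * real N0"
      using C1(3) by blast
    interpret regular_factorial_design "K m" "Nn m" "Nz m" "Y m" c_lo c_hi \<Delta> M "real N0"
    proof
      fix z assume z: "z \<in> levels (K m)"
      then obtain c where c: "c_lo \<le> c" "c \<le> c_hi" "real (Nz m z) = c * real N0" using N0 by blast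
      then show "c_lo * real N0 \<le> real (Nz m z)" "real (Nz m z) \<le> c_hi * real N0"
        by (auto intro: mult_right_mono)
    qed (use design C1 N0 C3_i(2) C3_ii C3_iii in auto)
    have rho: "local.\<rho> = rh" by (simp add: local.\<rho>_def rh_def)
    have kap: "local.\<kappa> = ka" by (simp add: local.\<kappa>_def ka_def rho)
    have n: "0 < ?n m" by (rule N_pos)
    have beta: "0 \<le> \<beta> (?n m)" by (simp add: \<beta>_def)
    have "1 - (384 * local.\<kappa> ^ 4 / (\<epsilon>\<^sup>2 * Nn m) + D m * \<beta> (?n m)) \<le> ?p m"
    proof (rule screening_error[where T = "T (?n m)"])
      fix d c :: nat assume d: "d \<in> {1..D m}" and c: "1 \<le> c" "c \<le> Nn m"
      have c': "real c \<le> ?n m" using c by simp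
      have sm: "b2 * ?n m powr (- \<delta>') < 2 * std_normal_density 1" "b2 * ?n m powr (- \<delta>') < 1"
        using small by auto
      have lv: "b1 * ?n m powr (-\<delta>') \<le> \<alpha> m d" "\<alpha> m d \<le> b2 * ?n m powr (-\<delta>')" using level d by auto
      note th = threshold_bounds[OF s(1,2) b(1) lv sm c(1) c' n]
      show "0 < Phi_inv (1 - min (\<alpha> m d / real c) 1 / 2) \<and> Phi_inv (1 - min (\<alpha> m d / real c) 1 / 2) \<le> T (?n m) \<and>
          2 * exp (- ((1 - \<epsilon>) * (Phi_inv (1 - min (\<alpha> m d / real c) 1 / 2))\<^sup>2 / 2) + 1) \<le> \<beta> (?n m) / c"
        using th unfolding T_def \<beta>_def eps(3) C_def s(3) by blast
    next
      fix \<K> assume "\<K> \<in> Mstar_upto (K m) (Nn m) (Y m) (D m)"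
      then have "a1 * ?n m powr \<delta> \<le> \<bar>tau (K m) (Nn m) (Y m) \<K>\<bar>" using signal by blast
      moreover have cs_eq: "sqrt (2 * \<Delta>\<^sup>2 * rh / ?n m) + sqrt (4 * M\<^sup>2 * \<Delta>\<^sup>2 * rh / ?n m) = cs / sqrt (?n m)"
        by (simp add: cs_def real_sqrt_divide add_divide_distrib)
      ultimately show "T (?n m) * (sqrt (2 * \<Delta>\<^sup>2 * local.\<rho> / ?n m) + sqrt (4 * M\<^sup>2 * \<Delta>\<^sup>2 * local.\<rho> / ?n m))
          \<le> \<bar>tau (K m) (Nn m) (Y m) \<K>\<bar>"
        using T3 unfolding rho cs_eq by linarith
    next
      show "case h of Weak \<Rightarrow> \<exists>\<K>'\<in>parents \<K>. tau (K m) (Nn m) (Y m) \<K>' \<noteq> 0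
          | Strong \<Rightarrow> \<forall>\<K>'\<in>parents \<K>. tau (K m) (Nn m) (Y m) \<K>' \<noteq> 0"
        if "\<K> \<subseteq> {1..K m}" "2 \<le> card \<K>" "tau (K m) (Nn m) (Y m) \<K> \<noteq> 0" for \<K>
        using C4 that by blast
      show "8 * (local.\<kappa> * T (?n m) / sqrt (?n m)) \<le> 1" using T1 unfolding kap by linarith
      show "real (24 * Nn m) * (2 * (local.\<kappa> * T (?n m) / sqrt (?n m)))^3 + 3 * (2 * (local.\<kappa> * T (?n m) / sqrt (?n m)))\<^sup>2 \<le> 1"
        using T2 unfolding kap by simp
    qed (use eps beta in auto)
    moreover have "D m * \<beta> (?n m) \<le> ln (?n m) / ln 2 * \<beta> (?n m)"
    proof (rule mult_right_mono[OF _ beta])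
      \<comment> \<open>The number of stages is at most \<open>K m\<close>, and every one of the
        \<open>2 ^ K m\<close> levels is occupied; hence it is at most the binary logarithm of
        \<open>Nn m\<close>.\<close>
      have "real (2 ^ K m) \<le> ?n m" using two_power_le by (simp only: of_nat_le_iff)
      then have "ln (2 ^ K m) \<le> ln (?n m)" using n by (intro ln_mono) auto
      then have "K m * ln 2 \<le> ln (?n m)" by (simp add: ln_realpow)
      moreover have "D m * ln 2 \<le> K m * ln (2::real)" using D_le_K by (intro mult_right_mono) auto
      ultimately have "D m * ln 2 \<le> ln (?n m)" by linarith
      then show "real (D m) \<le> ln (?n m) / ln 2" by (simp add: pos_le_divide_eq)
    qed
    ultimately show ?thesis unfolding err_def kap by simp
  qed
  have "\<forall>\<^sub>F m in sequentially. 1 - err (?n m) \<le> ?p m"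
    using signal level eventually_compose_filterlim[OF small N_inf] eventually_compose_filterlim[OF T1 N_inf]
      eventually_compose_filterlim[OF T2 N_inf] eventually_compose_filterlim[OF T3 N_inf]
    by eventually_elim (rule lower)
  moreover have "(\<lambda>m. 1 - err (?n m)) \<longlonglongrightarrow> 1"
    using tendsto_diff[OF tendsto_const[of 1] filterlim_compose[OF err_lim N_inf]] by simp
  ultimately show ?thesis
    by (intro tendsto_sandwich[of "\<lambda>m. 1 - err (?n m)" ?p sequentially "\<lambda>_. 1"]) auto
qed

end
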